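(* Let $\omega \in (-1/4,1/4)$. Then the Fokker-Planck operator of the chain of oscillators under Neumann boundary conditions, with pinning potential $\eta\geq 0$ and friction at both terminal ends, is hypoelliptic. In particular, the operator exhibits a non-zero spectral gap.
   Context: One-dimensional chain of $N$ oscillators with unit masses, potential $V(q) = \frac{1}{2}\sum_{i=1}^{N-1} (q_i-q_{i+1})^2 + \frac{\omega}{2} \sum_{i=1}^{N-2}(q_i-q_{i+2})^2 + \frac{\eta}{2}\sum_{i=1}^N q_i^2$, and Fokker–Planck generator $\mathcal{L} f(z) = - \langle z, M_{[N]} \nabla_z f(z) \rangle + \langle \nabla_p , \Gamma \vartheta \nabla_p f(z) \rangle$ with $M_{[N]}=\begin{pmatrix}\Gamma & -I\\ B_{[N]} & 0\end{pmatrix}$, $\Gamma=\operatorname{diag}(\gamma_1,0,\dots,0,\gamma_N)$ with $\gamma_1,\gamma_N>0$. Under Neumann (free) boundary conditions $B_{[N]}$ is the matrix of the quadratic form of $V$, which decomposes as $B_{[N]} = T_\omega + \omega P$ with $T_\omega = (1+4\omega)\mathscr V_1 - \omega\mathscr V_1^2 + \eta\operatorname{Id}$, where $\mathscr V_1$ is the discrete Neumann Laplacian (tridiagonal with diagonal $1,2,\dots,2,1$ and $-1$ off the diagonal), and $P=\operatorname{diag}(\Lambda,0,\dots,0,\Lambda)$ with $\Lambda=\begin{pmatrix}-1&1\\1&-1\end{pmatrix}$. $\mathcal L$ is hypoelliptic if every distribution $u$ with $\mathcal L u$ smooth is itself smooth; the spectral gap is $\inf\{\Re\lambda:\lambda\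in\Spec(M_{[N]})\}$.
   Formalization: The non-zero spectral gap is proved only for pinning η > 0: for η = 0 the constant vector lies in the kernel of B, so 0 is an eigenvalue of M and the gap is 0. Hypoellipticity is proved for all η ≥ 0. *)

theory Defs
  imports "HOL-Analysis.Analysis"
begin

text \<open>Phase space R^{2N}: coordinates are indexed by the type 'n + 'n, where
  Inl i is the momentum coordinate p_i and Inr i the position coordinate q_i,
  i.e. z = (p, q).  The chain sites are the elements of the finite type 'n,
  ordered along the chain by a bijection idx onto {0..<N}, N = CARD('n).\<close>

type_synonym 'n phase = "real ^ ('n + 'n)"

definition pd :: "('n::finite + 'n) \<Rightarrow> ('n phase \<Rightarrow> real) \<Rightarrow> 'n phase \<Rightarrow> real"
  where "pd k f z = deriv (\<lambda>t. f (z + t *\<^sub>R axis k 1)) 0"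

fun iterpd :: "('n::finite + 'n) list \<Rightarrow> ('n phase \<Rightarrow> real) \<Rightarrow> 'n phase \<Rightarrow> real"
  where "iterpd [] f = f"
  | "iterpd (k # ks) f = pd k (iterpd ks f)"

definition smooth_fun :: "('n::finite phase \<Rightarrow> real) \<Rightarrow> bool"
  where "smooth_fun f \<longleftrightarrow>
    (\<forall>ks. continuous_on UNIV (iterpd ks f) \<and>
      (\<forall>k z. (\<lambda>t. iterpd ks f (z + t *\<^sub>R axis k 1)) field_differentiable (at 0)))"

definition test_fun :: "('n::finite phase \<Rightarrow> real) \<Rightarrow> bool"
  where "test_fun \<phi> \<longleftrightarrow> smooth_fun \<phi> \<and> compact (closure {z. \<phi> z \<noteq> 0})"

definition distribution :: "(('n::finite phase \<Rightarrow> real) \<Rightarrow> real) \<Rightarrow> bool"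
  where "distribution u \<longleftrightarrow>
    (\<forall>\<phi> \<psi> a b. test_fun \<phi> \<longrightarrow> test_fun \<psi> \<longrightarrow>
        u (\<lambda>z. a * \<phi> z + b * \<psi> z) = a * u \<phi> + b * u \<psi>) \<and>
    (\<forall>K. compact K \<longrightarrow> (\<exists>C m. \<forall>\<phi>. test_fun \<phi> \<and> closure {z. \<phi> z \<noteq> 0} \<subseteq> K \<longrightarrow>
        \<bar>u \<phi>\<bar> \<le> C * (\<Sum>ks\<in>{ks. length ks \<le> m}. (SUP z. \<bar>iterpd ks \<phi> z\<bar>))))"

definition smooth_distribution :: "(('n::finite phase \<Rightarrow> real) \<Rightarrow> real) \<Rightarrow> bool"
  where "smooth_distribution u \<longleftrightarrow>
    (\<exists>f. smooth_fun f \<and> (\<forall>\<phi>. test_fun \<phi> \<longrightarrow> u \<phi> = (LINT z|lborel. f z * \<phi> z)))"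

definition potential :: "('n::finite \<Rightarrow> nat) \<Rightarrow> real \<Rightarrow> real \<Rightarrow> real ^ 'n \<Rightarrow> real"
  where "potential idx \<omega> \<eta> q =
     1/2 * (\<Sum>i\<in>UNIV. \<Sum>j\<in>{j. idx j = idx i + 1}. (q $ i - q $ j)^2)
   + \<omega>/2 * (\<Sum>i\<in>UNIV. \<Sum>j\<in>{j. idx j = idx i + 2}. (q $ i - q $ j)^2)
   + \<eta>/2 * (\<Sum>i\<in>UNIV. (q $ i)^2)"

text \<open>B_[N] (Neumann/free boundary conditions): the matrix of the quadratic form V,
  i.e. V(q) = 1/2 q^T B q, recovered by polarisation.\<close>
definition Bmat :: "('n::finite \<Rightarrow> nat) \<Rightarrow> real \<Rightarrow> real \<Rightarrow> real ^ 'n ^ 'n"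
  where "Bmat idx \<omega> \<eta> = (\<chi> i j. potential idx \<omega> \<eta> (axis i 1 + axis j 1)
                          - potential idx \<omega> \<eta> (axis i 1) - potential idx \<omega> \<eta> (axis j 1))"

definition Mmat :: "('n::finite \<Rightarrow> real) \<Rightarrow> real ^ 'n ^ 'n \<Rightarrow> real ^ ('n + 'n) ^ ('n + 'n)"
  where "Mmat \<gamma> B = (\<chi> a b. case (a, b) of
       (Inl i, Inl j) \<Rightarrow> (if i = j then \<gamma> i else 0)
     | (Inl i, Inr j) \<Rightarrow> (if i = j then -1 else 0)
     | (Inr i, Inl j) \<Rightarrow> B $ i $ j
     | (Inr i, Inr j) \<Rightarrow> 0)"

definition FP_op :: "real ^ ('n::finite + 'n) ^ ('n + 'n) \<Rightarrow> ('n \<Rightarrow> real) \<Rightarrow> ('n \<Rightarrow> real)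
                     \<Rightarrow> ('n phase \<Rightarrow> real) \<Rightarrow> 'n phase \<Rightarrow> real"
  where "FP_op M \<gamma> \<theta> f z =
     - (\<Sum>a\<in>UNIV. \<Sum>b\<in>UNIV. z $ a * M $ a $ b * pd b f z)
     + (\<Sum>i\<in>UNIV. \<gamma> i * \<theta> i * pd (Inl i) (pd (Inl i) f) z)"

definition FP_adj :: "real ^ ('n::finite + 'n) ^ ('n + 'n) \<Rightarrow> ('n \<Rightarrow> real) \<Rightarrow> ('n \<Rightarrow> real)
                     \<Rightarrow> ('n phase \<Rightarrow> real) \<Rightarrow> 'n phase \<Rightarrow> real"
  where "FP_adj M \<gamma> \<theta> \<phi> z =
     (\<Sum>b\<in>UNIV. pd b (\<lambda>w. (\<Sum>a\<in>UNIV. w $ a * M $ a $ b) * \<phi> w) z)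
     + (\<Sum>i\<in>UNIV. \<gamma> i * \<theta> i * pd (Inl i) (pd (Inl i) \<phi>) z)"

definition FP_dist :: "real ^ ('n::finite + 'n) ^ ('n + 'n) \<Rightarrow> ('n \<Rightarrow> real) \<Rightarrow> ('n \<Rightarrow> real)
                     \<Rightarrow> (('n phase \<Rightarrow> real) \<Rightarrow> real) \<Rightarrow> ('n phase \<Rightarrow> real) \<Rightarrow> real"
  where "FP_dist M \<gamma> \<theta> u \<phi> = u (FP_adj M \<gamma> \<theta> \<phi>)"

definition hypoelliptic_FP :: "real ^ ('n::finite + 'n) ^ ('n + 'n) \<Rightarrow> ('n \<Rightarrow> real) \<Rightarrow> ('n \<Rightarrow> real) \<Rightarrow> bool"
  where "hypoelliptic_FP M \<gamma> \<theta> \<longleftrightarrow>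
    (\<forall>u. distribution u \<longrightarrow> smooth_distribution (FP_dist M \<gamma> \<theta> u) \<longrightarrow> smooth_distribution u)"

definition cmat :: "real ^ 'k ^ 'k \<Rightarrow> complex ^ 'k ^ 'k"
  where "cmat A = (\<chi> i j. complex_of_real (A $ i $ j))"

definition mat_spectrum :: "real ^ ('k::finite) ^ 'k \<Rightarrow> complex set"
  where "mat_spectrum A = {c. det (mat c - cmat A) = 0}"

definition spectral_gap :: "real ^ ('k::finite) ^ 'k \<Rightarrow> real"
  where "spectral_gap A = Inf (Re ` mat_spectrum A)"

end

(*
  Hypoellipticity.  For a test function a consider the local Fourier transform
  w(xi) = u(a * cos(xi . x + c)).  Pairing L u with a * cos(xi . x + c) moves the frequency
  along xi' = M xi, and w along such a trajectory satisfies the damped equation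
  w' = q w + h with q = sum_i gamma_i theta_i (xi_i)^2, the sum running over the momentum
  components.  The error h involves the transforms with a replaced by its derivatives,
  multiplied by at most the square root of q.  If w = O(|xi|^k) for all a and the damped components
  observe the flow of M, then q has integral at least C s^m |xi|^2 over [0, s], so the
  damping beats the errors by a fixed power of |xi|.  Iterating, w decays rapidly, and
  a Fourier series represents u by a smooth function on each cube.

  Observability.  An unobservable vector would produce an eigenvector of B vanishing at both
  ends of the chain.  Extended evenly about the ends, it solves the recursion of the factor
  T_omega, a quadratic polynomial in the discrete Laplacian.  The eigenvalue, shifted by the
  pinning, lies in [0, 4], and for |omega| < 1/4 this makes one root of the polynomial lie
  outside [0, 4].  That factor is injective by the maximum principle, and the other factor,
  a three-term recursion, propagates the zero value at the left end.

  Spectrum.  If c is an eigenvalue of M and v the momentum part of its eigenvector, then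
  c^2 |v|^2 - c <v, Gamma v> + <v, B v> = 0 with <v, B v> > 0 when eta > 0; hence
  Re c > 0 unless Gamma v = 0, in which case v would be an eigenvector of B vanishing
  at both ends.
*)

theory Submission
  imports Defs "HOL-Computational_Algebra.Fundamental_Theorem_Algebra"
begin

subsection \<open>Smooth functions and test functions\<close>

text \<open>The obstacle is that \<open>q\<close> sees only the end momenta and may vanish to high
  order in time, so damping shows only after integration over a time T. The cross terms of
  \<open>h\<close> are split by the arithmetic-geometric mean inequality into \<delta> q +
  1/\<delta>. Against exp(-Q) the first part integrates to at most \<delta> and the second to at
  most T/\<delta>; the value at time T enters with the factor exp(-Q(T)). With T = \<delta>^2,
  \<delta> = |\<xi>|^(-\<epsilon>) and \<epsilon> = 1/(2(m+1)) all three are O(\<delta>), and this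
  gain does not depend on the order already reached, so it can be iterated. Since \<open>h\<close>
  contains transforms with differentiated amplitudes, an order of growth has to be asserted for all
  amplitudes on a compact set at once; differentiation does not enlarge supports, so one set serves
  the whole iteration. As distributions act here on real functions, the complex exponential is
  replaced by a cosine with a free phase, and a derivative shifts that phase by pi/2.\<close>

definition has_pd :: "('n::finite + 'n) \<Rightarrow> ('n phase \<Rightarrow> real) \<Rightarrow> ('n phase \<Rightarrow> real) \<Rightarrow> bool"
  where "has_pd k f g \<longleftrightarrow>
    (\<forall>z. ((\<lambda>t. f (z + t *\<^sub>R axis k 1)) has_real_derivative g z) (at 0))"

text \<open>\<open>pd\<close> is a value of \<open>deriv\<close>, which says nothing about
  existence. \<open>has_pd\<close> includes existence and composes, so the calculus is done with it
  and read off for \<open>pd\<close> here.\<close>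

lemma has_pd_imp_pd: "has_pd k f g \<Longrightarrow> pd k f = g"
  by (auto simp: has_pd_def pd_def fun_eq_iff intro: DERIV_imp_deriv)

text \<open>A coinduction principle: if each member of a class of continuous functions has all its
  partial derivatives in the class again, induction on the list keeps every \<open>iterpd\<close> in
  the class.\<close>

lemma smooth_coinduct:
  assumes "P f"
    and step: "\<And>f. P f \<Longrightarrow> continuous_on UNIV f \<and> (\<forall>k. \<exists>g. P g \<and> has_pd k f g)"
  shows "smooth_fun f"
proof -
  have P: "P (iterpd ks f)" for ks
  proof (induction ks)
    case (Cons k ks)
    then obtain g where "P g" "has_pd k (iterpd ks f) g" using step by blast
    then show ?case using has_pd_imp_pd by force
  qed (simp add: assms(1))
  show ?thesis
    unfolding smooth_fun_def
  proof (intro allI conjI)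
    fix ks k z
    show "continuous_on UNIV (iterpd ks f)" using P step by blast
    obtain g where "has_pd k (iterpd ks f) g" using P step by blast
    then show "(\<lambda>t. iterpd ks f (z + t *\<^sub>R axis k 1)) field_differentiable at 0"
      by (auto simp: has_pd_def field_differentiable_def)
  qed
qed

lemma iterpd_snoc: "iterpd (ks @ [k]) f = iterpd ks (pd k f)"
  by (induction ks) auto

lemma smooth_pd: "smooth_fun f \<Longrightarrow> smooth_fun (pd k f)"
  unfolding smooth_fun_def iterpd_snoc[symmetric] by blast

lemma smooth_iterpd: "smooth_fun f \<Longrightarrow> smooth_fun (iterpd ks f)"
  by (induction ks) (auto intro: smooth_pd)

lemma smooth_has_pd: "smooth_fun f \<Longrightarrow> has_pd k f (pd k f)"
  unfolding smooth_fun_def has_pd_def pd_def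
  by (simp add: DERIV_deriv_iff_field_differentiable) (metis iterpd.simps(1))

lemma smooth_continuous: "smooth_fun f \<Longrightarrow> continuous_on UNIV f"
  unfolding smooth_fun_def by (metis iterpd.simps(1))

lemma has_pd_add:
  "has_pd k f f' \<Longrightarrow> has_pd k g g' \<Longrightarrow> has_pd k (\<lambda>z. f z + g z) (\<lambda>z. f' z + g' z)"
  unfolding has_pd_def by (auto intro!: derivative_intros)

lemma has_pd_mult:
  assumes "has_pd k f f'" "has_pd k g g'"
  shows "has_pd k (\<lambda>z. f z * g z) (\<lambda>z. f' z * g z + f z * g' z)"
  unfolding has_pd_def
proof
  fix z
  show "((\<lambda>t. f (z + t *\<^sub>R axis k 1) * g (z + t *\<^sub>R axis k 1)) has_real_derivative
      f' z * g z + f z * g' z) (at 0)"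
    using DERIV_mult[OF assms(1)[unfolded has_pd_def, rule_format, of z]
        assms(2)[unfolded has_pd_def, rule_format, of z]]
    by (simp add: algebra_simps)
qed

lemma has_pd_const: "has_pd k (\<lambda>z. c) (\<lambda>z. 0)"
  unfolding has_pd_def by auto

lemma has_pd_chain:
  assumes "has_pd k f f'" "\<And>z. (h has_real_derivative h' (f z)) (at (f z))"
  shows "has_pd k (\<lambda>z. h (f z)) (\<lambda>z. h' (f z) * f' z)"
  unfolding has_pd_def
proof
  fix z
  show "((\<lambda>t. h (f (z + t *\<^sub>R axis k 1))) has_real_derivative h' (f z) * f' z) (at 0)"
    using DERIV_chain2[of h "h' (f z)" "\<lambda>t. f (z + t *\<^sub>R axis k 1)" 0 "f' z" UNIV]
      assms(1)[unfolded has_pd_def, rule_format, of z] assms(2)[of z]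
    by simp
qed

lemma has_pd_inner: "has_pd k (\<lambda>z. \<xi> \<bullet> z) (\<lambda>z. \<xi> $ k)"
  unfolding has_pd_def
  by (auto simp: inner_add_right inner_axis intro!: derivative_eq_intros)

text \<open>The class for the coinduction. Products alone are not closed under differentiation,
  because the Leibniz rule produces sums, so the whole algebra over the smooth functions generated
  by \<open>G\<close> is taken.\<close>

inductive smooth_alg :: "('n::finite phase \<Rightarrow> real) set \<Rightarrow> ('n phase \<Rightarrow> real) \<Rightarrow> bool"
  for G where
  base: "f \<in> G \<Longrightarrow> smooth_alg G f"
| smooth: "smooth_fun f \<Longrightarrow> smooth_alg G f"
| add: "smooth_alg G f \<Longrightarrow> smooth_alg G g \<Longrightarrow> smooth_alg G (\<lambda>z. f z + g z)"
| mult: "smooth_alg G f \<Longrightarrow> smooth_alg G g \<Longrightarrow> smooth_alg G (\<lambda>z. f z * g z)"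

text \<open>Sums and products inherit derivatives inside the algebra, so only the generators have to
  be differentiated. With \<open>G\<close> empty this yields closure of smooth functions under sums
  and products.\<close>

lemma smooth_alg_smooth:
  assumes G: "\<And>f. f \<in> G \<Longrightarrow> continuous_on UNIV f \<and> (\<forall>k. \<exists>g. smooth_alg G g \<and> has_pd k f g)"
    and "smooth_alg G f"
  shows "smooth_fun f"
proof (rule smooth_coinduct[of "smooth_alg G"])
  fix f assume "smooth_alg G f"
  then show "continuous_on UNIV f \<and> (\<forall>k. \<exists>g. smooth_alg G g \<and> has_pd k f g)"
  proof induction
    case (base f)
    then show ?case using G by blast
  next
    case (smooth f)
    then show ?case
      using smooth_alg.smooth smooth_continuous smooth_has_pd smooth_pd by blast
  next
    case (add f g)
    have "\<exists>h. smooth_alg G h \<and> has_pd k (\<lambda>z. f z + g z) h" for k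
    proof -
      from add obtain f' g' where "smooth_alg G f'" "has_pd k f f'" "smooth_alg G g'" "has_pd k g g'"
        by blast
      then show ?thesis
        by (intro exI[of _ "\<lambda>z. f' z + g' z"] conjI smooth_alg.add has_pd_add)
    qed
    then show ?case using add by (simp add: continuous_on_add)
  next
    case (mult f g)
    have "\<exists>h. smooth_alg G h \<and> has_pd k (\<lambda>z. f z * g z) h" for k
    proof -
      from mult obtain f' g' where "smooth_alg G f'" "has_pd k f f'" "smooth_alg G g'" "has_pd k g g'"
        by blast
      with mult.hyps show ?thesis
        by (intro exI[of _ "\<lambda>z. f' z * g z + f z * g' z"] conjI smooth_alg.add smooth_alg.mult has_pd_mult)
    qed
    then show ?case using mult by (simp add: continuous_on_mult)
  qed
qed (rule assms)

lemma smooth_add: "smooth_fun f \<Longrightarrow> smooth_fun g \<Longrightarrow> smooth_fun (\<lambda>z. f z + g z)"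
  by (rule smooth_alg_smooth[OF _ smooth_alg.add[OF smooth_alg.smooth smooth_alg.smooth], of "{}"]) auto

lemma smooth_mult: "smooth_fun f \<Longrightarrow> smooth_fun g \<Longrightarrow> smooth_fun (\<lambda>z. f z * g z)"
  by (rule smooth_alg_smooth[OF _ smooth_alg.mult[OF smooth_alg.smooth smooth_alg.smooth], of "{}"]) auto

lemma smooth_const: "smooth_fun (\<lambda>z. c)"
proof (rule smooth_coinduct[of "\<lambda>f. \<exists>c. f = (\<lambda>_. c)"])
  fix f :: "'a phase \<Rightarrow> real" assume "\<exists>c. f = (\<lambda>_. c)"
  then obtain c where f: "f = (\<lambda>_. c)" by blast
  have "\<exists>g. (\<exists>c. g = (\<lambda>_. c)) \<and> has_pd k f g" for k
    unfolding f by (rule exI[of _ "\<lambda>_. 0"]) (simp add: has_pd_const exI[of _ 0])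
  then show "continuous_on UNIV f \<and> (\<forall>k. \<exists>g. (\<exists>c. g = (\<lambda>_. c)) \<and> has_pd k f g)"
    by (simp add: f)
qed blast

lemma smooth_inner: "smooth_fun (\<lambda>z. \<xi> \<bullet> z)"
proof (rule smooth_alg_smooth[of "{\<lambda>z. \<xi> \<bullet> z}"])
  have "\<exists>g. smooth_alg {\<lambda>z. \<xi> \<bullet> z} g \<and> has_pd k (\<lambda>z. \<xi> \<bullet> z) g" for k
    by (rule exI[of _ "\<lambda>z. \<xi> $ k"]) (simp add: has_pd_inner smooth_alg.smooth smooth_const)
  then show "continuous_on UNIV f \<and> (\<forall>k. \<exists>g. smooth_alg {\<lambda>z. \<xi> \<bullet> z} g \<and> has_pd k f g)"
    if "f \<in> {\<lambda>z. \<xi> \<bullet> z}" for f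
    using that by (auto intro!: continuous_intros)
qed (simp add: smooth_alg.base)

lemma smooth_nth: "smooth_fun (\<lambda>z. z $ j)"
  using smooth_inner[of "axis j 1"] by (simp add: inner_axis')

lemma smooth_cmult: "smooth_fun f \<Longrightarrow> smooth_fun (\<lambda>z. c * f z)"
  by (intro smooth_mult smooth_const)

lemma smooth_minus: "smooth_fun f \<Longrightarrow> smooth_fun (\<lambda>z. - f z)"
  using smooth_cmult[of f "-1"] by simp

lemma smooth_diff: "smooth_fun f \<Longrightarrow> smooth_fun g \<Longrightarrow> smooth_fun (\<lambda>z. f z - g z)"
  using smooth_add[OF _ smooth_minus, of f g] by simp

lemma smooth_sum: "(\<And>i. i \<in> I \<Longrightarrow> smooth_fun (f i)) \<Longrightarrow> smooth_fun (\<lambda>z. \<Sum>i\<in>I. f i z)"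
  by (induction I rule: infinite_finite_induct) (simp_all add: smooth_add smooth_const)

lemma smooth_prod: "(\<And>i. i \<in> I \<Longrightarrow> smooth_fun (f i)) \<Longrightarrow> smooth_fun (\<lambda>z. \<Prod>i\<in>I. f i z)"
  by (induction I rule: infinite_finite_induct) (simp_all add: smooth_mult smooth_const)

lemma has_pd_cos:
  "has_pd k (\<lambda>z. cos (\<xi> \<bullet> z + c)) (\<lambda>z. \<xi> $ k * cos (\<xi> \<bullet> z + (c + pi/2)))"
proof -
  have "has_pd k (\<lambda>z. \<xi> \<bullet> z + c) (\<lambda>z. \<xi> $ k + 0)"
    by (intro has_pd_add has_pd_inner has_pd_const)
  then have "has_pd k (\<lambda>z. cos (\<xi> \<bullet> z + c)) (\<lambda>z. - sin (\<xi> \<bullet> z + c) * (\<xi> $ k + 0))"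
    by (rule has_pd_chain[where h = cos and h' = "\<lambda>y. - sin y"]) (auto intro!: derivative_eq_intros)
  moreover have "cos (\<xi> \<bullet> z + (c + pi/2)) = - sin (\<xi> \<bullet> z + c)" for z
    by (simp add: minus_sin_cos_eq add.assoc)
  ultimately show ?thesis by (simp add: mult.commute)
qed

text \<open>The generators are the cosines of all phases: a derivative is a multiple of the cosine
  shifted by pi/2.\<close>

lemma smooth_cos: "smooth_fun (\<lambda>z. cos (\<xi> \<bullet> z + c))"
proof (rule smooth_alg_smooth[of "range (\<lambda>c z. cos (\<xi> \<bullet> z + c))"])
  fix f :: "'a phase \<Rightarrow> real" assume "f \<in> range (\<lambda>c z. cos (\<xi> \<bullet> z + c))"
  then obtain c where f: "f = (\<lambda>z. cos (\<xi> \<bullet> z + c))" by blast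
  let ?G = "range (\<lambda>c z. cos (\<xi> \<bullet> z + c))"
  have "\<exists>g. smooth_alg ?G g \<and> has_pd k f g" for k
  proof (intro exI conjI)
    show "has_pd k f (\<lambda>z. \<xi> $ k * cos (\<xi> \<bullet> z + (c + pi/2)))" unfolding f by (rule has_pd_cos)
    show "smooth_alg ?G (\<lambda>z. \<xi> $ k * cos (\<xi> \<bullet> z + (c + pi/2)))"
      by (rule smooth_alg.mult[OF smooth_alg.smooth[OF smooth_const] smooth_alg.base]) blast
  qed
  moreover have "continuous_on UNIV f" unfolding f by (intro continuous_intros)
  ultimately show "continuous_on UNIV f \<and> (\<forall>k. \<exists>g. smooth_alg ?G g \<and> has_pd k f g)" by blast
qed (simp add: smooth_alg.base)

text \<open>One generator suffices, since the derivative of 1/f is - (1/f)(1/f) times a derivative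
  of f.\<close>

lemma smooth_inverse:
  assumes f: "smooth_fun f" and nz: "\<And>z. f z \<noteq> 0"
  shows "smooth_fun (\<lambda>z. inverse (f z))"
proof (rule smooth_alg_smooth[of "{\<lambda>z. inverse (f z)}"])
  have a: "smooth_alg {\<lambda>z. inverse (f z)} (\<lambda>z. (-1 * (inverse (f z) * inverse (f z))) * pd k f z)" for k
    by (intro smooth_alg.mult smooth_alg.smooth[OF smooth_const] smooth_alg.smooth[OF smooth_pd] f
        smooth_alg.base) auto
  have "has_pd k (\<lambda>z. inverse (f z)) (\<lambda>z. (-1 * (inverse (f z) * inverse (f z))) * pd k f z)" for k
    by (rule has_pd_chain[where h = inverse, OF smooth_has_pd[OF f]])
      (auto simp: nz intro!: derivative_eq_intros)
  then show "continuous_on UNIV g \<and> (\<forall>k. \<exists>h. smooth_alg {\<lambda>z. inverse (f z)} h \<and> has_pd k g h)"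
    if "g \<in> {\<lambda>z. inverse (f z)}" for g
    using that a continuous_on_inverse[OF smooth_continuous[OF f]] nz by auto
qed (simp add: smooth_alg.base)

lemma pd_add: "smooth_fun f \<Longrightarrow> smooth_fun g \<Longrightarrow> pd k (\<lambda>z. f z + g z) = (\<lambda>z. pd k f z + pd k g z)"
  by (intro has_pd_imp_pd has_pd_add smooth_has_pd)

lemma pd_mult: "smooth_fun f \<Longrightarrow> smooth_fun g \<Longrightarrow>
    pd k (\<lambda>z. f z * g z) = (\<lambda>z. pd k f z * g z + f z * pd k g z)"
  by (intro has_pd_imp_pd has_pd_mult smooth_has_pd)

lemma pd_cmult: "smooth_fun f \<Longrightarrow> pd k (\<lambda>z. c * f z) = (\<lambda>z. c * pd k f z)"
  using has_pd_imp_pd[OF has_pd_mult[OF has_pd_const smooth_has_pd, of f k c]] by simp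

lemma pd_cos:
  "pd k (\<lambda>z. cos (\<xi> \<bullet> z + c)) = (\<lambda>z. \<xi> $ k * cos (\<xi> \<bullet> z + (c + pi/2)))"
  by (rule has_pd_imp_pd[OF has_pd_cos])

lemma iterpd_add: "smooth_fun f \<Longrightarrow> smooth_fun g \<Longrightarrow>
    iterpd ks (\<lambda>z. f z + g z) = (\<lambda>z. iterpd ks f z + iterpd ks g z)"
  by (induction ks) (auto simp: pd_add smooth_iterpd)

lemma iterpd_cmult: "smooth_fun f \<Longrightarrow> iterpd ks (\<lambda>z. c * f z) = (\<lambda>z. c * iterpd ks f z)"
  by (induction ks) (auto simp: pd_cmult smooth_iterpd)

text \<open>Vanishing off \<open>K\<close> is used in place of a condition on the closure of the
  support: it is visibly stable under linear combinations and multiplication by smooth functions,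
  and for compact \<open>K\<close> it implies \<open>test_fun\<close>.\<close>

definition test_on :: "'n::finite phase set \<Rightarrow> ('n phase \<Rightarrow> real) \<Rightarrow> bool"
  where "test_on K f \<longleftrightarrow> smooth_fun f \<and> (\<forall>z. z \<notin> K \<longrightarrow> f z = 0)"

lemma test_onD: "test_on K f \<Longrightarrow> smooth_fun f" "test_on K f \<Longrightarrow> z \<notin> K \<Longrightarrow> f z = 0"
  by (auto simp: test_on_def)

lemma test_on_support:
  assumes "closed K" "test_on K f"
  shows "closure {z. f z \<noteq> 0} \<subseteq> K"
  using assms by (intro closure_minimal) (auto simp: test_on_def)

lemma test_on_imp_test: "compact K \<Longrightarrow> test_on K f \<Longrightarrow> test_fun f"
  unfolding test_fun_def
  using test_onD(1) test_on_support[of K f] compact_Int_closed[of K "closure {z. f z \<noteq> 0}"]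
  by (auto simp: compact_imp_closed Int_absorb1)

lemma test_imp_test_on: "test_fun f \<Longrightarrow> test_on (closure {z. f z \<noteq> 0}) f"
  unfolding test_fun_def test_on_def using closure_subset[of "{z. f z \<noteq> 0}"] by auto

lemma test_on_mono: "test_on K f \<Longrightarrow> K \<subseteq> L \<Longrightarrow> test_on L f"
  by (auto simp: test_on_def)

lemma pd_cong_open:
  assumes "open S" "z \<in> S" "\<And>y. y \<in> S \<Longrightarrow> f y = g y"
  shows "pd k f z = pd k g z"
proof -
  have "((\<lambda>t. z + t *\<^sub>R axis k 1) \<longlongrightarrow> z + 0 *\<^sub>R axis k 1) (nhds (0::real))"
    by (intro tendsto_intros) (simp add: filterlim_ident)
  then have "\<forall>\<^sub>F t in nhds 0. z + t *\<^sub>R axis k 1 \<in> S"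
    using assms(1,2) by (simp add: topological_tendstoD)
  then have "\<forall>\<^sub>F t in nhds 0. f (z + t *\<^sub>R axis k 1) = g (z + t *\<^sub>R axis k 1)"
    by eventually_elim (rule assms(3))
  then show ?thesis unfolding pd_def by (rule deriv_cong_ev) simp
qed

lemma iterpd_cong_open:
  assumes "open S" "\<And>y. y \<in> S \<Longrightarrow> f y = g y" "z \<in> S"
  shows "iterpd ks f z = iterpd ks g z"
  using assms(3) by (induction ks arbitrary: z) (auto intro: assms pd_cong_open[OF assms(1)])

text \<open>Derivatives are local, and the complement of the closed set \<open>K\<close> is an open
  set on which the function agrees with 0.\<close>

lemma test_on_pd:
  assumes "closed K" "test_on K f"
  shows "test_on K (pd k f)"
proof -
  have "pd k f z = 0" if "z \<notin> K" for z
  proof -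
    have "pd k f z = pd k (\<lambda>_. 0) z"
      using assms that by (intro pd_cong_open[of "- K"]) (auto simp: test_on_def)
    then show ?thesis by (simp add: pd_def)
  qed
  then show ?thesis using assms by (simp add: test_on_def smooth_pd)
qed

lemma test_on_add: "test_on K f \<Longrightarrow> test_on K g \<Longrightarrow> test_on K (\<lambda>z. f z + g z)"
  and test_on_diff: "test_on K f \<Longrightarrow> test_on K g \<Longrightarrow> test_on K (\<lambda>z. f z - g z)"
  and test_on_cmult: "test_on K f \<Longrightarrow> test_on K (\<lambda>z. c * f z)"
  and test_on_mult: "test_on K f \<Longrightarrow> smooth_fun h \<Longrightarrow> test_on K (\<lambda>z. f z * h z)"
  and test_on_mult': "test_on K f \<Longrightarrow> smooth_fun h \<Longrightarrow> test_on K (\<lambda>z. h z * f z)"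
  by (auto simp: test_on_def smooth_add smooth_diff smooth_cmult smooth_mult)

lemma test_on_sum: "(\<And>i. i \<in> I \<Longrightarrow> test_on K (f i)) \<Longrightarrow> test_on K (\<lambda>z. \<Sum>i\<in>I. f i z)"
  by (auto simp: test_on_def smooth_sum)

lemma test_on_bounded:
  assumes "compact K" "test_on K f"
  obtains B where "B \<ge> 0" "\<And>z. \<bar>f z\<bar> \<le> B"
proof -
  have "continuous_on K f"
    using assms(2) continuous_on_subset smooth_continuous test_onD(1) by blast
  then have "bounded (f ` K)" using assms(1) by (simp add: compact_continuous_image compact_imp_bounded)
  then obtain B where B: "\<And>z. z \<in> K \<Longrightarrow> \<bar>f z\<bar> \<le> B" by (auto simp: bounded_iff)
  have "\<bar>f z\<bar> \<le> max B 0" for z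
    using B[of z] test_onD(2)[OF assms(2), of z] by (cases "z \<in> K") auto
  then show ?thesis using that[of "max B 0"] by simp
qed

subsection \<open>Distributions\<close>

text \<open>A single bound for all derivatives up to order \<open>m\<close>. It takes the place of
  the sum of suprema in \<open>distribution\<close>, where boundedness of each set would have to be
  tracked separately.\<close>

definition pd_bound :: "nat \<Rightarrow> ('n::finite phase \<Rightarrow> real) \<Rightarrow> real \<Rightarrow> bool"
  where "pd_bound m f B \<longleftrightarrow> (\<forall>ks z. length ks \<le> m \<longrightarrow> \<bar>iterpd ks f z\<bar> \<le> B)"

lemma distribution_bound:
  fixes u :: "('n::finite phase \<Rightarrow> real) \<Rightarrow> real"
  assumes "distribution u" "compact K"
  obtains C m where "C \<ge> 0" "\<And>\<phi> B. test_on K \<phi> \<Longrightarrow> pd_bound m \<phi> B \<Longrightarrow> \<bar>u \<phi>\<bar> \<le> C * B"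
proof -
  obtain C m where C: "\<And>\<phi>. test_fun \<phi> \<Longrightarrow> closure {z. \<phi> z \<noteq> 0} \<subseteq> K \<Longrightarrow>
      \<bar>u \<phi>\<bar> \<le> C * (\<Sum>ks\<in>{ks. length ks \<le> m}. (SUP z. \<bar>iterpd ks \<phi> z\<bar>))"
    using assms(1)[unfolded distribution_def, THEN conjunct2, rule_format, OF assms(2)] by blast
  define L :: "('n + 'n) list set" where "L = {ks. length ks \<le> m}"
  have "\<bar>u \<phi>\<bar> \<le> (\<bar>C\<bar> * card L) * B" if \<phi>: "test_on K \<phi>" and B: "pd_bound m \<phi> B" for \<phi> B
  proof -
    have b: "\<bar>iterpd ks \<phi> z\<bar> \<le> B" if "ks \<in> L" for ks z
      using that B by (auto simp: pd_bound_def L_def)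
    have ub: "(SUP z. \<bar>iterpd ks \<phi> z\<bar>) \<le> B" if "ks \<in> L" for ks
      by (rule cSUP_least) (auto simp: b that)
    \<comment> \<open>The constant in the definition of a distribution may be negative; nonnegative
      suprema allow it to be replaced by its absolute value.\<close>
    have lb: "0 \<le> (SUP z. \<bar>iterpd ks \<phi> z\<bar>)" if "ks \<in> L" for ks
    proof -
      have "\<bar>iterpd ks \<phi> 0\<bar> \<le> (SUP z. \<bar>iterpd ks \<phi> z\<bar>)"
        by (rule cSUP_upper) (auto intro!: bdd_aboveI[of _ B] simp: b that)
      then show ?thesis by linarith
    qed
    have "(\<Sum>ks\<in>L. (SUP z. \<bar>iterpd ks \<phi> z\<bar>)) \<le> card L * B"
      using sum_bounded_above[of L "\<lambda>ks. (SUP z. \<bar>iterpd ks \<phi> z\<bar>)" B] ub by simp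
    moreover have "0 \<le> (\<Sum>ks\<in>L. (SUP z. \<bar>iterpd ks \<phi> z\<bar>))" by (rule sum_nonneg) (rule lb)
    ultimately have "C * (\<Sum>ks\<in>L. (SUP z. \<bar>iterpd ks \<phi> z\<bar>)) \<le> \<bar>C\<bar> * (card L * B)"
      by (intro mult_mono) auto
    moreover have "\<bar>u \<phi>\<bar> \<le> C * (\<Sum>ks\<in>L. (SUP z. \<bar>iterpd ks \<phi> z\<bar>))"
      unfolding L_def
      by (rule C[OF test_on_imp_test[OF assms(2) \<phi>] test_on_support[OF compact_imp_closed[OF assms(2)] \<phi>]])
    ultimately show ?thesis by (simp add: mult.assoc)
  qed
  then show ?thesis using that[of "\<bar>C\<bar> * card L" m] by simp
qed

lemma dist_lin:
  assumes "distribution u" "compact K" "test_on K \<phi>" "test_on K \<psi>"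
  shows "u (\<lambda>z. a * \<phi> z + b * \<psi> z) = a * u \<phi> + b * u \<psi>"
  using assms(1)[unfolded distribution_def, THEN conjunct1, rule_format,
      OF test_on_imp_test test_on_imp_test, OF assms(2,3,2,4)] .

lemma dist_add:
  assumes "distribution u" "compact K" "test_on K \<phi>" "test_on K \<psi>"
  shows "u (\<lambda>z. \<phi> z + \<psi> z) = u \<phi> + u \<psi>"
  using dist_lin[OF assms, of 1 1] by simp

lemma dist_diff:
  assumes "distribution u" "compact K" "test_on K \<phi>" "test_on K \<psi>"
  shows "u (\<lambda>z. \<phi> z - \<psi> z) = u \<phi> - u \<psi>"
  using dist_lin[OF assms, of 1 "-1"] by simp

lemma dist_cmult:
  assumes "distribution u" "compact K" "test_on K \<phi>"
  shows "u (\<lambda>z. a * \<phi> z) = a * u \<phi>"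
  using dist_lin[OF assms assms(3), of a 0] by simp

lemma dist_zero: "distribution u \<Longrightarrow> u (\<lambda>z. 0) = 0"
  using dist_cmult[of u "{}" "\<lambda>_. 0" 0] by (simp add: test_on_def smooth_const)

lemma dist_sum:
  assumes "distribution u" "compact K" "\<And>i. i \<in> I \<Longrightarrow> test_on K (\<phi> i)"
  shows "u (\<lambda>z. \<Sum>i\<in>I. \<phi> i z) = (\<Sum>i\<in>I. u (\<phi> i))"
  using assms(3)
proof (induction I rule: infinite_finite_induct)
  case (insert i I)
  then have "u (\<lambda>z. \<phi> i z + (\<Sum>j\<in>I. \<phi> j z)) = u (\<phi> i) + u (\<lambda>z. \<Sum>j\<in>I. \<phi> j z)"
    by (intro dist_add[OF assms(1,2)] test_on_sum) auto
  with insert show ?case by simp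
qed (simp_all add: dist_zero assms)

lemma pd_bound_0: "pd_bound 0 f B \<longleftrightarrow> (\<forall>z. \<bar>f z\<bar> \<le> B)"
  by (simp add: pd_bound_def)

lemma pd_bound_le0: "pd_bound m f B \<Longrightarrow> pd_bound 0 f B"
  unfolding pd_bound_def by (metis le0 le_zero_eq)

lemma pd_bound_Suc:
  assumes "\<And>z. \<bar>f z\<bar> \<le> B" "\<And>k. pd_bound m (pd k f) B"
  shows "pd_bound (Suc m) f B"
  unfolding pd_bound_def
proof (intro allI impI)
  fix ks :: "('a + 'a) list" and z assume "length ks \<le> Suc m"
  with assms show "\<bar>iterpd ks f z\<bar> \<le> B"
    by (cases ks rule: rev_cases) (auto simp: iterpd_snoc pd_bound_def)
qed

lemma pd_bound_mono: "pd_bound m f B \<Longrightarrow> B \<le> B' \<Longrightarrow> pd_bound m f B'"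
  unfolding pd_bound_def by (meson order_trans)

lemma pd_bound_add:
  assumes "smooth_fun f" "smooth_fun g" "pd_bound m f B" "pd_bound m g B'"
  shows "pd_bound m (\<lambda>z. f z + g z) (B + B')"
  using assms(3,4) unfolding pd_bound_def iterpd_add[OF assms(1,2)]
  by (meson abs_triangle_ineq add_mono order_trans)

lemma pd_bound_cmult:
  assumes "smooth_fun f" "pd_bound m f B"
  shows "pd_bound m (\<lambda>z. c * f z) (\<bar>c\<bar> * B)"
  using assms unfolding pd_bound_def by (auto simp: iterpd_cmult abs_mult mult_left_mono)

lemma pd_mult_cos:
  assumes "smooth_fun a"
  shows "pd k (\<lambda>z. a z * cos (\<xi> \<bullet> z + c)) =
    (\<lambda>z. pd k a z * cos (\<xi> \<bullet> z + c) + \<xi> $ k * (a z * cos (\<xi> \<bullet> z + (c + pi/2))))"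
  by (simp add: pd_mult[OF assms smooth_cos] pd_cos mult.left_commute)

lemma smooth_mult_cos: "smooth_fun a \<Longrightarrow> smooth_fun (\<lambda>z. a z * cos (\<xi> \<bullet> z + c))"
  by (intro smooth_mult smooth_cos)

text \<open>Each derivative falls either on the amplitude or on the cosine, and in the second case
  costs one factor |\<xi>|. The induction runs over all amplitudes, since the first case changes the
  amplitude.\<close>

lemma pd_bound_mult_cos:
  fixes a :: "'n::finite phase \<Rightarrow> real"
  assumes "compact K" "test_on K a"
  shows "\<exists>C\<ge>0. \<forall>\<xi> c. pd_bound m (\<lambda>z. a z * cos (\<xi> \<bullet> z + c)) (C * (1 + norm \<xi>) ^ m)"
  using assms(2)
proof (induction m arbitrary: a)
  case 0
  obtain B where "B \<ge> 0" "\<And>z. \<bar>a z\<bar> \<le> B" by (rule test_on_bounded[OF assms(1) 0]) blast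
  then have "\<bar>a z * cos t\<bar> \<le> B" for z t
    using mult_mono[of "\<bar>a z\<bar>" B "\<bar>cos t\<bar>" 1] by (simp add: abs_mult)
  then show ?case using \<open>B \<ge> 0\<close> by (auto simp: pd_bound_0 intro!: exI[of _ B])
next
  case (Suc m)
  have sm: "smooth_fun a" using Suc.prems by (simp add: test_on_def)
  obtain B where B: "B \<ge> 0" "\<And>z. \<bar>a z\<bar> \<le> B" by (rule test_on_bounded[OF assms(1) Suc.prems]) blast
  have Bc: "\<bar>a z * cos t\<bar> \<le> B" for z t
    using mult_mono[of "\<bar>a z\<bar>" B "\<bar>cos t\<bar>" 1] B by (simp add: abs_mult)
  have "\<exists>C\<ge>0. \<forall>\<xi> c. pd_bound m (\<lambda>z. pd k a z * cos (\<xi> \<bullet> z + c)) (C * (1 + norm \<xi>) ^ m)" for k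
    by (rule Suc.IH[OF test_on_pd[OF compact_imp_closed[OF assms(1)] Suc.prems]])
  then obtain C where C: "\<And>k. C k \<ge> 0"
    "\<And>k \<xi> c. pd_bound m (\<lambda>z. pd k a z * cos (\<xi> \<bullet> z + c)) (C k * (1 + norm \<xi>) ^ m)"
    by metis
  obtain C' where C': "C' \<ge> 0"
    "\<And>\<xi> c. pd_bound m (\<lambda>z. a z * cos (\<xi> \<bullet> z + c)) (C' * (1 + norm \<xi>) ^ m)"
    using Suc.IH[OF Suc.prems] by blast
  define D where "D = B + (\<Sum>k\<in>UNIV. C k) + C'"
  have CD: "C k + C' \<le> D" for k
    using member_le_sum[of k UNIV C] C(1) B(1) by (auto simp: D_def)
  have D0: "D \<ge> B" "D \<ge> 0" using C(1) C'(1) B(1) by (auto simp: D_def sum_nonneg)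
  have "pd_bound (Suc m) (\<lambda>z. a z * cos (\<xi> \<bullet> z + c)) (D * (1 + norm \<xi>) ^ Suc m)" for \<xi> c
  proof (rule pd_bound_Suc)
    have p: "(1 + norm \<xi>) ^ Suc m \<ge> 1" by (intro one_le_power) simp
    have "D * 1 \<le> D * (1 + norm \<xi>) ^ Suc m" using p D0 by (intro mult_left_mono) auto
    then show "\<bar>a z * cos (\<xi> \<bullet> z + c)\<bar> \<le> D * (1 + norm \<xi>) ^ Suc m" for z
      using Bc[of z "\<xi> \<bullet> z + c"] D0(1) by linarith
    fix k
    have "pd_bound m (\<lambda>z. pd k a z * cos (\<xi> \<bullet> z + c) + \<xi> $ k * (a z * cos (\<xi> \<bullet> z + (c + pi/2))))
        (C k * (1 + norm \<xi>) ^ m + \<bar>\<xi> $ k\<bar> * (C' * (1 + norm \<xi>) ^ m))"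
      by (intro pd_bound_add pd_bound_cmult smooth_cmult smooth_mult_cos smooth_pd sm C C')
    moreover have "C k * (1 + norm \<xi>) ^ m + \<bar>\<xi> $ k\<bar> * (C' * (1 + norm \<xi>) ^ m)
        \<le> D * (1 + norm \<xi>) ^ Suc m"
    proof -
      have "C k + \<bar>\<xi> $ k\<bar> * C' \<le> (C k + C') * (1 + norm \<xi>)"
        using mult_right_mono[OF component_le_norm_cart[of \<xi> k] C'(1)] C'(1)
          mult_nonneg_nonneg[OF C(1)[of k] norm_ge_zero[of \<xi>]]
        by (simp add: algebra_simps)
      also have "\<dots> \<le> D * (1 + norm \<xi>)" by (intro mult_right_mono CD) simp
      finally have "(C k + \<bar>\<xi> $ k\<bar> * C') * (1 + norm \<xi>) ^ m \<le> D * (1 + norm \<xi>) * (1 + norm \<xi>) ^ m"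
        by (rule mult_right_mono) simp
      then show ?thesis by (simp add: algebra_simps)
    qed
    ultimately show "pd_bound m (pd k (\<lambda>z. a z * cos (\<xi> \<bullet> z + c))) (D * (1 + norm \<xi>) ^ Suc m)"
      unfolding pd_mult_cos[OF sm] by (rule pd_bound_mono)
  qed
  then show ?case using D0 by blast
qed

section \<open>Differentiating oscillatory pairings with respect to the frequency\<close>

lemma cos_diff_le: "\<bar>cos (x + h) - cos x\<bar> \<le> \<bar>h::real\<bar>"
proof -
  have "norm (cos (x + h) - cos x) \<le> 1 * norm ((x + h) - x)"
    by (rule field_differentiable_bound[of UNIV cos "\<lambda>x. - sin x"]) (auto intro!: derivative_eq_intros)
  then show ?thesis by simp
qed

text \<open>The mean value bound is applied to cos t + t sin x, whose derivative sin x - sin t is at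
  most |h| between x and x + h. The constant 1 in place of 1/2 is enough for
  differentiability.\<close>

lemma cos_taylor2: "\<bar>cos (x + h) - cos x + h * sin x\<bar> \<le> (h::real)\<^sup>2"
proof -
  have "norm ((cos (x + h) + h * 0 + (x+h) * sin x) - (cos x + x * sin x)) \<le> \<bar>h\<bar> * norm ((x + h) - x)"
  proof -
    have "norm ((\<lambda>t. cos t + t * sin x) (x+h) - (\<lambda>t. cos t + t * sin x) x) \<le> \<bar>h\<bar> * norm ((x + h) - x)"
    proof (rule field_differentiable_bound[of "closed_segment x (x+h)" _ "\<lambda>t. - sin t + sin x"])
      fix t assume t: "t \<in> closed_segment x (x+h)"
      show "((\<lambda>t. cos t + t * sin x) has_field_derivative - sin t + sin x)
          (at t within closed_segment x (x+h))"
        by (auto intro!: derivative_eq_intros)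
      have "\<bar>t - x\<bar> \<le> \<bar>h\<bar>" using t by (auto simp: closed_segment_eq_real_ivl split: if_splits)
      moreover have "\<bar>sin x - sin t\<bar> \<le> \<bar>x - t\<bar>"
        using cos_diff_le[of "t - pi/2" "x - t"] by (simp add: cos_sin_eq[symmetric] cos_diff)
      ultimately show "norm (- sin t + sin x) \<le> \<bar>h\<bar>" by simp
    qed auto
    then show ?thesis by simp
  qed
  then show ?thesis by (simp add: algebra_simps power2_eq_square abs_mult[symmetric])
qed

lemma has_pd_cong:
  "has_pd k f g \<Longrightarrow> (\<And>z. f z = f' z) \<Longrightarrow> (\<And>z. g z = g' z) \<Longrightarrow> has_pd k f' g'"
  by (simp add: has_pd_def)

text \<open>The difference of cosines is reproduced with a shifted phase, up to one term that
  carries the small factor \<delta>. This self-similarity closes the induction on the order of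
  derivatives.\<close>

lemma pd_mult_cos_diff:
  assumes "smooth_fun a"
  shows "pd k (\<lambda>z. a z * (cos ((\<xi> + \<delta>) \<bullet> z + c) - cos (\<xi> \<bullet> z + c))) =
    (\<lambda>z. pd k a z * (cos ((\<xi> + \<delta>) \<bullet> z + c) - cos (\<xi> \<bullet> z + c))
      + (\<xi> $ k * (a z * (cos ((\<xi> + \<delta>) \<bullet> z + (c + pi/2)) - cos (\<xi> \<bullet> z + (c + pi/2))))
      + \<delta> $ k * (a z * cos ((\<xi> + \<delta>) \<bullet> z + (c + pi/2)))))"
proof (rule has_pd_imp_pd)
  have "has_pd k (\<lambda>z. cos ((\<xi> + \<delta>) \<bullet> z + c) + (-1) * cos (\<xi> \<bullet> z + c))
      (\<lambda>z. (\<xi> + \<delta>) $ k * cos ((\<xi> + \<delta>) \<bullet> z + (c + pi/2))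
        + (0 * cos (\<xi> \<bullet> z + c) + (-1) * (\<xi> $ k * cos (\<xi> \<bullet> z + (c + pi/2)))))"
    by (rule has_pd_add[OF has_pd_cos has_pd_mult[OF has_pd_const has_pd_cos]])
  from has_pd_mult[OF smooth_has_pd[OF assms, of k] this]
  show "has_pd k (\<lambda>z. a z * (cos ((\<xi> + \<delta>) \<bullet> z + c) - cos (\<xi> \<bullet> z + c)))
    (\<lambda>z. pd k a z * (cos ((\<xi> + \<delta>) \<bullet> z + c) - cos (\<xi> \<bullet> z + c))
      + (\<xi> $ k * (a z * (cos ((\<xi> + \<delta>) \<bullet> z + (c + pi/2)) - cos (\<xi> \<bullet> z + (c + pi/2))))
      + \<delta> $ k * (a z * cos ((\<xi> + \<delta>) \<bullet> z + (c + pi/2)))))"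
    by (rule has_pd_cong) (simp_all add: algebra_simps)
qed

lemma pd_mult_cos_diff2:
  assumes "smooth_fun a"
  shows "pd k (\<lambda>z. a z * (cos ((\<xi> + \<delta>) \<bullet> z + c) - cos (\<xi> \<bullet> z + c)
        - (\<delta> \<bullet> z) * cos (\<xi> \<bullet> z + (c + pi/2)))) =
    (\<lambda>z. pd k a z * (cos ((\<xi> + \<delta>) \<bullet> z + c) - cos (\<xi> \<bullet> z + c)
        - (\<delta> \<bullet> z) * cos (\<xi> \<bullet> z + (c + pi/2)))
      + (\<xi> $ k * (a z * (cos ((\<xi> + \<delta>) \<bullet> z + (c + pi/2)) - cos (\<xi> \<bullet> z + (c + pi/2))
        - (\<delta> \<bullet> z) * cos (\<xi> \<bullet> z + (c + pi/2 + pi/2))))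
      + \<delta> $ k * (a z * (cos ((\<xi> + \<delta>) \<bullet> z + (c + pi/2)) - cos (\<xi> \<bullet> z + (c + pi/2))))))"
    (is "pd k ?f = ?g")
proof (rule has_pd_imp_pd)
  have "has_pd k (\<lambda>z. (cos ((\<xi> + \<delta>) \<bullet> z + c) + (-1) * cos (\<xi> \<bullet> z + c))
        + (-1) * ((\<delta> \<bullet> z) * cos (\<xi> \<bullet> z + (c + pi/2))))
      (\<lambda>z. ((\<xi> + \<delta>) $ k * cos ((\<xi> + \<delta>) \<bullet> z + (c + pi/2))
        + (0 * cos (\<xi> \<bullet> z + c) + (-1) * (\<xi> $ k * cos (\<xi> \<bullet> z + (c + pi/2)))))
        + (0 * ((\<delta> \<bullet> z) * cos (\<xi> \<bullet> z + (c + pi/2)))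
           + (-1) * (\<delta> $ k * cos (\<xi> \<bullet> z + (c + pi/2))
              + (\<delta> \<bullet> z) * (\<xi> $ k * cos (\<xi> \<bullet> z + (c + pi/2 + pi/2))))))"
    by (intro has_pd_add[OF has_pd_add[OF has_pd_cos has_pd_mult[OF has_pd_const has_pd_cos]]
         has_pd_mult[OF has_pd_const has_pd_mult[OF has_pd_inner has_pd_cos]]])
  from has_pd_mult[OF smooth_has_pd[OF assms, of k] this]
  show "has_pd k ?f ?g"
    by (rule has_pd_cong) (simp_all add: algebra_simps)
qed

lemma smooth_mult_cos_diff:
  "smooth_fun a \<Longrightarrow> smooth_fun (\<lambda>z. a z * (cos (\<zeta> \<bullet> z + d) - cos (\<xi> \<bullet> z + c)))"
  by (rule smooth_mult[OF _ smooth_diff[OF smooth_cos smooth_cos]])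

lemma smooth_mult_cos_diff2:
  "smooth_fun a \<Longrightarrow> smooth_fun (\<lambda>z. a z * (cos (\<zeta> \<bullet> z + d) - cos (\<xi> \<bullet> z + c)
      - (\<delta> \<bullet> z) * cos (\<xi> \<bullet> z + e)))"
  by (rule smooth_mult[OF _ smooth_diff[OF smooth_diff[OF smooth_cos smooth_cos]
        smooth_mult[OF smooth_inner smooth_cos]]])

text \<open>A Lipschitz bound in the frequency, uniform over derivatives up to order
  \<open>m\<close>. The cap \<open>R\<close> on |\<xi>| absorbs the frequency factors that
  derivatives produce; compactness of \<open>K\<close> bounds \<delta> \<bullet> z.\<close>

lemma pd_bound_mult_cos_diff:
  fixes a :: "'n::finite phase \<Rightarrow> real"
  assumes K: "compact K" and "test_on K a" and "R \<ge> 0"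
  shows "\<exists>C\<ge>0. \<forall>\<xi> \<delta> c. norm \<xi> \<le> R \<longrightarrow> norm \<delta> \<le> 1 \<longrightarrow>
    pd_bound m (\<lambda>z. a z * (cos ((\<xi> + \<delta>) \<bullet> z + c) - cos (\<xi> \<bullet> z + c))) (C * norm \<delta>)"
  using assms(2)
proof (induction m arbitrary: a)
  case 0
  obtain B where B: "B \<ge> 0" "\<And>z. \<bar>a z\<bar> \<le> B" by (rule test_on_bounded[OF K 0]) blast
  obtain L where L: "L > 0" "\<And>z. z \<in> K \<Longrightarrow> norm z \<le> L"
    using compact_imp_bounded[OF K] unfolding bounded_pos by blast
  have "\<bar>a z * (cos ((\<xi> + \<delta>) \<bullet> z + c) - cos (\<xi> \<bullet> z + c))\<bar> \<le> B * L * norm \<delta>" for z \<xi> \<delta> c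
  proof (cases "z \<in> K")
    case True
    have "\<bar>cos ((\<xi> + \<delta>) \<bullet> z + c) - cos (\<xi> \<bullet> z + c)\<bar> \<le> \<bar>\<delta> \<bullet> z\<bar>"
      using cos_diff_le[of "\<xi> \<bullet> z + c" "\<delta> \<bullet> z"] by (simp add: inner_add_left add_ac)
    also have "\<dots> \<le> norm \<delta> * norm z" by (rule Cauchy_Schwarz_ineq2)
    also have "\<dots> \<le> norm \<delta> * L" using L(2)[OF True] by (intro mult_left_mono) auto
    finally have "\<bar>a z\<bar> * \<bar>cos ((\<xi> + \<delta>) \<bullet> z + c) - cos (\<xi> \<bullet> z + c)\<bar> \<le> B * (norm \<delta> * L)"
      using B by (intro mult_mono) auto
    then show ?thesis by (simp add: abs_mult mult_ac)
  next
    case False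
    then have "a z = 0" using 0 by (simp add: test_on_def)
    then show ?thesis using B(1) L(1) by simp
  qed
  then show ?case using B(1) L(1) by (auto simp: pd_bound_0 intro!: exI[of _ "B * L"])
next
  case (Suc m)
  have sm: "smooth_fun a" using Suc.prems by (simp add: test_on_def)
  let ?d = "\<lambda>a \<xi> \<delta> c z. a z * (cos ((\<xi> + \<delta>) \<bullet> z + c) - cos (\<xi> \<bullet> z + c))"
  have "\<exists>C\<ge>0. \<forall>\<xi> \<delta> c. norm \<xi> \<le> R \<longrightarrow> norm \<delta> \<le> 1 \<longrightarrow>
    pd_bound m (?d (pd k a) \<xi> \<delta> c) (C * norm \<delta>)" for k
    by (rule Suc.IH[OF test_on_pd[OF compact_imp_closed[OF K] Suc.prems]])
  from choice[OF allI[OF this]] obtain C where C': "\<forall>k. 0 \<le> C k \<and> (\<forall>\<xi> \<delta> c. norm \<xi> \<le> R \<longrightarrow> norm \<delta> \<le> 1 \<longrightarrow>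
    pd_bound m (?d (pd k a) \<xi> \<delta> c) (C k * norm \<delta>))" ..
  then have C: "\<And>k. C k \<ge> 0" "\<And>k \<xi> \<delta> c. norm \<xi> \<le> R \<Longrightarrow> norm \<delta> \<le> 1 \<Longrightarrow>
    pd_bound m (?d (pd k a) \<xi> \<delta> c) (C k * norm \<delta>)"
    by simp_all
  obtain C' where C': "C' \<ge> 0" "\<And>\<xi> \<delta> c. norm \<xi> \<le> R \<Longrightarrow> norm \<delta> \<le> 1 \<Longrightarrow>
    pd_bound m (?d a \<xi> \<delta> c) (C' * norm \<delta>)"
    using Suc.IH[OF Suc.prems] by blast
  obtain E where E: "E \<ge> 0" "\<And>\<xi> c. pd_bound m (\<lambda>z. a z * cos (\<xi> \<bullet> z + c)) (E * (1 + norm \<xi>) ^ m)"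
    using pd_bound_mult_cos[OF K Suc.prems] by blast
  obtain B where B: "B \<ge> 0" "\<And>\<xi> \<delta> c. norm \<xi> \<le> R \<Longrightarrow> norm \<delta> \<le> 1 \<Longrightarrow>
    pd_bound 0 (?d a \<xi> \<delta> c) (B * norm \<delta>)"
  proof -
    have "pd_bound 0 (?d a \<xi> \<delta> c) (C' * norm \<delta>)" if "norm \<xi> \<le> R" "norm \<delta> \<le> 1" for \<xi> \<delta> c
      using C'(2)[OF that, of c] by (rule pd_bound_le0)
    then show ?thesis using that[OF C'(1)] by blast
  qed
  define D where "D = B + (\<Sum>k\<in>UNIV. C k) + (R * C' + E * (2 + R) ^ m)"
  have nn: "R * C' \<ge> 0" "E * (2 + R) ^ m \<ge> 0" using \<open>R \<ge> 0\<close> C'(1) E(1) by auto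
  have CD: "C k + R * C' + E * (2 + R) ^ m \<le> D" for k
    using member_le_sum[of k UNIV C] C(1) B(1) nn by (auto simp: D_def)
  have D0: "D \<ge> B" "D \<ge> 0" using C(1) nn B(1) by (auto simp: D_def sum_nonneg)
  have "pd_bound (Suc m) (?d a \<xi> \<delta> c) (D * norm \<delta>)" if le: "norm \<xi> \<le> R" "norm \<delta> \<le> 1" for \<xi> \<delta> c
  proof (rule pd_bound_Suc)
    show "\<bar>?d a \<xi> \<delta> c z\<bar> \<le> D * norm \<delta>" for z
      using B(2)[OF le, of c] mult_right_mono[OF D0(1) norm_ge_zero[of \<delta>]]
      unfolding pd_bound_0 by (meson order_trans)
    fix k
    have "pd_bound m (\<lambda>z. ?d (pd k a) \<xi> \<delta> c z + (\<xi> $ k * ?d a \<xi> \<delta> (c + pi/2) z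
        + \<delta> $ k * (a z * cos ((\<xi> + \<delta>) \<bullet> z + (c + pi/2)))))
        (C k * norm \<delta> + (\<bar>\<xi> $ k\<bar> * (C' * norm \<delta>) + \<bar>\<delta> $ k\<bar> * (E * (1 + norm (\<xi> + \<delta>)) ^ m)))"
      by (intro pd_bound_add pd_bound_cmult smooth_cmult smooth_add smooth_mult_cos smooth_mult_cos_diff
          smooth_pd sm C(2) C'(2) E(2) le)
    moreover have "C k * norm \<delta> + (\<bar>\<xi> $ k\<bar> * (C' * norm \<delta>) + \<bar>\<delta> $ k\<bar> * (E * (1 + norm (\<xi> + \<delta>)) ^ m))
        \<le> D * norm \<delta>"
    proof -
      have 1: "\<bar>\<xi> $ k\<bar> * (C' * norm \<delta>) \<le> R * (C' * norm \<delta>)"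
        using component_le_norm_cart[of \<xi> k] le(1) C'(1) by (intro mult_right_mono) auto
      have "(1 + norm (\<xi> + \<delta>)) ^ m \<le> (2 + R) ^ m"
        using norm_triangle_ineq[of \<xi> \<delta>] le by (intro power_mono) auto
      then have "\<bar>\<delta> $ k\<bar> * (E * (1 + norm (\<xi> + \<delta>)) ^ m) \<le> norm \<delta> * (E * (2 + R) ^ m)"
        using component_le_norm_cart[of \<delta> k] E(1) by (intro mult_mono) auto
      with 1 have "C k * norm \<delta> + (\<bar>\<xi> $ k\<bar> * (C' * norm \<delta>) + \<bar>\<delta> $ k\<bar> * (E * (1 + norm (\<xi> + \<delta>)) ^ m))
          \<le> (C k + R * C' + E * (2 + R) ^ m) * norm \<delta>"
        by (simp add: algebra_simps)
      also have "\<dots> \<le> D * norm \<delta>" by (intro mult_right_mono CD) simp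
      finally show ?thesis .
    qed
    ultimately show "pd_bound m (pd k (?d a \<xi> \<delta> c)) (D * norm \<delta>)"
      unfolding pd_mult_cos_diff[OF sm] by (rule pd_bound_mono)
  qed
  then show ?case using D0 by blast
qed

text \<open>The first-order Taylor remainder is quadratic in \<delta> in every derivative up to
  order \<open>m\<close>, not only pointwise; a distribution of order \<open>m\<close> on
  \<open>K\<close> needs this. Differentiation returns a remainder of the same kind plus \<delta>
  times a first-order difference, which is again quadratic.\<close>

lemma pd_bound_mult_cos_diff2:
  fixes a :: "'n::finite phase \<Rightarrow> real"
  assumes K: "compact K" and "test_on K a" and "R \<ge> 0"
  shows "\<exists>C\<ge>0. \<forall>\<xi> \<delta> c. norm \<xi> \<le> R \<longrightarrow> norm \<delta> \<le> 1 \<longrightarrow>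
    pd_bound m (\<lambda>z. a z * (cos ((\<xi> + \<delta>) \<bullet> z + c) - cos (\<xi> \<bullet> z + c)
        - (\<delta> \<bullet> z) * cos (\<xi> \<bullet> z + (c + pi/2)))) (C * (norm \<delta>)\<^sup>2)"
  using assms(2)
proof (induction m arbitrary: a)
  case 0
  obtain B where B: "B \<ge> 0" "\<And>z. \<bar>a z\<bar> \<le> B" by (rule test_on_bounded[OF K 0]) blast
  obtain L where L: "L > 0" "\<And>z. z \<in> K \<Longrightarrow> norm z \<le> L"
    using compact_imp_bounded[OF K] unfolding bounded_pos by blast
  have "\<bar>a z * (cos ((\<xi> + \<delta>) \<bullet> z + c) - cos (\<xi> \<bullet> z + c)
        - (\<delta> \<bullet> z) * cos (\<xi> \<bullet> z + (c + pi/2)))\<bar> \<le> B * L\<^sup>2 * (norm \<delta>)\<^sup>2" for z \<xi> \<delta> c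
  proof (cases "z \<in> K")
    case True
    have "cos (\<xi> \<bullet> z + (c + pi/2)) = - sin (\<xi> \<bullet> z + c)"
      by (simp add: minus_sin_cos_eq add.assoc)
    then have "\<bar>cos ((\<xi> + \<delta>) \<bullet> z + c) - cos (\<xi> \<bullet> z + c) - (\<delta> \<bullet> z) * cos (\<xi> \<bullet> z + (c + pi/2))\<bar>
        \<le> (\<delta> \<bullet> z)\<^sup>2"
      using cos_taylor2[of "\<xi> \<bullet> z + c" "\<delta> \<bullet> z"] by (simp add: inner_add_left add_ac)
    also have "\<dots> \<le> (norm \<delta> * norm z)\<^sup>2"
      using Cauchy_Schwarz_ineq2[of \<delta> z] by (metis abs_ge_zero power2_abs power_mono)
    also have "\<dots> \<le> (norm \<delta> * L)\<^sup>2" using L(2)[OF True] by (intro power_mono mult_left_mono) auto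
    finally have "\<bar>a z\<bar> * \<bar>cos ((\<xi> + \<delta>) \<bullet> z + c) - cos (\<xi> \<bullet> z + c)
        - (\<delta> \<bullet> z) * cos (\<xi> \<bullet> z + (c + pi/2))\<bar> \<le> B * (norm \<delta> * L)\<^sup>2"
      using B by (intro mult_mono) auto
    then show ?thesis by (simp add: abs_mult power_mult_distrib mult_ac)
  next
    case False
    then have "a z = 0" using 0 by (simp add: test_on_def)
    then show ?thesis using B(1) L(1) by simp
  qed
  then show ?case using B(1) L(1) by (auto simp: pd_bound_0 intro!: exI[of _ "B * L\<^sup>2"])
next
  case (Suc m)
  have sm: "smooth_fun a" using Suc.prems by (simp add: test_on_def)
  let ?d = "\<lambda>a \<xi> \<delta> c z. a z * (cos ((\<xi> + \<delta>) \<bullet> z + c) - cos (\<xi> \<bullet> z + c))"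
  let ?F = "\<lambda>a \<xi> \<delta> c z. a z * (cos ((\<xi> + \<delta>) \<bullet> z + c) - cos (\<xi> \<bullet> z + c)
        - (\<delta> \<bullet> z) * cos (\<xi> \<bullet> z + (c + pi/2)))"
  have "\<exists>C\<ge>0. \<forall>\<xi> \<delta> c. norm \<xi> \<le> R \<longrightarrow> norm \<delta> \<le> 1 \<longrightarrow>
    pd_bound m (?F (pd k a) \<xi> \<delta> c) (C * (norm \<delta>)\<^sup>2)" for k
    by (rule Suc.IH[OF test_on_pd[OF compact_imp_closed[OF K] Suc.prems]])
  from choice[OF allI[OF this]] obtain C where C': "\<forall>k. 0 \<le> C k \<and> (\<forall>\<xi> \<delta> c. norm \<xi> \<le> R \<longrightarrow> norm \<delta> \<le> 1 \<longrightarrow>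
    pd_bound m (?F (pd k a) \<xi> \<delta> c) (C k * (norm \<delta>)\<^sup>2))" ..
  then have C: "\<And>k. C k \<ge> 0" "\<And>k \<xi> \<delta> c. norm \<xi> \<le> R \<Longrightarrow> norm \<delta> \<le> 1 \<Longrightarrow>
    pd_bound m (?F (pd k a) \<xi> \<delta> c) (C k * (norm \<delta>)\<^sup>2)"
    by simp_all
  obtain C' where C': "C' \<ge> 0" "\<And>\<xi> \<delta> c. norm \<xi> \<le> R \<Longrightarrow> norm \<delta> \<le> 1 \<Longrightarrow>
    pd_bound m (?F a \<xi> \<delta> c) (C' * (norm \<delta>)\<^sup>2)"
    using Suc.IH[OF Suc.prems] by blast
  obtain E where E: "E \<ge> 0" "\<And>\<xi> \<delta> c. norm \<xi> \<le> R \<Longrightarrow> norm \<delta> \<le> 1 \<Longrightarrow>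
    pd_bound m (?d a \<xi> \<delta> c) (E * norm \<delta>)"
    using pd_bound_mult_cos_diff[OF K Suc.prems assms(3)] by blast
  have B: "pd_bound 0 (?F a \<xi> \<delta> c) (C' * (norm \<delta>)\<^sup>2)" if "norm \<xi> \<le> R" "norm \<delta> \<le> 1" for \<xi> \<delta> c
    using C'(2)[OF that, of c] by (rule pd_bound_le0)
  define D where "D = C' + (\<Sum>k\<in>UNIV. C k) + (R * C' + E)"
  have nn: "R * C' \<ge> 0" using \<open>R \<ge> 0\<close> C'(1) by auto
  have CD: "C k + R * C' + E \<le> D" for k
    using member_le_sum[of k UNIV C] C(1) C'(1) nn E(1) by (auto simp: D_def)
  have D0: "D \<ge> C'" "D \<ge> 0" using C(1) nn C'(1) E(1) by (auto simp: D_def sum_nonneg)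
  have "pd_bound (Suc m) (?F a \<xi> \<delta> c) (D * (norm \<delta>)\<^sup>2)" if le: "norm \<xi> \<le> R" "norm \<delta> \<le> 1" for \<xi> \<delta> c
  proof (rule pd_bound_Suc)
    show "\<bar>?F a \<xi> \<delta> c z\<bar> \<le> D * (norm \<delta>)\<^sup>2" for z
      using B[OF le, of c] mult_right_mono[OF D0(1) zero_le_power2[of "norm \<delta>"]]
      unfolding pd_bound_0 by (meson order_trans)
    fix k
    have "pd_bound m (\<lambda>z. ?F (pd k a) \<xi> \<delta> c z + (\<xi> $ k * ?F a \<xi> \<delta> (c + pi/2) z
        + \<delta> $ k * ?d a \<xi> \<delta> (c + pi/2) z))
        (C k * (norm \<delta>)\<^sup>2 + (\<bar>\<xi> $ k\<bar> * (C' * (norm \<delta>)\<^sup>2) + \<bar>\<delta> $ k\<bar> * (E * norm \<delta>)))"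
      by (intro pd_bound_add pd_bound_cmult smooth_cmult smooth_add smooth_mult_cos_diff
          smooth_mult_cos_diff2 smooth_pd sm C(2) C'(2) E(2) le)
    moreover have "C k * (norm \<delta>)\<^sup>2 + (\<bar>\<xi> $ k\<bar> * (C' * (norm \<delta>)\<^sup>2) + \<bar>\<delta> $ k\<bar> * (E * norm \<delta>))
        \<le> D * (norm \<delta>)\<^sup>2"
    proof -
      have 1: "\<bar>\<xi> $ k\<bar> * (C' * (norm \<delta>)\<^sup>2) \<le> R * (C' * (norm \<delta>)\<^sup>2)"
        using component_le_norm_cart[of \<xi> k] le(1) C'(1) by (intro mult_right_mono) auto
      have "\<bar>\<delta> $ k\<bar> * (E * norm \<delta>) \<le> norm \<delta> * (E * norm \<delta>)"
        using component_le_norm_cart[of \<delta> k] E(1) by (intro mult_right_mono) auto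
      with 1 have "C k * (norm \<delta>)\<^sup>2 + (\<bar>\<xi> $ k\<bar> * (C' * (norm \<delta>)\<^sup>2) + \<bar>\<delta> $ k\<bar> * (E * norm \<delta>))
          \<le> (C k + R * C' + E) * (norm \<delta>)\<^sup>2"
        by (simp add: algebra_simps power2_eq_square)
      also have "\<dots> \<le> D * (norm \<delta>)\<^sup>2" by (intro mult_right_mono CD) simp
      finally show ?thesis .
    qed
    ultimately show "pd_bound m (pd k (?F a \<xi> \<delta> c)) (D * (norm \<delta>)\<^sup>2)"
      unfolding pd_mult_cos_diff2[OF sm] by (rule pd_bound_mono)
  qed
  then show ?case using D0 by blast
qed

lemma test_on_mult_cos: "test_on K a \<Longrightarrow> test_on K (\<lambda>z. a z * cos (\<xi> \<bullet> z + c))"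
  by (rule test_on_mult[OF _ smooth_cos])

text \<open>Differentiation under \<open>u\<close>: the transform is Frechet differentiable in the
  frequency, because the Taylor remainder is small in the seminorm that controls \<open>u\<close> on
  \<open>K\<close>. The chain rule along \<open>y\<close> then gives the claim.\<close>

lemma distribution_cos_derivative:
  assumes u: "distribution u" and K: "compact K" and a: "test_on K a"
    and y: "(y has_vector_derivative y') (at s)"
  shows "((\<lambda>s. u (\<lambda>z. a z * cos (y s \<bullet> z + c))) has_real_derivative
      u (\<lambda>z. a z * (y' \<bullet> z) * cos (y s \<bullet> z + (c + pi/2)))) (at s)"
proof -
  define W where "W \<xi> = u (\<lambda>z. a z * cos (\<xi> \<bullet> z + c))" for \<xi>
  define D where "D \<delta> = u (\<lambda>z. a z * (\<delta> \<bullet> z) * cos (y s \<bullet> z + (c + pi/2)))" for \<delta>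
  have tD: "test_on K (\<lambda>z. a z * (\<delta> \<bullet> z) * cos (y s \<bullet> z + (c + pi/2)))" for \<delta>
    by (rule test_on_mult_cos[OF test_on_mult[OF a smooth_inner]])
  have "linear D"
  proof (rule linearI)
    fix \<delta> \<epsilon> :: "'a phase" and r :: real
    show "D (\<delta> + \<epsilon>) = D \<delta> + D \<epsilon>"
      unfolding D_def using dist_add[OF u K tD[of \<delta>] tD[of \<epsilon>]] by (simp add: algebra_simps)
    show "D (r *\<^sub>R \<delta>) = r *\<^sub>R D \<delta>"
      unfolding D_def using dist_cmult[OF u K tD[of \<delta>], of r] by (simp add: algebra_simps)
  qed
  then have bl: "bounded_linear D" by (simp add: linear_conv_bounded_linear)
  obtain C m where C: "C \<ge> 0" "\<And>\<phi> B. test_on K \<phi> \<Longrightarrow> pd_bound m \<phi> B \<Longrightarrow> \<bar>u \<phi>\<bar> \<le> C * B"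
    using distribution_bound[OF u K] by blast
  obtain E where E: "E \<ge> 0" "\<And>\<xi> \<delta> c. norm \<xi> \<le> norm (y s) \<Longrightarrow> norm \<delta> \<le> 1 \<Longrightarrow>
    pd_bound m (\<lambda>z. a z * (cos ((\<xi> + \<delta>) \<bullet> z + c) - cos (\<xi> \<bullet> z + c)
        - (\<delta> \<bullet> z) * cos (\<xi> \<bullet> z + (c + pi/2)))) (E * (norm \<delta>)\<^sup>2)"
    using pd_bound_mult_cos_diff2[OF K a norm_ge_zero, of "y s" m] by blast
  have est: "\<bar>W (y s + \<delta>) - W (y s) - D \<delta>\<bar> \<le> C * (E * (norm \<delta>)\<^sup>2)" if "norm \<delta> \<le> 1" for \<delta>
  proof -
    let ?F = "\<lambda>z. a z * (cos ((y s + \<delta>) \<bullet> z + c) - cos (y s \<bullet> z + c)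
        - (\<delta> \<bullet> z) * cos (y s \<bullet> z + (c + pi/2)))"
    have eq: "?F = (\<lambda>z. (a z * cos ((y s + \<delta>) \<bullet> z + c) - a z * cos (y s \<bullet> z + c))
        - a z * (\<delta> \<bullet> z) * cos (y s \<bullet> z + (c + pi/2)))"
      by (auto simp: fun_eq_iff algebra_simps)
    have uF: "u ?F = W (y s + \<delta>) - W (y s) - D \<delta>"
      unfolding eq W_def D_def
      using dist_diff[OF u K test_on_diff[OF test_on_mult_cos[OF a] test_on_mult_cos[OF a]] tD]
        dist_diff[OF u K test_on_mult_cos[OF a] test_on_mult_cos[OF a]] by simp
    have tF: "test_on K ?F" unfolding eq
      by (rule test_on_diff[OF test_on_diff[OF test_on_mult_cos[OF a] test_on_mult_cos[OF a]] tD])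
    show ?thesis using C(2)[OF tF E(2)[OF order_refl that]] unfolding uF .
  qed
  have "(W has_derivative D) (at (y s))"
    unfolding has_derivative_at
  proof (intro conjI bl)
    show "(\<lambda>h. norm (W (y s + h) - W (y s) - D h) / norm h) \<midarrow>0\<rightarrow> 0"
    proof (rule Lim_null_comparison)
      have "\<forall>\<^sub>F h in at 0. norm h \<le> 1"
        unfolding eventually_at by (rule exI[of _ 1]) (auto simp: dist_norm)
      then show "\<forall>\<^sub>F h in at 0. norm (norm (W (y s + h) - W (y s) - D h) / norm h) \<le> C * E * norm h"
      proof eventually_elim
        case (elim h)
        then show ?case using est[OF elim]
          by (cases "h = 0") (auto simp: divide_simps power2_eq_square mult_ac)
      qed
      show "(\<lambda>h. C * E * norm h) \<midarrow>0\<rightarrow> 0" by (auto intro!: tendsto_eq_intros)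
    qed
  qed
  from has_derivative_compose[OF y[unfolded has_vector_derivative_def] this]
  have "((\<lambda>s. W (y s)) has_derivative (\<lambda>h. D (h *\<^sub>R y'))) (at s)" .
  then show ?thesis
    unfolding has_field_derivative_def W_def
    using linear_scale[OF \<open>linear D\<close>, of _ y'] by (simp add: D_def mult_commute_abs)
qed

subsection \<open>Linear flows and observability\<close>

lemma matrix_bound:
  fixes M :: "real ^ 'k::finite ^ 'k"
  obtains c where "c \<ge> 0" "\<And>v. norm (M *v v) \<le> c * norm v"
proof -
  have "bounded_linear ((*v) M)" by (simp add: matrix_vector_mul_bounded_linear)
  from bounded_linear.nonneg_bounded[OF this] obtain c where
    "c \<ge> 0" "\<And>v. norm (M *v v) \<le> norm v * c" by blast
  then show ?thesis using that[of c] by (simp add: mult.commute)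
qed

lemma power_matrix_bound:
  fixes M :: "real ^ 'k::finite ^ 'k"
  assumes "c \<ge> 0" "\<And>v. norm (M *v v) \<le> c * norm v"
  shows "norm (((*v) M ^^ n) v) \<le> c ^ n * norm v"
proof (induction n)
  case (Suc n)
  have "norm (((*v) M ^^ Suc n) v) \<le> c * norm (((*v) M ^^ n) v)" using assms(2) by simp
  also have "\<dots> \<le> c * (c ^ n * norm v)" using Suc assms(1) by (intro mult_left_mono)
  finally show ?case by (simp add: mult.assoc)
qed simp

text \<open>The flow is exp(s M) \<xi>, built componentwise as power series in s so that termwise
  differentiation of real series applies; \<open>a i n\<close> is component i of M^n \<xi> /
  n!.\<close>

lemma linear_flow_exists:
  fixes M :: "real ^ 'k::finite ^ 'k"
  shows "\<exists>y. y 0 = \<xi> \<and> (\<forall>s. (y has_vector_derivative M *v y s) (at s))"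
proof -
  obtain c where c: "c \<ge> 0" "\<And>v. norm (M *v v) \<le> c * norm v" using matrix_bound[of M] by blast
  define a where "a i n = (((*v) M ^^ n) \<xi>) $ i / fact n" for i n
  have le: "norm (a i n * s ^ n) \<le> (c * \<bar>s\<bar>) ^ n / fact n * norm \<xi>" for i n s
  proof -
    have "\<bar>(((*v) M ^^ n) \<xi>) $ i\<bar> \<le> c ^ n * norm \<xi>"
      using component_le_norm_cart[of "((*v) M ^^ n) \<xi>" i] power_matrix_bound[OF c, of n \<xi>] by linarith
    then have "\<bar>(((*v) M ^^ n) \<xi>) $ i\<bar> * (\<bar>s\<bar> ^ n / fact n) \<le> c ^ n * norm \<xi> * (\<bar>s\<bar> ^ n / fact n)"
      by (rule mult_right_mono) simp
    then show ?thesis by (simp add: a_def abs_mult power_abs power_mult_distrib mult_ac)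
  qed
  have "summable (\<lambda>n. (c * \<bar>s\<bar>) ^ n / fact n * norm \<xi>)" for s
    using summable_exp[of "c * \<bar>s\<bar>"] by (intro summable_mult2) (simp add: field_simps)
  then have sm: "summable (\<lambda>n. a i n * s ^ n)" for i s
    by (rule summable_comparison_test'[where N = 0]) (rule le)
  define f where "f i s = (\<Sum>n. a i n * s ^ n)" for i s
  have f0: "f i 0 = \<xi> $ i" for i 
    unfolding f_def powser_zero by (simp add: a_def)
  have diffs_a: "diffs (a i) n = (\<Sum>j\<in>UNIV. M $ i $ j * a j n)" for i n
  proof -
    have "diffs (a i) n = (((*v) M ^^ Suc n) \<xi>) $ i / fact n"
      by (simp add: diffs_def a_def del: of_nat_Suc funpow.simps)
    then show ?thesis by (simp add: a_def matrix_vector_mult_def sum_divide_distrib)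
  qed
  have der: "(f i has_real_derivative (\<Sum>j\<in>UNIV. M $ i $ j * f j s)) (at s)" for i s
  proof -
    have "(f i has_real_derivative (\<Sum>n. diffs (a i) n * s ^ n)) (at s)"
      unfolding f_def by (rule termdiffs_strong_converges_everywhere[OF sm])
    also have "(\<Sum>n. diffs (a i) n * s ^ n) = (\<Sum>n. \<Sum>j\<in>UNIV. M $ i $ j * (a j n * s ^ n))"
      by (simp add: diffs_a sum_distrib_right mult.assoc)
    also have "\<dots> = (\<Sum>j\<in>UNIV. \<Sum>n. M $ i $ j * (a j n * s ^ n))"
      by (rule suminf_sum) (intro summable_mult sm)
    also have "\<dots> = (\<Sum>j\<in>UNIV. M $ i $ j * f j s)"
      by (simp add: f_def suminf_mult[OF sm])
    finally show ?thesis .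
  qed
  define y where "y s = (\<Sum>i\<in>UNIV. f i s *\<^sub>R axis i (1::real))" for s
  have y: "y s $ i = f i s" for s i
    by (simp add: y_def axis_def if_distrib sum.delta cong: if_cong)
  have "(y has_vector_derivative (\<Sum>i\<in>UNIV. (\<Sum>j\<in>UNIV. M $ i $ j * f j s) *\<^sub>R axis i 1)) (at s)" for s
    unfolding y_def
    by (rule has_vector_derivative_sum)
      (use has_vector_derivative_scaleR[OF der has_vector_derivative_const] in simp)
  moreover have "(\<Sum>i\<in>UNIV. (\<Sum>j\<in>UNIV. M $ i $ j * f j s) *\<^sub>R axis i 1) = M *v y s" for s
    by (simp add: vec_eq_iff y matrix_vector_mult_def axis_def if_distrib sum.delta cong: if_cong)
  moreover have "y 0 = \<xi>" by (simp add: vec_eq_iff y f0)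
  ultimately show ?thesis by auto
qed

text \<open>Gronwall for the squared norm: its derivative is at most 2c times itself in absolute
  value, so multiplication by exp(-2cs) or exp(2cs) makes it monotone.\<close>

lemma linear_flow_norm:
  fixes M :: "real ^ 'k::finite ^ 'k"
  assumes c: "c \<ge> 0" "\<And>v. norm (M *v v) \<le> c * norm v"
    and y: "\<And>s. (y has_vector_derivative M *v y s) (at s)" and s: "0 \<le> s" "s \<le> 1"
  shows "norm (y s) \<le> exp c * norm (y 0)" "exp (-c) * norm (y 0) \<le> norm (y s)"
proof -
  define N where "N r = y r \<bullet> y r" for r
  have N: "(N has_real_derivative 2 * (y r \<bullet> (M *v y r))) (at r)" for r
  proof -
    have "((\<lambda>r. y r \<bullet> y r) has_derivative (\<lambda>h. y r \<bullet> (h *\<^sub>R (M *v y r)) + (h *\<^sub>R (M *v y r)) \<bullet> y r)) (at r)"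
      using y[of r] unfolding has_vector_derivative_def by (intro has_derivative_inner)
    then show ?thesis unfolding has_field_derivative_def N_def
      by (rule has_derivative_eq_rhs) (auto simp: inner_commute fun_eq_iff)
  qed
  have bd: "\<bar>y r \<bullet> (M *v y r)\<bar> \<le> c * N r" for r
  proof -
    have "\<bar>y r \<bullet> (M *v y r)\<bar> \<le> norm (y r) * norm (M *v y r)" by (rule Cauchy_Schwarz_ineq2)
    also have "\<dots> \<le> norm (y r) * (c * norm (y r))" by (intro mult_left_mono c) simp
    finally show ?thesis by (simp add: N_def dot_square_norm power2_eq_square mult_ac)
  qed
  have d: "((\<lambda>r. N r * exp (b * r)) has_real_derivative
      (2 * (y r \<bullet> (M *v y r)) + b * N r) * exp (b * r)) (at r)" for r b
    by (auto intro!: derivative_eq_intros N simp: algebra_simps)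
  have "N s * exp (-2 * c * s) \<le> N 0 * exp (-2 * c * 0)"
  proof (rule DERIV_nonpos_imp_nonincreasing[OF s(1)])
    fix r
    show "\<exists>z. ((\<lambda>r. N r * exp (-2*c * r)) has_real_derivative z) (at r) \<and> z \<le> 0"
      using d[of "-2*c" r] bd[of r] by (intro exI conjI) (auto simp: mult_le_0_iff)
  qed
  then have "N s \<le> N 0 * exp (2 * c * s)" by (simp add: exp_minus field_simps)
  also have "\<dots> \<le> N 0 * exp (2*c)" using s c(1) by (intro mult_left_mono) (auto simp: N_def mult_left_le)
  finally have "(norm (y s))\<^sup>2 \<le> (exp c * norm (y 0))\<^sup>2"
    by (simp add: N_def dot_square_norm power_mult_distrib exp_double[symmetric] mult.commute)
  then show "norm (y s) \<le> exp c * norm (y 0)" by (rule power2_le_imp_le) simp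
  have "N 0 * exp (2 * c * 0) \<le> N s * exp (2 * c * s)"
  proof (rule DERIV_nonneg_imp_nondecreasing[OF s(1)])
    fix r
    show "\<exists>z. ((\<lambda>r. N r * exp (2*c * r)) has_real_derivative z) (at r) \<and> 0 \<le> z"
      using d[of "2*c" r] bd[of r] by (intro exI conjI) (auto simp: zero_le_mult_iff)
  qed
  then have "N 0 \<le> N s * exp (2 * c * s)" by simp
  also have "\<dots> \<le> N s * exp (2*c)" using s c(1) by (intro mult_left_mono) (auto simp: N_def mult_left_le)
  finally have "(norm (y 0))\<^sup>2 \<le> (exp c * norm (y s))\<^sup>2"
    by (simp add: N_def dot_square_norm power_mult_distrib exp_double[symmetric] mult.commute)
  then have "norm (y 0) \<le> exp c * norm (y s)" by (rule power2_le_imp_le) simp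
  then show "exp (-c) * norm (y 0) \<le> norm (y s)" by (simp add: exp_minus field_simps)
qed

text \<open>If the derivative of order j + 1 stays away from 0, it has one sign, so the derivative
  of order j is strictly monotone with slope at least c. On one of the two outer quarters of the
  interval it is then at least c times a quarter of the length, and the order drops by one.\<close>

lemma derivative_lower_bound_subinterval:
  fixes h :: "nat \<Rightarrow> real \<Rightarrow> real"
  assumes h: "\<And>j s. (h j has_real_derivative h (Suc j) s) (at s)"
  shows "a < b \<Longrightarrow> c > 0 \<Longrightarrow> (\<And>s. a \<le> s \<Longrightarrow> s \<le> b \<Longrightarrow> c \<le> \<bar>h j s\<bar>) \<Longrightarrow>
    \<exists>a' b'. a \<le> a' \<and> a' < b' \<and> b' \<le> b \<and> b' - a' = (b - a) / 4 ^ j \<and>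
      (\<forall>s. a' \<le> s \<longrightarrow> s \<le> b' \<longrightarrow> c * ((b - a) / 4 ^ Suc j) ^ j \<le> \<bar>h 0 s\<bar>)"
proof (induction j arbitrary: a b c)
  case 0
  then show ?case by (intro exI[of _ a] exI[of _ b]) auto
next
  case (Suc j)
  define l where "l = b - a"
  have l: "l > 0" using Suc.prems by (simp add: l_def)
  have cont: "continuous_on {a..b} (h (Suc j))"
    by (intro continuous_at_imp_continuous_on ballI DERIV_isCont[OF h])
  \<comment> \<open>The sign of the top derivative: a sign change would produce a zero by the
    intermediate value theorem, against the lower bound.\<close>
  obtain \<sigma> :: real where \<sigma>: "\<bar>\<sigma>\<bar> = 1" "\<And>s. a \<le> s \<Longrightarrow> s \<le> b \<Longrightarrow> c \<le> \<sigma> * h (Suc j) s"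
  proof (cases "h (Suc j) a > 0")
    case True
    have "c \<le> 1 * h (Suc j) s" if s: "a \<le> s" "s \<le> b" for s
    proof (rule ccontr)
      assume "\<not> ?thesis"
      then have "h (Suc j) s \<le> 0" using Suc.prems(3)[OF s] by linarith
      then obtain x where "a \<le> x" "x \<le> s" "h (Suc j) x = 0"
        using IVT2'[of "h (Suc j)" s 0 a] True s continuous_on_subset[OF cont, of "{a..s}"] by force
      then show False using Suc.prems(2) Suc.prems(3)[of x] s by auto
    qed
    then show ?thesis using that[of 1] by simp
  next
    case False
    have "c \<le> -1 * h (Suc j) s" if s: "a \<le> s" "s \<le> b" for s
    proof (rule ccontr)
      assume "\<not> ?thesis"
      then have "0 \<le> h (Suc j) s" using Suc.prems(3)[OF s] by linarith
      then obtain x where "a \<le> x" "x \<le> s" "h (Suc j) x = 0"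
        using IVT'[of "h (Suc j)" a 0 s] False s continuous_on_subset[OF cont, of "{a..s}"] by force
      then show False using Suc.prems(2) Suc.prems(3)[of x] s by auto
    qed
    then show ?thesis using that[of "-1"] by simp
  qed
  have incr: "c * (t - s) \<le> \<sigma> * h j t - \<sigma> * h j s" if "a \<le> s" "s \<le> t" "t \<le> b" for s t
  proof -
    have "\<sigma> * h j s - c * s \<le> \<sigma> * h j t - c * t"
    proof (rule DERIV_nonneg_imp_nondecreasing[OF that(2)])
      fix x assume "s \<le> x" "x \<le> t"
      then show "\<exists>y. ((\<lambda>s. \<sigma> * h j s - c * s) has_real_derivative y) (at x) \<and> 0 \<le> y"
        using \<sigma>(2)[of x] that
        by (intro exI[of _ "\<sigma> * h (Suc j) x - c"] conjI) (auto intro!: derivative_eq_intros h)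
    qed
    then show ?thesis by (simp add: algebra_simps)
  qed
  \<comment> \<open>The sign at the midpoint decides on which side the monotone function moves away
    from zero; the outer quarter of that side keeps a distance of a quarter length from the
    midpoint.\<close>
  obtain a1 b1 where ab: "a \<le> a1" "b1 \<le> b" "b1 - a1 = l / 4"
    and big: "\<And>s. a1 \<le> s \<Longrightarrow> s \<le> b1 \<Longrightarrow> c * (l / 4) \<le> \<bar>h j s\<bar>"
  proof (cases "\<sigma> * h j (a + l/2) \<ge> 0")
    case True
    show ?thesis
    proof (rule that[of "b - l/4" b])
      fix s assume s: "b - l/4 \<le> s" "s \<le> b"
      have "c * (l/4) \<le> c * (s - (a + l/2))"
        using s Suc.prems(2) by (intro mult_left_mono) (auto simp: l_def field_simps)
      also have "\<dots> \<le> \<sigma> * h j s - \<sigma> * h j (a + l/2)"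
        using s l by (intro incr) (auto simp: l_def field_simps)
      also have "\<dots> \<le> \<bar>\<sigma> * h j s\<bar>" using True by linarith
      finally show "c * (l/4) \<le> \<bar>h j s\<bar>" using \<sigma>(1) by (simp add: abs_mult)
    qed (use l in \<open>auto simp: l_def field_simps\<close>)
  next
    case False
    show ?thesis
    proof (rule that[of a "a + l/4"])
      fix s assume s: "a \<le> s" "s \<le> a + l/4"
      have "c * (l/4) \<le> c * ((a + l/2) - s)"
        using s Suc.prems(2) by (intro mult_left_mono) (auto simp: l_def field_simps)
      also have "\<dots> \<le> \<sigma> * h j (a + l/2) - \<sigma> * h j s"
        using s l by (intro incr) (auto simp: l_def field_simps)
      also have "\<dots> \<le> \<bar>\<sigma> * h j s\<bar>" using False by linarith
      finally show "c * (l/4) \<le> \<bar>h j s\<bar>" using \<sigma>(1) by (simp add: abs_mult)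
    qed (use l in \<open>auto simp: l_def field_simps\<close>)
  qed
  have "a1 < b1" "c * (l/4) > 0" using ab(3) l Suc.prems(2) by auto
  from Suc.IH[OF this big] obtain a' b' where r: "a1 \<le> a'" "a' < b'" "b' \<le> b1"
    "b' - a' = (b1 - a1) / 4 ^ j"
    "\<And>s. a' \<le> s \<Longrightarrow> s \<le> b' \<Longrightarrow> c * (l/4) * ((b1 - a1) / 4 ^ Suc j) ^ j \<le> \<bar>h 0 s\<bar>"
    by blast
  have "c * (l / 4 ^ Suc (Suc j)) ^ Suc j = c * (l / 4 ^ Suc (Suc j)) * (l / 4 ^ Suc (Suc j)) ^ j"
    by simp
  also have "\<dots> \<le> c * (l / 4) * (l / 4 ^ Suc (Suc j)) ^ j"
  proof (intro mult_right_mono mult_left_mono)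
    have "(4::real) * 1 \<le> 4 * 4 ^ Suc j" by (intro mult_left_mono one_le_power) auto
    then show "l / 4 ^ Suc (Suc j) \<le> l / 4" using l by (intro divide_left_mono) auto
  qed (use l Suc.prems(2) in auto)
  finally have "c * (l / 4 ^ Suc (Suc j)) ^ Suc j \<le> c * (l/4) * ((b1 - a1) / 4 ^ Suc j) ^ j"
    by (simp add: ab(3))
  then show ?case using r ab
    by (intro exI[of _ a'] exI[of _ b']) (force simp: l_def[symmetric])
qed

lemma linear_matrix_power: "linear ((*v) (M :: real ^ 'k::finite ^ 'k) ^^ j)"
proof (induction j)
  case (Suc j)
  from linear_compose[OF this matrix_vector_mul_linear[of M]] show ?case by (simp add: o_def)
qed (simp add: linear_iff)

text \<open>Pointwise observability becomes quantitative by compactness: the open sets on which the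
  derivatives of order j are seen cover the unit sphere, so finitely many orders suffice, and
  homogeneity carries the bound to all vectors.\<close>

lemma observability_lower_bound:
  fixes M :: "real ^ 'k::finite ^ 'k" and g :: "'n::finite \<Rightarrow> real" and e :: "'n \<Rightarrow> 'k"
  assumes g: "\<And>i. g i \<ge> 0"
    and obs: "\<And>\<xi>. \<xi> \<noteq> 0 \<Longrightarrow> \<exists>j i. g i > 0 \<and> (((*v) M ^^ j) \<xi>) $ e i \<noteq> 0"
  obtains D \<kappa> where "\<kappa> > 0"
    "\<And>\<xi>. \<exists>j\<le>D. \<exists>i. \<kappa> * norm \<xi> \<le> g i * \<bar>(((*v) M ^^ j) \<xi>) $ e i\<bar>"
proof -
  define F where "F j \<xi> = (\<Sum>i\<in>UNIV. g i * \<bar>(((*v) M ^^ j) \<xi>) $ e i\<bar>)" for j \<xi>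
  have cont: "continuous_on UNIV (F j)" for j
    unfolding F_def by (intro continuous_intros linear_continuous_on linear_conv_bounded_linear[THEN iffD1] linear_matrix_power)
  have F_nonneg: "F j \<xi> \<ge> 0" for j \<xi> unfolding F_def by (intro sum_nonneg mult_nonneg_nonneg g) auto
  define U where "U j = {\<xi>. F j \<xi> > 0}" for j
  have openU: "open (U j)" for j
    unfolding U_def using open_Collect_less[OF continuous_on_const cont] by blast
  have cover: "sphere 0 1 \<subseteq> (\<Union>j\<in>UNIV. U j)"
  proof
    fix \<xi> :: "real ^ 'k" assume "\<xi> \<in> sphere 0 1"
    then have "\<xi> \<noteq> 0" by auto
    then obtain j i where ji: "g i > 0" "(((*v) M ^^ j) \<xi>) $ e i \<noteq> 0" using obs by blast
    have "0 < g i * \<bar>(((*v) M ^^ j) \<xi>) $ e i\<bar>" using ji by simp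
    also have "\<dots> \<le> F j \<xi>" unfolding F_def by (rule member_le_sum) (auto intro!: mult_nonneg_nonneg g)
    finally show "\<xi> \<in> (\<Union>j\<in>UNIV. U j)" by (auto simp: U_def)
  qed
  obtain J where J: "finite J" "sphere 0 1 \<subseteq> (\<Union>j\<in>J. U j)"
    by (rule compactE_image[OF compact_sphere openU cover])
  define S where "S \<xi> = (\<Sum>j\<in>J. F j \<xi>)" for \<xi>
  have "continuous_on (sphere 0 1) S" unfolding S_def
    by (intro continuous_on_sum continuous_on_subset[OF cont]) auto
  moreover have "sphere (0::real^'k) 1 \<noteq> {}" by simp
  ultimately obtain x where x: "x \<in> sphere 0 1" "\<And>\<xi>. \<xi> \<in> sphere 0 1 \<Longrightarrow> S x \<le> S \<xi>"
    using continuous_attains_inf[of "sphere 0 1" S] by auto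
  have "S x > 0"
  proof -
    obtain j where "j \<in> J" "F j x > 0" using x(1) J(2) by (auto simp: U_def)
    then show ?thesis unfolding S_def using J(1) F_nonneg by (intro sum_pos2[of J j]) auto
  qed
  \<comment> \<open>A pigeonhole: if each of the n terms were below \<open>\<kappa>\<close>, their
    sum would be at most n \<open>\<kappa>\<close>, less than the minimum \<open>S x\<close> on the
    sphere.\<close>
  define n where "n = real (card J * CARD('n))"
  have n: "n \<ge> 0" by (simp add: n_def)
  define \<kappa> where "\<kappa> = S x / (n + 1)"
  have \<kappa>: "\<kappa> > 0" using \<open>S x > 0\<close> n by (simp add: \<kappa>_def)
  have unit: "\<exists>j\<in>J. \<exists>i. \<kappa> \<le> g i * \<bar>(((*v) M ^^ j) \<xi>) $ e i\<bar>" if "\<xi> \<in> sphere 0 1" for \<xi>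
  proof (rule ccontr)
    assume neg: "\<not> ?thesis"
    have "F j \<xi> \<le> CARD('n) * \<kappa>" if "j \<in> J" for j
    proof -
      have "g i * \<bar>(((*v) M ^^ j) \<xi>) $ e i\<bar> \<le> \<kappa>" for i using neg \<open>j \<in> J\<close> by (meson linear)
      then show ?thesis
        unfolding F_def using sum_bounded_above[of UNIV "\<lambda>i. g i * \<bar>(((*v) M ^^ j) \<xi>) $ e i\<bar>" \<kappa>] by simp
    qed
    then have "S \<xi> \<le> card J * (CARD('n) * \<kappa>)"
      unfolding S_def using sum_bounded_above[of J "\<lambda>j. F j \<xi>"] by simp
    also have "\<dots> = n * \<kappa>" by (simp add: n_def)
    also have "\<dots> < (n + 1) * \<kappa>" using \<kappa> by simp
    also have "\<dots> = S x" using n by (simp add: \<kappa>_def)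
    finally show False using x(2)[OF that] by simp
  qed
  obtain D where D: "\<And>j. j \<in> J \<Longrightarrow> j \<le> D" using J(1) finite_nat_set_iff_bounded_le by auto
  have "\<exists>j\<le>D. \<exists>i. \<kappa> * norm \<xi> \<le> g i * \<bar>(((*v) M ^^ j) \<xi>) $ e i\<bar>" for \<xi>
  proof (cases "\<xi> = 0")
    case True
    then show ?thesis by (intro exI[of _ 0]) (simp add: g)
  next
    case False
    then have "(1 / norm \<xi>) *\<^sub>R \<xi> \<in> sphere 0 1" by simp
    from unit[OF this] obtain j i where ji: "j \<in> J"
      "\<kappa> \<le> g i * \<bar>(((*v) M ^^ j) ((1 / norm \<xi>) *\<^sub>R \<xi>)) $ e i\<bar>" by blast
    have "\<kappa> * norm \<xi> \<le> g i * \<bar>(((*v) M ^^ j) \<xi>) $ e i\<bar>"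
      using ji(2) False by (simp add: linear_scale[OF linear_matrix_power] abs_mult field_simps)
    then show ?thesis using D ji(1) by blast
  qed
  then show ?thesis using that \<kappa> by blast
qed

text \<open>Some derivative of order j of an observed component is large at time 0 and remains so
  for a time proportional to s. Hence the component itself is large on a subinterval. The exponent
  2D + 1 has D twice from the square and 1 from the length of that subinterval.\<close>

lemma flow_observability:
  fixes M :: "real ^ 'k::finite ^ 'k" and g :: "'n::finite \<Rightarrow> real" and e :: "'n \<Rightarrow> 'k"
  assumes g: "\<And>i. g i \<ge> 0"
    and obs: "\<And>\<xi>. \<xi> \<noteq> 0 \<Longrightarrow> \<exists>j i. g i > 0 \<and> (((*v) M ^^ j) \<xi>) $ e i \<noteq> 0"
  obtains C m where "C > 0"
    "\<And>y s. (\<And>s. (y has_vector_derivative M *v y s) (at s)) \<Longrightarrow> 0 < s \<Longrightarrow> s \<le> 1 \<Longrightarrow>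
      C * s ^ m * (norm (y 0))\<^sup>2 \<le> integral {0..s} (\<lambda>r. \<Sum>i\<in>UNIV. g i * (y r $ e i)\<^sup>2)"
proof -
  have "\<exists>\<kappa>>0. \<exists>D. \<forall>\<xi>. \<exists>j\<le>D. \<exists>i. \<kappa> * norm \<xi> \<le> g i * \<bar>(((*v) M ^^ j) \<xi>) $ e i\<bar>"
  proof (rule observability_lower_bound[OF g obs])
    fix D \<kappa> assume "0 < \<kappa>" "\<And>\<xi>. \<exists>j\<le>D. \<exists>i. \<kappa> * norm \<xi> \<le> g i * \<bar>(((*v) M ^^ j) \<xi>) $ e i\<bar>"
    then show ?thesis by blast
  qed
  then obtain \<kappa> D where \<kappa>: "\<kappa> > 0"
    and obs': "\<And>\<xi>. \<exists>j\<le>D. \<exists>i. \<kappa> * norm \<xi> \<le> g i * \<bar>(((*v) M ^^ j) \<xi>) $ e i\<bar>"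
    by blast
  obtain c where c: "c \<ge> 0" "\<And>v. norm (M *v v) \<le> c * norm v" using matrix_bound[of M] by blast
  define G where "G = (\<Sum>i\<in>UNIV. g i) + 1"
  have G: "G > 0" "g i \<le> G" for i
    using member_le_sum[of i UNIV g] g sum_nonneg[of UNIV g] by (auto simp: G_def add_nonneg_pos)
  \<comment> \<open>Per unit of |y 0|, \<open>A\<close> bounds the speed at which g_i times any
    derivative of order at most D changes during unit time; up to time \<open>s0\<close> at least
    half of the initial value therefore survives.\<close>
  define A where "A = G * (c + 1) ^ Suc D * exp c"
  have A: "A > 0" using G c by (simp add: A_def)
  define s0 where "s0 = min 1 (\<kappa> / (2 * A))"
  have s0: "0 < s0" "s0 \<le> 1" "A * s0 \<le> \<kappa> / 2"
    using \<kappa> A by (auto simp: s0_def min_def field_simps)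
  define C where "C = \<kappa>\<^sup>2 / (4 * G) * (s0 / 4 ^ Suc D) ^ Suc (2 * D)"
  have C: "C > 0" using \<kappa> G s0 by (simp add: C_def)
  have "C * s ^ Suc (2 * D) * (norm (y 0))\<^sup>2 \<le> integral {0..s} (\<lambda>r. \<Sum>i\<in>UNIV. g i * (y r $ e i)\<^sup>2)"
    if y: "\<And>s. (y has_vector_derivative M *v y s) (at s)" and s: "0 < s" "s \<le> 1" for y s
  proof -
    define x where "x = norm (y 0)"
    define q where "q = (\<lambda>r. \<Sum>i\<in>UNIV. g i * (y r $ e i)\<^sup>2)"
    have conty: "continuous_on T y" for T
      by (intro continuous_at_imp_continuous_on ballI has_vector_derivative_continuous[OF y])
    have contq: "continuous_on T q" for T unfolding q_def
      by (intro continuous_intros conty)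
    have q0: "q r \<ge> 0" for r unfolding q_def by (intro sum_nonneg mult_nonneg_nonneg g) auto
    show ?thesis
    proof (cases "y 0 = 0")
      case True
      have "0 \<le> integral {0..s} q"
        by (intro Henstock_Kurzweil_Integration.integral_nonneg integrable_continuous_interval contq q0)
      then show ?thesis using True by (simp add: q_def)
    next
      case False
      then have x: "x > 0" by (simp add: x_def)
      obtain j i where ji: "j \<le> D" "\<kappa> * x \<le> g i * \<bar>(((*v) M ^^ j) (y 0)) $ e i\<bar>"
        using obs'[of "y 0"] by (auto simp: x_def)
      define h where "h = (\<lambda>n r. (((*v) M ^^ n) (y r)) $ e i)"
      have hd: "(h n has_real_derivative h (Suc n) r) (at r)" for n r
      proof -
        have "((\<lambda>r. ((*v) M ^^ n) (y r)) has_vector_derivative ((*v) M ^^ Suc n) (y r)) (at r)" for r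
        proof (induction n)
          case (Suc n)
          from bounded_linear.has_vector_derivative[OF matrix_vector_mul_bounded_linear this]
          show ?case by simp
        qed (simp add: y)
        from bounded_linear.has_vector_derivative[OF bounded_linear_vec_nth this]
        show ?thesis by (simp add: h_def has_real_derivative_iff_has_vector_derivative)
      qed
      have gi: "g i > 0" using ji(2) mult_pos_pos[OF \<kappa> x] g[of i] by (cases "g i = 0") auto
      have hb: "\<bar>h n r\<bar> \<le> c ^ n * (exp c * x)" if "0 \<le> r" "r \<le> 1" for n r
      proof -
        have "\<bar>h n r\<bar> \<le> norm (((*v) M ^^ n) (y r))" unfolding h_def by (rule component_le_norm_cart)
        also have "\<dots> \<le> c ^ n * norm (y r)" by (rule power_matrix_bound[OF c])
        also have "\<dots> \<le> c ^ n * (exp c * x)"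
          using linear_flow_norm(1)[OF c y that] c(1) by (intro mult_left_mono) (auto simp: x_def)
        finally show ?thesis .
      qed
      define l where "l = s0 * s"
      have l: "0 < l" "l \<le> s" "l \<le> s0" "l \<le> 1" using s s0 by (auto simp: l_def mult_le_one)
      have low: "\<kappa> * x / (2 * g i) \<le> \<bar>h j r\<bar>" if r: "0 \<le> r" "r \<le> l" for r
      proof -
        have "norm (h j r - h j 0) \<le> c ^ Suc j * (exp c * x) * norm (r - 0)"
          by (rule field_differentiable_bound[of "{0..l}" "h j" "h (Suc j)"])
            (use hb l r in \<open>auto intro: has_field_derivative_at_within hd simp del: power_Suc\<close>)
        also have "\<dots> \<le> ((c + 1) ^ Suc D * (exp c * x)) * s0"
        proof -
          have "c ^ Suc j \<le> (c + 1) ^ Suc j" using c(1) by (intro power_mono) auto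
          also have "\<dots> \<le> (c + 1) ^ Suc D" using c(1) ji(1) by (intro power_increasing) auto
          finally show ?thesis using r l x c(1) by (intro mult_mono) auto
        qed
        finally have d: "\<bar>h j r - h j 0\<bar> \<le> (c + 1) ^ Suc D * (exp c * x) * s0" by simp
        have "g i * \<bar>h j r - h j 0\<bar> \<le> G * ((c + 1) ^ Suc D * (exp c * x) * s0)"
          using d G g by (intro mult_mono) auto
        also have "\<dots> = A * s0 * x" by (simp add: A_def mult_ac)
        also have "\<dots> \<le> \<kappa> / 2 * x" using s0(3) x by (intro mult_right_mono) auto
        finally have "g i * \<bar>h j r - h j 0\<bar> \<le> \<kappa> / 2 * x" .
        moreover have "\<kappa> * x \<le> g i * \<bar>h j 0\<bar>" using ji(2) by (simp add: h_def)
        moreover have "g i * \<bar>h j 0\<bar> \<le> g i * (\<bar>h j r\<bar> + \<bar>h j r - h j 0\<bar>)"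
          using g by (intro mult_left_mono) auto
        ultimately have "\<kappa> / 2 * x \<le> g i * \<bar>h j r\<bar>" by (simp add: algebra_simps)
        then show ?thesis using gi by (simp add: field_simps)
      qed
      obtain a b where ab: "0 \<le> a" "a < b" "b \<le> l" "b - a = (l - 0) / 4 ^ j"
        and h0: "\<And>r. a \<le> r \<Longrightarrow> r \<le> b \<Longrightarrow> \<kappa> * x / (2 * g i) * ((l - 0) / 4 ^ Suc j) ^ j \<le> \<bar>h 0 r\<bar>"
        using derivative_lower_bound_subinterval[where h = h, OF hd l(1) _ low] \<kappa> x gi by auto
      \<comment> \<open>A length below the subinterval lengths for every j \<le> D. Since it is at
        most 1, powers with exponent j may be replaced by powers with exponent D, which removes the
        dependence on j.\<close>
      define p where "p = l / 4 ^ Suc D"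
      have p: "0 < p" "p \<le> 1"
      proof -
        have "l * 1 \<le> 1 * 4 ^ Suc D" using l by (intro mult_mono one_le_power) auto
        then show "0 < p" "p \<le> 1" using l by (auto simp: p_def)
      qed
      have pj: "p \<le> l / 4 ^ j" "p \<le> l / 4 ^ Suc j"
        unfolding p_def using l ji(1) by (auto intro!: divide_left_mono power_increasing simp del: power_Suc)
      have qlow: "g i * (\<kappa> * x / (2 * g i) * p ^ D)\<^sup>2 \<le> q r" if r: "a \<le> r" "r \<le> b" for r
      proof -
        have "p ^ D \<le> p ^ j" using p ji(1) by (intro power_decreasing) auto
        also have "\<dots> \<le> (l / 4 ^ Suc j) ^ j" using p pj by (intro power_mono) auto
        finally have "\<kappa> * x / (2 * g i) * p ^ D \<le> \<kappa> * x / (2 * g i) * (l / 4 ^ Suc j) ^ j"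
          using \<kappa> x gi by (intro mult_left_mono) auto
        also have "\<dots> \<le> \<bar>y r $ e i\<bar>" using h0[OF r] by (simp add: h_def)
        finally have "(\<kappa> * x / (2 * g i) * p ^ D)\<^sup>2 \<le> \<bar>y r $ e i\<bar>\<^sup>2"
          using \<kappa> x gi p by (intro power_mono) auto
        then have "g i * (\<kappa> * x / (2 * g i) * p ^ D)\<^sup>2 \<le> g i * (y r $ e i)\<^sup>2"
          using gi by simp
        also have "\<dots> \<le> q r" unfolding q_def by (rule member_le_sum) (auto intro!: mult_nonneg_nonneg g)
        finally show ?thesis .
      qed
      have "C * s ^ Suc (2 * D) * x\<^sup>2 = \<kappa>\<^sup>2 * x\<^sup>2 / (4 * G) * p ^ Suc (2 * D)"
        by (simp add: C_def p_def l_def power_mult_distrib power_divide)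
      also have "\<dots> \<le> \<kappa>\<^sup>2 * x\<^sup>2 / (4 * g i) * p ^ Suc (2 * D)"
        using G gi p by (intro mult_right_mono divide_left_mono) auto
      also have "\<dots> = p * (g i * (\<kappa> * x / (2 * g i) * p ^ D)\<^sup>2)"
        using gi by (simp add: power_mult_distrib power_divide power_mult power2_eq_square power_even_eq field_simps)
      also have "\<dots> \<le> (b - a) * (g i * (\<kappa> * x / (2 * g i) * p ^ D)\<^sup>2)"
        using ab(4) pj(1) gi by (intro mult_right_mono) auto
      also have "\<dots> = integral {a..b} (\<lambda>_. g i * (\<kappa> * x / (2 * g i) * p ^ D)\<^sup>2)"
        using ab(2) by simp
      also have "\<dots> \<le> integral {a..b} q"
        by (rule integral_le) (use qlow in \<open>auto intro!: integrable_continuous_interval contq\<close>)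
      also have "\<dots> \<le> integral {0..s} q"
        by (rule integral_subset_le) (use ab l q0 in \<open>auto intro!: integrable_continuous_interval contq\<close>)
      finally show ?thesis by (simp add: q_def x_def)
    qed
  qed
  then show ?thesis by (rule that[OF C])
qed

subsection \<open>Decay of oscillatory integrals\<close>

lemma integrable_compact_support:
  fixes f :: "'a::euclidean_space \<Rightarrow> real"
  assumes "compact K" "continuous_on UNIV f" "\<And>z. z \<notin> K \<Longrightarrow> f z = 0"
  shows "integrable lborel f"
proof -
  have "integrable lborel (\<lambda>x. indicator K x *\<^sub>R f x)"
    using assms(1) continuous_on_subset[OF assms(2)] by (intro borel_integrable_compact) auto
  moreover have "(\<lambda>x. indicator K x *\<^sub>R f x) = f"
    using assms(3) by (auto simp: indicator_def fun_eq_iff)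
  ultimately show ?thesis by simp
qed

lemma integrable_test_on: "compact K \<Longrightarrow> test_on K f \<Longrightarrow> integrable lborel f"
  by (rule integrable_compact_support) (auto simp: test_on_def smooth_continuous)

lemma smooth_line_derivative:
  assumes "smooth_fun f"
  shows "((\<lambda>t. f (x + t *\<^sub>R axis k 1)) has_real_derivative pd k f (x + t *\<^sub>R axis k 1)) (at t)"
proof -
  have "((\<lambda>s. f ((x + t *\<^sub>R axis k 1) + s *\<^sub>R axis k 1)) has_real_derivative
      pd k f (x + t *\<^sub>R axis k 1)) (at 0)"
    using smooth_has_pd[OF assms, of k] unfolding has_pd_def by blast
  then have "((\<lambda>s. f (x + (s + t) *\<^sub>R axis k 1)) has_real_derivative
      pd k f (x + t *\<^sub>R axis k 1)) (at 0)"
    by (simp add: scaleR_add_left add_ac)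
  then show ?thesis using DERIV_shift[of "\<lambda>s. f (x + s *\<^sub>R axis k 1)" _ 0 t] by simp
qed

lemma
  fixes f :: "'a::euclidean_space \<Rightarrow> real"
  assumes "continuous_on UNIV f" "integrable lborel f"
  shows integrable_translate: "integrable lborel (\<lambda>x. f (x + v))"
    and integral_translate: "(LINT x|lborel. f (x + v)) = (LINT x|lborel. f x)"
proof -
  have m: "(+) v \<in> measurable lborel borel" by simp
  have fm: "f \<in> borel_measurable borel" by (rule borel_measurable_continuous_onI[OF assms(1)])
  have d: "distr lborel borel ((+) v) = (lborel :: 'a measure)" by (rule lborel_distr_plus)
  show "integrable lborel (\<lambda>x. f (x + v))"
    using assms(2) integrable_distr_eq[OF m fm] unfolding d by (simp add: add.commute)
  show "(LINT x|lborel. f (x + v)) = (LINT x|lborel. f x)"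
    using integral_distr[OF m fm] unfolding d by (simp add: add.commute)
qed

text \<open>Translation invariance makes the integral of every difference quotient vanish; dominated
  convergence passes to the derivative.\<close>

lemma integral_pd_eq_0:
  fixes f :: "'n::finite phase \<Rightarrow> real"
  assumes K: "compact K" and f: "test_on K f"
  shows "(LINT z|lborel. pd k f z) = 0"
proof -
  define e :: "'n phase" where "e = axis k 1"
  have tp: "test_on K (pd k f)" by (rule test_on_pd[OF compact_imp_closed[OF K] f])
  obtain B where B: "B \<ge> 0" "\<And>z. \<bar>pd k f z\<bar> \<le> B" by (rule test_on_bounded[OF K tp]) blast
  have sm: "smooth_fun f" using f by (simp add: test_on_def)
  \<comment> \<open>\<open>K\<close> swept backwards along the coordinate direction for unit length:
    it contains the supports of all difference quotients with step at most 1, and the indicator of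
    this set dominates.\<close>
  define L where "L = (\<lambda>(x, s). x - s *\<^sub>R e) ` (K \<times> {0..1::real})"
  have L: "compact L" unfolding L_def
    by (intro compact_continuous_image compact_Times K) (auto intro!: continuous_intros simp: case_prod_unfold)
  have KL: "K \<subseteq> L" unfolding L_def by (force simp: image_iff)
  have inL: "x \<in> L" if "x + s *\<^sub>R e \<in> K" "0 \<le> s" "s \<le> 1" for x s
    unfolding L_def image_iff using that by (intro bexI[of _ "(x + s *\<^sub>R e, s)"]) auto
  define t where "t n = inverse (real (Suc n))" for n
  have t: "0 < t n" "t n \<le> 1" for n by (auto simp: t_def field_simps)
  have t0: "t \<longlonglongrightarrow> 0" unfolding t_def by (rule LIMSEQ_inverse_real_of_nat)
  define s where "s n x = (f (x + t n *\<^sub>R e) - f x) / t n" for n x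
  have intf: "integrable lborel f" by (rule integrable_test_on[OF K f])
  note shift = integrable_translate[OF smooth_continuous[OF sm] intf] integral_translate[OF smooth_continuous[OF sm] intf]
  have s_int: "integral\<^sup>L lborel (s n) = 0" for n
    unfolding s_def using shift intf by simp
  have "(\<lambda>n. integral\<^sup>L lborel (s n)) \<longlonglongrightarrow> integral\<^sup>L lborel (pd k f)"
  proof (rule integral_dominated_convergence[where w = "\<lambda>x. indicator L x * B"])
    show "pd k f \<in> borel_measurable lborel"
      using borel_measurable_integrable[OF integrable_test_on[OF K tp]] .
    show "s n \<in> borel_measurable lborel" for n
      unfolding s_def using borel_measurable_integrable[OF shift(1)[of "t n *\<^sub>R e"]]
        borel_measurable_integrable[OF intf] by measurable
    show "integrable lborel (\<lambda>x. indicator L x * B)"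
      using emeasure_compact_finite[OF L] compact_imp_closed[OF L]
      by (intro integrable_mult_left integrable_real_indicator) auto
    have "(\<lambda>n. s n x) \<longlonglongrightarrow> pd k f x" for x
    proof -
      have "((\<lambda>h. (f (x + h *\<^sub>R e) - f x) / h) \<longlongrightarrow> pd k f x) (at 0)"
        using smooth_line_derivative[OF sm, of x k 0] by (simp add: DERIV_def e_def)
      moreover have "filterlim t (at 0) sequentially"
        using t0 t by (auto simp: filterlim_at intro!: always_eventually less_imp_neq[THEN not_sym])
      ultimately show ?thesis unfolding s_def by (rule filterlim_compose)
    qed
    then show "AE x in lborel. (\<lambda>n. s n x) \<longlonglongrightarrow> pd k f x" by simp
    have "norm (s n x) \<le> indicator L x * B" for n x
    proof (cases "x \<in> L")
      case True
      have "norm (f (x + t n *\<^sub>R e) - f (x + 0 *\<^sub>R e)) \<le> B * norm (t n - 0)"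
        unfolding e_def
        by (rule field_differentiable_bound[of UNIV _ "\<lambda>s. pd k f (x + s *\<^sub>R axis k 1)"])
          (auto intro: smooth_line_derivative[OF sm] B)
      then show ?thesis using True t[of n] by (simp add: s_def abs_divide field_simps)
    next
      case False
      then have "x \<notin> K" "x + t n *\<^sub>R e \<notin> K" using KL inL[of x "t n"] t[of n] by auto
      then show ?thesis using f False by (simp add: s_def test_on_def)
    qed
    then show "AE x in lborel. norm (s n x) \<le> indicator L x * B" for n by simp
  qed
  then have "(\<lambda>n. 0) \<longlonglongrightarrow> integral\<^sup>L lborel (pd k f)" by (simp add: s_int)
  then show ?thesis using LIMSEQ_unique tendsto_const by blast
qed

text \<open>The phase c - pi/2 is chosen so that differentiating the cosine brings back the phase
  c.\<close>

lemma integral_cos_by_parts: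
  assumes K: "compact K" and a: "test_on K a"
  shows "\<xi> $ k * (LINT z|lborel. a z * cos (\<xi> \<bullet> z + c)) =
    - (LINT z|lborel. pd k a z * cos (\<xi> \<bullet> z + (c - pi/2)))"
proof -
  have sm: "smooth_fun a" using a by (simp add: test_on_def)
  have tp: "test_on K (pd k a)" by (rule test_on_pd[OF compact_imp_closed[OF K] a])
  have "0 = (LINT z|lborel. pd k (\<lambda>z. a z * cos (\<xi> \<bullet> z + (c - pi/2))) z)"
    by (rule integral_pd_eq_0[OF K test_on_mult_cos[OF a], symmetric])
  also have "\<dots> = (LINT z|lborel. pd k a z * cos (\<xi> \<bullet> z + (c - pi/2))
      + \<xi> $ k * (a z * cos (\<xi> \<bullet> z + c)))"
    by (simp add: pd_mult_cos[OF sm])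
  also have "\<dots> = (LINT z|lborel. pd k a z * cos (\<xi> \<bullet> z + (c - pi/2)))
      + \<xi> $ k * (LINT z|lborel. a z * cos (\<xi> \<bullet> z + c))"
    by (subst Bochner_Integration.integral_add)
      (auto intro!: integrable_test_on[OF K] test_on_cmult test_on_mult_cos a tp)
  finally show ?thesis by simp
qed

lemma integral_cos_component_decay:
  assumes K: "compact K" and "test_on K a"
  shows "\<exists>C. \<forall>\<xi> c. \<bar>\<xi> $ k\<bar> ^ n * \<bar>LINT z|lborel. a z * cos (\<xi> \<bullet> z + c)\<bar> \<le> C"
  using assms(2)
proof (induction n arbitrary: a)
  case 0
  have "\<bar>LINT z|lborel. a z * cos (\<xi> \<bullet> z + c)\<bar> \<le> (LINT z|lborel. \<bar>a z\<bar>)" for \<xi> c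
  proof -
    have "\<bar>a z\<bar> * \<bar>cos t\<bar> \<le> \<bar>a z\<bar>" for z t using mult_left_mono[of "\<bar>cos t\<bar>" 1 "\<bar>a z\<bar>"] by simp
    then have "norm (LINT z|lborel. a z * cos (\<xi> \<bullet> z + c)) \<le> (LINT z|lborel. \<bar>a z\<bar>)"
      by (intro Bochner_Integration.integral_norm_bound_integral integrable_test_on[OF K] test_on_mult_cos 0
          integrable_abs) (auto simp: abs_mult)
    then show ?thesis by simp
  qed
  then show ?case by auto
next
  case (Suc n)
  obtain C where C: "\<And>\<xi> c. \<bar>\<xi> $ k\<bar> ^ n * \<bar>LINT z|lborel. pd k a z * cos (\<xi> \<bullet> z + c)\<bar> \<le> C"
    using Suc.IH[OF test_on_pd[OF compact_imp_closed[OF K] Suc.prems]] by blast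
  have "\<bar>\<xi> $ k\<bar> ^ Suc n * \<bar>LINT z|lborel. a z * cos (\<xi> \<bullet> z + c)\<bar> \<le> C" for \<xi> c
  proof -
    have "\<bar>\<xi> $ k\<bar> ^ Suc n * \<bar>LINT z|lborel. a z * cos (\<xi> \<bullet> z + c)\<bar>
        = \<bar>\<xi> $ k\<bar> ^ n * \<bar>\<xi> $ k * (LINT z|lborel. a z * cos (\<xi> \<bullet> z + c))\<bar>"
      by (simp add: abs_mult)
    also have "\<dots> = \<bar>\<xi> $ k\<bar> ^ n * \<bar>LINT z|lborel. pd k a z * cos (\<xi> \<bullet> z + (c - pi/2))\<bar>"
      unfolding integral_cos_by_parts[OF K Suc.prems] by simp
    also have "\<dots> \<le> C" by (rule C)
    finally show ?thesis .
  qed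
  then show ?case by blast
qed

lemma integral_cos_decay:
  fixes a :: "'n::finite phase \<Rightarrow> real"
  assumes K: "compact K" and a: "test_on K a"
  shows "\<exists>C\<ge>0. \<forall>\<xi> c. \<bar>LINT z|lborel. a z * cos (\<xi> \<bullet> z + c)\<bar> * (1 + norm \<xi>) ^ n \<le> C"
proof -
  let ?I = "\<lambda>\<xi> c. \<bar>LINT z|lborel. a z * cos (\<xi> \<bullet> z + c)\<bar>"
  define d where "d = real CARD('n + 'n)"
  have "\<forall>k. \<exists>C. \<forall>\<xi> c. \<bar>\<xi> $ k\<bar> ^ n * ?I \<xi> c \<le> C"
    using integral_cos_component_decay[OF K a] by blast
  from choice[OF this] obtain C where C: "\<forall>k. \<forall>\<xi> c. \<bar>\<xi> $ k\<bar> ^ n * ?I \<xi> c \<le> C k" ..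
  obtain C0 where C0: "\<forall>\<xi> c. ?I \<xi> c \<le> C0"
    using integral_cos_component_decay[OF K a, of undefined 0] by auto
  have C0nn: "C0 \<ge> 0" using C0[rule_format, of 0 0] by linarith
  have Cnn: "C k \<ge> 0" for k
    by (rule order_trans[OF _ C[rule_format, of "0" k 0]]) simp
  have "?I \<xi> c * (1 + norm \<xi>) ^ n \<le> 2 ^ n * (C0 + d ^ n * (\<Sum>k\<in>UNIV. C k))" for \<xi> c
  proof -
    \<comment> \<open>Decay is known one component at a time. The largest component controls the
      norm up to the dimension, so its decay is the one that is used.\<close>
    obtain k where k: "\<And>j. \<bar>\<xi> $ j\<bar> \<le> \<bar>\<xi> $ k\<bar>"
    proof -
      have "Max (range (\<lambda>j. \<bar>\<xi> $ j\<bar>)) \<in> range (\<lambda>j. \<bar>\<xi> $ j\<bar>)" by (intro Max_in) auto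
      then obtain k where "Max (range (\<lambda>j. \<bar>\<xi> $ j\<bar>)) = \<bar>\<xi> $ k\<bar>" by blast
      then have "\<bar>\<xi> $ j\<bar> \<le> \<bar>\<xi> $ k\<bar>" for j using Max_ge[of "range (\<lambda>j. \<bar>\<xi> $ j\<bar>)" "\<bar>\<xi> $ j\<bar>"] by simp
      then show ?thesis by (rule that)
    qed
    have "norm \<xi> \<le> (\<Sum>j\<in>UNIV. \<bar>\<xi> $ j\<bar>)" by (rule norm_le_l1_cart)
    also have "\<dots> \<le> d * \<bar>\<xi> $ k\<bar>" using sum_bounded_above[of UNIV "\<lambda>j. \<bar>\<xi> $ j\<bar>" "\<bar>\<xi> $ k\<bar>"] k by (simp add: d_def)
    finally have le: "norm \<xi> \<le> d * \<bar>\<xi> $ k\<bar>" .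
    have "(1 + norm \<xi>) ^ n \<le> (2 * max 1 (d * \<bar>\<xi> $ k\<bar>)) ^ n" using le by (intro power_mono) auto
    also have "\<dots> = 2 ^ n * max 1 (d * \<bar>\<xi> $ k\<bar>) ^ n" by (simp add: power_mult_distrib)
    also have "\<dots> \<le> 2 ^ n * (1 + (d * \<bar>\<xi> $ k\<bar>) ^ n)"
      by (intro mult_left_mono) (auto simp: max_def d_def)
    finally have "?I \<xi> c * (1 + norm \<xi>) ^ n \<le> ?I \<xi> c * (2 ^ n * (1 + (d * \<bar>\<xi> $ k\<bar>) ^ n))"
      by (intro mult_left_mono) auto
    also have "\<dots> = 2 ^ n * (?I \<xi> c + d ^ n * (\<bar>\<xi> $ k\<bar> ^ n * ?I \<xi> c))"
      by (simp add: algebra_simps power_mult_distrib)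
    also have "\<dots> \<le> 2 ^ n * (C0 + d ^ n * (\<Sum>k\<in>UNIV. C k))"
    proof (intro mult_left_mono add_mono)
      have "\<bar>\<xi> $ k\<bar> ^ n * ?I \<xi> c \<le> C k" using C by blast
      also have "\<dots> \<le> (\<Sum>k\<in>UNIV. C k)" by (rule member_le_sum) (auto simp: Cnn)
      finally show "\<bar>\<xi> $ k\<bar> ^ n * ?I \<xi> c \<le> (\<Sum>k\<in>UNIV. C k)" .
    qed (use C0 in \<open>auto simp: d_def\<close>)
    finally show ?thesis .
  qed
  moreover have "2 ^ n * (C0 + d ^ n * (\<Sum>k\<in>UNIV. C k)) \<ge> 0"
    using C0nn Cnn by (auto simp: d_def intro!: mult_nonneg_nonneg add_nonneg_nonneg sum_nonneg)
  ultimately show ?thesis by blast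
qed

subsection \<open>Bootstrap along the flow\<close>

text \<open>Majorant for \<open>v = exp (- Q) w\<close>, whose derivative is \<open>exp (- Q) h\<close>: the part
  \<open>\<delta> q exp (- Q)\<close> of the bound is the derivative of \<open>- \<delta> exp (- Q)\<close>.\<close>

lemma damped_ode_bound:
  fixes w h q :: "real \<Rightarrow> real"
  assumes q: "continuous_on UNIV q" "\<And>s. q s \<ge> 0"
    and w: "\<And>s. 0 \<le> s \<Longrightarrow> s \<le> T \<Longrightarrow> (w has_real_derivative q s * w s + h s) (at s)"
    and h: "\<And>s. 0 \<le> s \<Longrightarrow> s \<le> T \<Longrightarrow> \<bar>h s\<bar> \<le> B * (\<delta> * q s + 1 / \<delta>)"
    and wT: "\<bar>w T\<bar> \<le> B" and pos: "0 \<le> T" "\<delta> > 0" "B \<ge> 0"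
  shows "\<bar>w 0\<bar> \<le> B * (\<delta> + T / \<delta> + exp (- integral {0..T} q))"
proof -
  \<comment> \<open>The primitive starts at -1 and is then normalised to vanish at 0, so that 0 is
    an interior point and a two-sided derivative exists there.\<close>
  define Q where "Q = (\<lambda>s. integral {-1..s} q - integral {-1..0} q)"
  have qc: "continuous_on S q" for S by (rule continuous_on_subset[OF q(1)]) simp
  have Q: "(Q has_real_derivative q s) (at s)" if "0 \<le> s" for s
  proof -
    have "((\<lambda>s. integral {-1..s} q) has_real_derivative q s) (at s within {-1..s+1})"
      by (rule integral_has_real_derivative[OF qc]) (use that in auto)
    moreover have "at s within {-1..s+1} = at s"
      by (rule at_within_interior) (use that in \<open>auto simp: interior_atLeastAtMost_real\<close>)
    ultimately show ?thesis unfolding Q_def by (auto intro!: derivative_eq_intros)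
  qed
  have Q0: "Q 0 = 0" by (simp add: Q_def)
  have QT: "Q T = integral {0..T} q"
    using Henstock_Kurzweil_Integration.integral_combine[of "-1" 0 T q] pos(1)
      integrable_continuous_interval[OF qc] by (simp add: Q_def)
  define v where "v s = exp (- Q s) * w s" for s
  define P where "P s = B * (s / \<delta> - \<delta> * exp (- Q s))" for s
  have v: "(v has_real_derivative exp (- Q s) * h s) (at s)" if "0 \<le> s" "s \<le> T" for s
    unfolding v_def by (rule derivative_eq_intros w[OF that] Q[OF that(1)] refl)+ (simp add: algebra_simps)
  have P: "(P has_real_derivative B * (1 / \<delta> + \<delta> * (exp (- Q s) * q s))) (at s)" if "0 \<le> s" for s
  proof -
    have "(P has_real_derivative B * (1 / \<delta> - \<delta> * (exp (- Q s) * - q s))) (at s)"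
      unfolding P_def by (intro DERIV_cmult DERIV_diff DERIV_cdivide DERIV_ident DERIV_fun_exp DERIV_minus Q that)
    then show ?thesis by (simp add: algebra_simps)
  qed
  have Qnn: "Q s \<ge> 0" if "0 \<le> s" for s
  proof -
    have "Q 0 \<le> Q s"
      by (rule DERIV_nonneg_imp_nondecreasing[OF that]) (use Q q(2) in blast)
    then show ?thesis by (simp add: Q0)
  qed
  have le: "\<bar>exp (- Q s) * h s\<bar> \<le> B * (1 / \<delta> + \<delta> * (exp (- Q s) * q s))" if "0 \<le> s" "s \<le> T" for s
  proof -
    have "\<bar>exp (- Q s) * h s\<bar> \<le> exp (- Q s) * (B * (\<delta> * q s + 1 / \<delta>))"
      using h[OF that] by (simp add: abs_mult)
    also have "\<dots> = B * (exp (- Q s) * (1 / \<delta>) + \<delta> * (exp (- Q s) * q s))" by (simp add: algebra_simps)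
    also have "\<dots> \<le> B * (1 * (1 / \<delta>) + \<delta> * (exp (- Q s) * q s))"
      using Qnn[OF that(1)] pos by (intro mult_left_mono add_mono mult_right_mono) auto
    finally show ?thesis by simp
  qed
  have "P 0 - v 0 \<le> P T - v T"
  proof (rule DERIV_nonneg_imp_nondecreasing[OF pos(1)])
    fix s assume "0 \<le> s" "s \<le> T"
    with le[of s] DERIV_diff[OF P v]
    show "\<exists>y. ((\<lambda>s. P s - v s) has_real_derivative y) (at s) \<and> 0 \<le> y"
      by (intro exI[of _ "B * (1 / \<delta> + \<delta> * (exp (- Q s) * q s)) - exp (- Q s) * h s"]) auto
  qed
  moreover have "P 0 + v 0 \<le> P T + v T"
  proof (rule DERIV_nonneg_imp_nondecreasing[OF pos(1)])
    fix s assume "0 \<le> s" "s \<le> T"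
    with le[of s] DERIV_add[OF P v]
    show "\<exists>y. ((\<lambda>s. P s + v s) has_real_derivative y) (at s) \<and> 0 \<le> y"
      by (intro exI[of _ "B * (1 / \<delta> + \<delta> * (exp (- Q s) * q s)) + exp (- Q s) * h s"]) auto
  qed
  ultimately have "\<bar>v 0\<bar> \<le> P T - P 0 + \<bar>v T\<bar>" by linarith
  also have "P T - P 0 \<le> B * (\<delta> + T / \<delta>)"
    using pos by (simp add: P_def Q0 algebra_simps)
  also have "\<bar>v T\<bar> \<le> exp (- Q T) * B" using wT by (simp add: v_def abs_mult)
  finally show ?thesis by (simp add: v_def Q0 QT algebra_simps)
qed

section \<open>Local Fourier transforms of a distribution and their order of growth\<close>

definition osc :: "(('n::finite phase \<Rightarrow> real) \<Rightarrow> real) \<Rightarrow> ('n phase \<Rightarrow> real) \<Rightarrow> 'n phase \<Rightarrow> real \<Rightarrow> real"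
  where "osc u a \<xi> c = u (\<lambda>z. a z * cos (\<xi> \<bullet> z + c))"

text \<open>The quantification over all amplitudes is essential: the transport equation for one
  amplitude involves its derivatives and its image under the adjoint. The order is real because each
  improvement is fractional.\<close>

definition osc_order :: "(('n::finite phase \<Rightarrow> real) \<Rightarrow> real) \<Rightarrow> 'n phase set \<Rightarrow> real \<Rightarrow> bool"
  where "osc_order u K \<kappa> \<longleftrightarrow> (\<forall>a. test_on K a \<longrightarrow>
    (\<exists>C\<ge>0. \<forall>\<xi> c. \<bar>osc u a \<xi> c\<bar> \<le> C * (1 + norm \<xi>) powr \<kappa>))"

lemma osc_order_exists:
  assumes "distribution u" "compact K"
  shows "\<exists>m::nat. osc_order u K (real m)"
proof -
  obtain C m where C: "C \<ge> 0" "\<And>\<phi> B. test_on K \<phi> \<Longrightarrow> pd_bound m \<phi> B \<Longrightarrow> \<bar>u \<phi>\<bar> \<le> C * B"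
    using distribution_bound[OF assms] by blast
  have "\<exists>C\<ge>0. \<forall>\<xi> c. \<bar>osc u a \<xi> c\<bar> \<le> C * (1 + norm \<xi>) powr real m" if a: "test_on K a" for a
  proof -
    obtain E where E: "E \<ge> 0" "\<And>\<xi> c. pd_bound m (\<lambda>z. a z * cos (\<xi> \<bullet> z + c)) (E * (1 + norm \<xi>) ^ m)"
      using pd_bound_mult_cos[OF assms(2) a] by blast
    have "\<bar>osc u a \<xi> c\<bar> \<le> C * E * (1 + norm \<xi>) powr real m" for \<xi> c
      using C(2)[OF test_on_mult_cos[OF a] E(2), of \<xi> c]
        powr_realpow[of "1 + norm \<xi>" m] by (simp add: osc_def mult.assoc add_pos_nonneg)
    then show ?thesis using C(1) E(1) by (intro exI[of _ "C * E"]) simp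
  qed
  then show ?thesis unfolding osc_order_def by blast
qed

lemma smooth_drift: "smooth_fun (\<lambda>w. \<Sum>a\<in>UNIV. w $ a * M $ a $ b)"
  by (intro smooth_sum smooth_mult smooth_nth smooth_const)

lemma test_on_FP_adj:
  assumes "closed K" "test_on K a"
  shows "test_on K (FP_adj M \<gamma> \<theta> a)"
proof -
  have "test_on K (\<lambda>z. (\<Sum>b\<in>UNIV. pd b (\<lambda>w. (\<Sum>a\<in>UNIV. w $ a * M $ a $ b) * a w) z)
     + (\<Sum>i\<in>UNIV. (\<gamma> i * \<theta> i) * pd (Inl i) (pd (Inl i) a) z))"
    by (intro test_on_add test_on_sum test_on_cmult test_on_pd[OF assms(1)] test_on_mult'[OF assms(2)]
        assms(2) smooth_drift)
  then show ?thesis by (simp add: FP_adj_def[abs_def])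
qed

text \<open>In order: the adjoint acting on the amplitude; the drift differentiating the phase,
  which pairs to (M \<xi>) \<bullet> z; the cross terms of the second derivatives, linear in \<xi>;
  and the second derivatives of the cosine, which give the damping.\<close>

lemma FP_adj_mult_cos:
  assumes a: "smooth_fun a"
  shows "FP_adj M \<gamma> \<theta> (\<lambda>z. a z * cos (\<xi> \<bullet> z + c)) z =
    FP_adj M \<gamma> \<theta> a z * cos (\<xi> \<bullet> z + c)
    + a z * ((M *v \<xi>) \<bullet> z) * cos (\<xi> \<bullet> z + (c + pi/2))
    + (\<Sum>i\<in>UNIV. (2 * (\<gamma> i * \<theta> i) * \<xi> $ Inl i) * (pd (Inl i) a z * cos (\<xi> \<bullet> z + (c + pi/2))))
    - (\<Sum>i\<in>UNIV. \<gamma> i * \<theta> i * (\<xi> $ Inl i)\<^sup>2) * (a z * cos (\<xi> \<bullet> z + c))"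
proof -
  let ?l = "\<lambda>b w. \<Sum>a\<in>UNIV. w $ a * M $ a $ b"
  let ?c = "cos (\<xi> \<bullet> z + c)" and ?c' = "cos (\<xi> \<bullet> z + (c + pi/2))"
  have 1: "pd b (\<lambda>w. ?l b w * (a w * cos (\<xi> \<bullet> w + c))) z =
      pd b (\<lambda>w. ?l b w * a w) z * ?c + \<xi> $ b * (?l b z * a z * ?c')" for b
    using fun_cong[OF pd_mult_cos[OF smooth_mult[OF smooth_drift[of M b] a], of b \<xi> c], of z]
    by (simp add: mult.assoc)
  have 2: "pd k (pd k (\<lambda>z. a z * cos (\<xi> \<bullet> z + c))) z =
      pd k (pd k a) z * ?c + 2 * \<xi> $ k * (pd k a z * ?c') - (\<xi> $ k)\<^sup>2 * (a z * ?c)" for k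
  proof -
    have pa: "smooth_fun (pd k a)" by (rule smooth_pd[OF a])
    have cpi: "cos (\<xi> \<bullet> z + (c + pi/2 + pi/2)) = - ?c"
      using cos_periodic_pi[of "\<xi> \<bullet> z + c"] by (simp add: add.assoc)
    have "pd k (pd k (\<lambda>z. a z * cos (\<xi> \<bullet> z + c))) z =
        pd k (\<lambda>z. pd k a z * cos (\<xi> \<bullet> z + c)) z + pd k (\<lambda>z. \<xi> $ k * (a z * cos (\<xi> \<bullet> z + (c + pi/2)))) z"
      unfolding pd_mult_cos[OF a] by (subst pd_add) (intro smooth_mult_cos smooth_cmult a pa refl)+
    also have "\<dots> = (pd k (pd k a) z * ?c + \<xi> $ k * (pd k a z * ?c'))
        + \<xi> $ k * (pd k a z * ?c' + \<xi> $ k * (a z * cos (\<xi> \<bullet> z + (c + pi/2 + pi/2))))"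
      unfolding pd_cmult[OF smooth_mult_cos[OF a]] pd_mult_cos[OF a] pd_mult_cos[OF pa] ..
    finally show ?thesis unfolding cpi by (simp add: algebra_simps power2_eq_square)
  qed
  have 3: "(\<Sum>b\<in>UNIV. \<xi> $ b * ?l b z) = (M *v \<xi>) \<bullet> z"
    unfolding inner_vec_def matrix_vector_mult_def
    by (simp add: sum_distrib_left sum_distrib_right mult_ac) (subst sum.swap, rule refl)
  have "(\<Sum>b\<in>UNIV. pd b (\<lambda>w. ?l b w * (a w * cos (\<xi> \<bullet> w + c))) z) =
      (\<Sum>b\<in>UNIV. pd b (\<lambda>w. ?l b w * a w) z) * ?c + (\<Sum>b\<in>UNIV. \<xi> $ b * ?l b z) * (a z * ?c')"
  proof -
    have "(\<Sum>b\<in>UNIV. P b * r + x b * (L b * A * C)) = (\<Sum>b\<in>UNIV. P b) * r + (\<Sum>b\<in>UNIV. x b * L b) * (A * C)"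
      for P x L :: "'a + 'a \<Rightarrow> real" and r A C
      by (simp add: sum.distrib sum_distrib_right mult.assoc)
    then show ?thesis unfolding 1 .
  qed
  moreover have "(\<Sum>i\<in>UNIV. \<gamma> i * \<theta> i * pd (Inl i) (pd (Inl i) (\<lambda>z. a z * cos (\<xi> \<bullet> z + c))) z) =
      (\<Sum>i\<in>UNIV. \<gamma> i * \<theta> i * pd (Inl i) (pd (Inl i) a) z) * ?c
      + (\<Sum>i\<in>UNIV. (2 * (\<gamma> i * \<theta> i) * \<xi> $ Inl i) * (pd (Inl i) a z * ?c'))
      - (\<Sum>i\<in>UNIV. \<gamma> i * \<theta> i * (\<xi> $ Inl i)\<^sup>2) * (a z * ?c)"
    unfolding 2 sum_distrib_right sum.distrib[symmetric] sum_subtractf[symmetric]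
    by (rule sum.cong) (auto simp: algebra_simps)
  ultimately show ?thesis unfolding FP_adj_def 3 by (simp add: algebra_simps)
qed

text \<open>The drift term of \<open>FP_adj_mult_cos\<close> is the time derivative of the transform
  when the frequency solves y' = M y, so the equation for \<open>u\<close> is solved for it. The
  coefficient +q means growth forward in time: the value at time 0 is recovered, damped, from a
  later one.\<close>

lemma osc_transport:
  assumes u: "distribution u" and K: "compact K" and a: "test_on K a" and f: "smooth_fun f"
    and eq: "\<And>\<phi>. test_fun \<phi> \<Longrightarrow> FP_dist M \<gamma> \<theta> u \<phi> = (LINT z|lborel. f z * \<phi> z)"
    and y: "\<And>s. (y has_vector_derivative M *v y s) (at s)"
  shows "((\<lambda>s. osc u a (y s) c) has_real_derivative
    (\<Sum>i\<in>UNIV. \<gamma> i * \<theta> i * (y s $ Inl i)\<^sup>2) * osc u a (y s) c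
    + ((LINT z|lborel. (f z * a z) * cos (y s \<bullet> z + c)) - osc u (FP_adj M \<gamma> \<theta> a) (y s) c
      - (\<Sum>i\<in>UNIV. (2 * (\<gamma> i * \<theta> i) * y s $ Inl i) * osc u (pd (Inl i) a) (y s) (c + pi/2)))) (at s)"
proof -
  let ?\<xi> = "y s"
  let ?q = "\<Sum>i\<in>UNIV. \<gamma> i * \<theta> i * (y s $ Inl i)\<^sup>2"
  have cl: "closed K" by (rule compact_imp_closed[OF K])
  have sm: "smooth_fun a" using a by (simp add: test_on_def)
  let ?A = "\<lambda>z. FP_adj M \<gamma> \<theta> a z * cos (?\<xi> \<bullet> z + c)"
  let ?B = "\<lambda>z. a z * ((M *v ?\<xi>) \<bullet> z) * cos (?\<xi> \<bullet> z + (c + pi/2))"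
  let ?Ci = "\<lambda>i z. (2 * (\<gamma> i * \<theta> i) * ?\<xi> $ Inl i) * (pd (Inl i) a z * cos (?\<xi> \<bullet> z + (c + pi/2)))"
  let ?D = "\<lambda>z. ?q * (a z * cos (?\<xi> \<bullet> z + c))"
  have tA: "test_on K ?A" by (rule test_on_mult_cos[OF test_on_FP_adj[OF cl a]])
  have tB: "test_on K ?B" by (rule test_on_mult_cos[OF test_on_mult[OF a smooth_inner]])
  have tCi: "test_on K (?Ci i)" for i by (rule test_on_cmult[OF test_on_mult_cos[OF test_on_pd[OF cl a]]])
  have tC: "test_on K (\<lambda>z. \<Sum>i\<in>UNIV. ?Ci i z)" by (rule test_on_sum) (rule tCi)
  have tD: "test_on K ?D" by (rule test_on_cmult[OF test_on_mult_cos[OF a]])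
  have "(LINT z|lborel. (f z * a z) * cos (?\<xi> \<bullet> z + c)) = u (FP_adj M \<gamma> \<theta> (\<lambda>z. a z * cos (?\<xi> \<bullet> z + c)))"
    using eq[OF test_on_imp_test[OF K test_on_mult_cos[OF a, of ?\<xi> c]]] by (simp add: FP_dist_def mult.assoc)
  also have "FP_adj M \<gamma> \<theta> (\<lambda>z. a z * cos (?\<xi> \<bullet> z + c)) = (\<lambda>z. ?A z + ?B z + (\<Sum>i\<in>UNIV. ?Ci i z) - ?D z)"
    by (rule ext) (rule FP_adj_mult_cos[OF sm])
  also have "u \<dots> = u ?A + u ?B + (\<Sum>i\<in>UNIV. u (?Ci i)) - u ?D"
    unfolding dist_diff[OF u K test_on_add[OF test_on_add[OF tA tB] tC] tD]
      dist_add[OF u K test_on_add[OF tA tB] tC] dist_add[OF u K tA tB]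
    by (simp add: dist_sum[OF u K tCi])
  also have "(\<Sum>i\<in>UNIV. u (?Ci i)) =
      (\<Sum>i\<in>UNIV. (2 * (\<gamma> i * \<theta> i) * ?\<xi> $ Inl i) * osc u (pd (Inl i) a) ?\<xi> (c + pi/2))"
    unfolding osc_def by (rule sum.cong[OF refl]) (rule dist_cmult[OF u K test_on_mult_cos[OF test_on_pd[OF cl a]]])
  also have "u ?D = ?q * osc u a ?\<xi> c"
    unfolding osc_def by (rule dist_cmult[OF u K test_on_mult_cos[OF a]])
  also have "u ?A = osc u (FP_adj M \<gamma> \<theta> a) ?\<xi> c" by (simp add: osc_def)
  finally have "u ?B = ?q * osc u a ?\<xi> c
    + ((LINT z|lborel. (f z * a z) * cos (?\<xi> \<bullet> z + c)) - osc u (FP_adj M \<gamma> \<theta> a) ?\<xi> c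
      - (\<Sum>i\<in>UNIV. (2 * (\<gamma> i * \<theta> i) * ?\<xi> $ Inl i) * osc u (pd (Inl i) a) ?\<xi> (c + pi/2)))"
    by linarith
  with distribution_cos_derivative[OF u K a y, of c s] show ?thesis by (simp add: osc_def)
qed

text \<open>The exponent becomes negative during the iteration; the absolute value covers both
  monotonicities of the power.\<close>

lemma powr_comparable:
  fixes t x A \<kappa> :: real
  assumes "1 \<le> A" "0 < x" "x \<le> A * t" "t \<le> A * x"
  shows "t powr \<kappa> \<le> A powr \<bar>\<kappa>\<bar> * x powr \<kappa>"
proof (cases "\<kappa> \<ge> 0")
  case True
  have "t > 0" using assms by (metis less_le_trans zero_less_mult_pos less_le not_less zero_less_one)
  then have "t powr \<kappa> \<le> (A * x) powr \<kappa>" using assms True by (intro powr_mono2) auto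
  then show ?thesis using assms True by (simp add: powr_mult)
next
  case False
  have "x / A > 0" "x / A \<le> t" using assms by (auto simp: field_simps)
  then have "t powr \<kappa> \<le> (x / A) powr \<kappa>" using False by (intro powr_mono2') auto
  then show ?thesis using assms False by (simp add: powr_divide powr_minus_divide)
qed

text \<open>Every transform along the trajectory is bounded by the order already known. During unit
  time the flow changes norms by a bounded factor only, so these bounds are comparable with the one
  at \<xi>, and the damped equation gains the extra power.\<close>

lemma osc_order_improve:
  fixes u :: "('n::finite phase \<Rightarrow> real) \<Rightarrow> real"
  assumes u: "distribution u" and K: "compact K" and f: "smooth_fun f"
    and eq: "\<And>\<phi>. test_fun \<phi> \<Longrightarrow> FP_dist M \<gamma> \<theta> u \<phi> = (LINT z|lborel. f z * \<phi> z)"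
    and g: "\<And>i. \<gamma> i * \<theta> i \<ge> 0"
    and C0: "C0 > 0" and obs: "\<And>y s. (\<And>s. (y has_vector_derivative M *v y s) (at s)) \<Longrightarrow>
      0 < s \<Longrightarrow> s \<le> 1 \<Longrightarrow> C0 * s ^ m * (norm (y 0))\<^sup>2 \<le>
        integral {0..s} (\<lambda>r. \<Sum>i\<in>UNIV. \<gamma> i * \<theta> i * (y r $ Inl i)\<^sup>2)"
    and ord: "osc_order u K \<kappa>"
  shows "osc_order u K (\<kappa> - 1 / (2 * (real m + 1)))"
  unfolding osc_order_def
proof (intro allI impI)
  fix a :: "'n phase \<Rightarrow> real" assume a: "test_on K a"
  define \<epsilon> where "\<epsilon> = 1 / (2 * (real m + 1))"
  have \<epsilon>: "0 < \<epsilon>" "\<epsilon> \<le> 1" "2 * \<epsilon> * (real m + 1) = 1" by (auto simp: \<epsilon>_def field_simps)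
  have cl: "closed K" by (rule compact_imp_closed[OF K])
  obtain cM where cM: "cM \<ge> 0" "\<And>v. norm (M *v v) \<le> cM * norm v" using matrix_bound[of M] by blast
  obtain C1 where C1: "C1 \<ge> 0" "\<And>\<xi> c. \<bar>osc u a \<xi> c\<bar> \<le> C1 * (1 + norm \<xi>) powr \<kappa>"
    using ord a unfolding osc_order_def by blast
  obtain C2 where C2: "C2 \<ge> 0" "\<And>\<xi> c. \<bar>osc u (FP_adj M \<gamma> \<theta> a) \<xi> c\<bar> \<le> C2 * (1 + norm \<xi>) powr \<kappa>"
    using ord test_on_FP_adj[OF cl a] unfolding osc_order_def by blast
  have "\<forall>i. \<exists>C. C \<ge> 0 \<and> (\<forall>\<xi> c. \<bar>osc u (pd (Inl i) a) \<xi> c\<bar> \<le> C * (1 + norm \<xi>) powr \<kappa>)"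
    using ord test_on_pd[OF cl a] unfolding osc_order_def by blast
  from choice[OF this] obtain C3 where C3': "\<forall>i. C3 i \<ge> 0 \<and>
      (\<forall>\<xi> c. \<bar>osc u (pd (Inl i) a) \<xi> c\<bar> \<le> C3 i * (1 + norm \<xi>) powr \<kappa>)" ..
  then have C3: "\<And>i. C3 i \<ge> 0" "\<And>i \<xi> c. \<bar>osc u (pd (Inl i) a) \<xi> c\<bar> \<le> C3 i * (1 + norm \<xi>) powr \<kappa>"
    by blast+
  \<comment> \<open>Integrals against smooth functions decay at any rate; this exponent is large
    enough to beat the power \<open>\<kappa>\<close> even when it is negative.\<close>
  obtain C4 where C4: "C4 \<ge> 0" "\<And>\<xi> c. \<bar>LINT z|lborel. (f z * a z) * cos (\<xi> \<bullet> z + c)\<bar> * (1 + norm \<xi>) ^ nat \<lceil>\<bar>\<kappa>\<bar>\<rceil> \<le> C4"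
    using integral_cos_decay[OF K test_on_mult'[OF a f]] by blast
  have I: "\<bar>LINT z|lborel. (f z * a z) * cos (\<xi> \<bullet> z + c)\<bar> \<le> C4 * (1 + norm \<xi>) powr \<kappa>" for \<xi> c
  proof -
    let ?x = "1 + norm \<xi>" and ?n = "nat \<lceil>\<bar>\<kappa>\<bar>\<rceil>"
    have x: "?x \<ge> 1" "?x > 0" by (auto simp: add_pos_nonneg)
    have "\<bar>LINT z|lborel. (f z * a z) * cos (\<xi> \<bullet> z + c)\<bar> \<le> C4 * ?x powr (- real ?n)"
    proof -
      have e: "?x powr (- real k) = 1 / ?x ^ k" for k using x by (simp add: powr_minus_divide powr_realpow)
      show ?thesis unfolding e using C4(2)[of \<xi> c] x by (simp add: le_divide_eq)
    qed
    also have "\<dots> \<le> C4 * ?x powr \<kappa>"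
    proof (intro mult_left_mono powr_mono C4 x)
      have "\<bar>\<kappa>\<bar> \<le> real ?n" by linarith
      then show "- real ?n \<le> \<kappa>" by linarith
    qed
    finally show ?thesis .
  qed
  define S3 where "S3 = (\<Sum>i\<in>UNIV. C3 i)"
  have S3: "S3 \<ge> 0" "C3 i \<le> S3" for i
    unfolding S3_def using C3(1) by (auto intro!: sum_nonneg member_le_sum)
  define G where "G = (\<Sum>i\<in>UNIV. \<gamma> i * \<theta> i)"
  have G: "G \<ge> 0" unfolding G_def using g by (intro sum_nonneg)
  define E where "E = exp cM powr \<bar>\<kappa>\<bar>"
  have E: "E > 0" by (simp add: E_def)
  define B0 where "B0 = C4 + C2 + S3 + S3 * G"
  have B0: "B0 \<ge> 0" using C4 C2 S3 G by (simp add: B0_def)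
  define F where "F = 2 * C1 + 2 * (C1 + B0) * E * (2 + 1 / C0)"
  have "\<bar>osc u a \<xi> c\<bar> \<le> F * (1 + norm \<xi>) powr (\<kappa> - \<epsilon>)" for \<xi> c
  proof (cases "norm \<xi> \<ge> 1")
    case False
    let ?x = "1 + norm \<xi>"
    have x: "?x \<ge> 1" "?x \<le> 2" using False by auto
    have "?x powr \<epsilon> \<le> ?x powr 1" using x \<epsilon> by (intro powr_mono) auto
    then have "?x powr \<epsilon> \<le> 2" using x by simp
    have "\<bar>osc u a \<xi> c\<bar> \<le> C1 * (?x powr (\<kappa> - \<epsilon>) * ?x powr \<epsilon>)"
      using C1(2)[of \<xi> c] by (simp add: powr_add[symmetric])
    also have "\<dots> \<le> C1 * (?x powr (\<kappa> - \<epsilon>) * 2)"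
      using \<open>?x powr \<epsilon> \<le> 2\<close> C1 by (intro mult_left_mono) auto
    also have "\<dots> = 2 * C1 * ?x powr (\<kappa> - \<epsilon>)" by simp
    also have "\<dots> \<le> F * ?x powr (\<kappa> - \<epsilon>)"
      unfolding F_def using C1 B0 E C0 by (intro mult_right_mono) auto
    finally show ?thesis .
  next
    case True
    define r where "r = norm \<xi>"
    have r: "r \<ge> 1" using True by (simp add: r_def)
    obtain y where y0: "y 0 = \<xi>" and y: "\<And>s. (y has_vector_derivative M *v y s) (at s)"
      using linear_flow_exists[of \<xi> M] by blast
    define X where "X = (1 + r) powr \<kappa>"
    have X: "X > 0" using r by (simp add: X_def)
    have comp: "(1 + norm (y s)) powr \<kappa> \<le> E * X" if "0 \<le> s" "s \<le> 1" for s
      unfolding E_def X_def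
    proof (rule powr_comparable)
      have e: "exp cM \<ge> 1" using cM(1) by simp
      show "1 \<le> exp cM" by (rule e)
      have "norm (y s) \<le> exp cM * r" "exp (- cM) * r \<le> norm (y s)"
        using linear_flow_norm[OF cM y that] by (auto simp: y0 r_def)
      then show "1 + norm (y s) \<le> exp cM * (1 + r)" "1 + r \<le> exp cM * (1 + norm (y s))"
        using e by (auto simp: exp_minus field_simps intro: add_mono)
    qed (use r in simp)
    \<comment> \<open>The choice T = \<delta>^2 equalises the two error contributions \<delta> and
      T/\<delta>.\<close>
    define \<delta> where "\<delta> = r powr (- \<epsilon>)"
    define T where "T = r powr (- 2 * \<epsilon>)"
    have \<delta>: "0 < \<delta>" "\<delta> \<le> 1" using r \<epsilon> powr_mono[of "- \<epsilon>" 0 r] by (auto simp: \<delta>_def)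
    have T: "0 < T" "T \<le> 1" "T / \<delta> = \<delta>"
      using r \<epsilon> powr_mono[of "- 2 * \<epsilon>" 0 r] by (auto simp: T_def \<delta>_def powr_diff[symmetric])
    define q where "q s = (\<Sum>i\<in>UNIV. \<gamma> i * \<theta> i * (y s $ Inl i)\<^sup>2)" for s
    define h where "h s = (LINT z|lborel. (f z * a z) * cos (y s \<bullet> z + c)) - osc u (FP_adj M \<gamma> \<theta> a) (y s) c
      - (\<Sum>i\<in>UNIV. (2 * (\<gamma> i * \<theta> i) * y s $ Inl i) * osc u (pd (Inl i) a) (y s) (c + pi/2))" for s
    define B where "B = (C1 + B0) * (E * X)"
    have "continuous_on UNIV y"
      by (intro continuous_at_imp_continuous_on ballI has_vector_derivative_continuous[OF y])
    then have contq: "continuous_on UNIV q" unfolding q_def by (intro continuous_intros)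
    have q0: "q s \<ge> 0" for s unfolding q_def by (rule sum_nonneg) (rule mult_nonneg_nonneg[OF g zero_le_power2])
    have "\<bar>osc u a (y 0) c\<bar> \<le> B * (\<delta> + T / \<delta> + exp (- integral {0..T} q))"
    proof (rule damped_ode_bound[where w = "\<lambda>s. osc u a (y s) c" and h = h, OF contq q0])
      show "((\<lambda>s. osc u a (y s) c) has_real_derivative q s * osc u a (y s) c + h s) (at s)" for s
        unfolding q_def h_def by (rule osc_transport[OF u K a f eq y])
      show "\<bar>osc u a (y T) c\<bar> \<le> B"
      proof -
        have "\<bar>osc u a (y T) c\<bar> \<le> C1 * (1 + norm (y T)) powr \<kappa>" by (rule C1)
        also have "\<dots> \<le> C1 * (E * X)" using comp[of T] T C1 by (intro mult_left_mono) auto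
        also have "\<dots> \<le> B" unfolding B_def using B0 E X by (intro mult_right_mono) auto
        finally show ?thesis .
      qed
      show "B \<ge> 0" using C1 B0 E X by (simp add: B_def)
      fix s assume "0 \<le> s" "s \<le> T"
      then have s: "0 \<le> s" "s \<le> 1" using T by auto
      have bd: "C * (1 + norm (y s)) powr \<kappa> \<le> C * (E * X)" if "C \<ge> 0" for C
        using comp[OF s] that by (intro mult_left_mono)
      let ?t = "\<lambda>i. (2 * (\<gamma> i * \<theta> i) * y s $ Inl i) * osc u (pd (Inl i) a) (y s) (c + pi/2)"
      have "\<bar>?t i\<bar> \<le> (\<gamma> i * \<theta> i * (\<delta> * (y s $ Inl i)\<^sup>2 + 1 / \<delta>)) * (S3 * (E * X))" for i
      proof -
        \<comment> \<open>Completing the square: the cross term is linear in the momentum frequency,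
          and this turns it into a small multiple of the damping plus a large constant.\<close>
        have am: "2 * \<bar>y s $ Inl i\<bar> \<le> \<delta> * (y s $ Inl i)\<^sup>2 + 1 / \<delta>"
        proof -
          have "0 \<le> (\<delta> * \<bar>y s $ Inl i\<bar> - 1)\<^sup>2" by simp
          also have "\<dots> = \<delta> * (\<delta> * (y s $ Inl i)\<^sup>2 - 2 * \<bar>y s $ Inl i\<bar>) + 1"
            by (simp add: power2_eq_square algebra_simps)
          finally show ?thesis using \<delta> by (simp add: field_simps)
        qed
        have e: "\<bar>2 * G * Y\<bar> = G * (2 * \<bar>Y\<bar>)" if "G \<ge> 0" for G Y :: real
          using that by (simp add: abs_mult)
        from am have 1: "\<bar>2 * (\<gamma> i * \<theta> i) * y s $ Inl i\<bar> \<le> \<gamma> i * \<theta> i * (\<delta> * (y s $ Inl i)\<^sup>2 + 1 / \<delta>)"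
          unfolding e[OF g] by (rule mult_left_mono[OF _ g])
        have "\<bar>osc u (pd (Inl i) a) (y s) (c + pi/2)\<bar> \<le> C3 i * (1 + norm (y s)) powr \<kappa>" by (rule C3)
        also have "\<dots> \<le> C3 i * (E * X)" by (rule bd[OF C3(1)])
        also have "\<dots> \<le> S3 * (E * X)" using S3 E X by (intro mult_right_mono) auto
        finally have 2: "\<bar>osc u (pd (Inl i) a) (y s) (c + pi/2)\<bar> \<le> S3 * (E * X)" .
        show ?thesis unfolding abs_mult[of "2 * (\<gamma> i * \<theta> i) * y s $ Inl i"]
          using 1 2 by (intro mult_mono) (auto intro: order_trans[OF abs_ge_zero])
      qed
      then have "\<bar>\<Sum>i\<in>UNIV. ?t i\<bar> \<le> (\<Sum>i\<in>UNIV. (\<gamma> i * \<theta> i * (\<delta> * (y s $ Inl i)\<^sup>2 + 1 / \<delta>)) * (S3 * (E * X)))"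
        by (intro order_trans[OF sum_abs] sum_mono)
      also have "\<dots> = (\<delta> * q s + G / \<delta>) * (S3 * (E * X))"
        by (simp add: q_def G_def sum_distrib_left sum_distrib_right sum_divide_distrib sum.distrib[symmetric]
            algebra_simps)
      finally have 3: "\<bar>\<Sum>i\<in>UNIV. ?t i\<bar> \<le> (\<delta> * q s + G / \<delta>) * (S3 * (E * X))" .
      have "\<bar>h s\<bar> \<le> C4 * (E * X) + C2 * (E * X) + (\<delta> * q s + G / \<delta>) * (S3 * (E * X))"
        using 3 order_trans[OF I bd[OF C4(1)], of c] order_trans[OF C2(2) bd[OF C2(1)], of c]
        unfolding h_def by linarith
      also have "\<dots> = (C4 + C2 + S3 * (\<delta> * q s) + S3 * G * (1 / \<delta>)) * (E * X)" by (simp add: algebra_simps)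
      also have "\<dots> \<le> (B0 * (\<delta> * q s + 1 / \<delta>)) * (E * X)"
      proof (intro mult_right_mono)
        have d1: "1 \<le> 1 / \<delta>" using \<delta> by simp
        have "C4 * 1 \<le> C4 * (1 / \<delta>)" "C2 * 1 \<le> C2 * (1 / \<delta>)" by (intro mult_left_mono d1 C4 C2)+
        moreover have "0 \<le> S3 * (1 / \<delta>)" "0 \<le> (C4 + C2 + S3 * G) * (\<delta> * q s)"
          using S3 C4 C2 G \<delta> q0[of s] by auto
        ultimately show "C4 + C2 + S3 * (\<delta> * q s) + S3 * G * (1 / \<delta>) \<le> B0 * (\<delta> * q s + 1 / \<delta>)"
          unfolding B0_def by (simp add: algebra_simps)
      qed (use E X in auto)
      also have "\<dots> \<le> B * (\<delta> * q s + 1 / \<delta>)"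
        unfolding B_def using C1 E X \<delta> q0[of s] by (simp add: algebra_simps)
      finally show "\<bar>h s\<bar> \<le> B * (\<delta> * q s + 1 / \<delta>)" .
    qed (use T \<delta> in auto)
    also have "\<dots> \<le> B * ((2 + 1 / C0) * \<delta>)"
    proof (intro mult_left_mono)
      \<comment> \<open>Here \<open>\<epsilon>\<close> is used in full: it makes r T^(m+1) equal to
        1, so T^m r^2 is at least r even though T shrinks.\<close>
      have "C0 * r \<le> C0 * T ^ m * r\<^sup>2"
      proof -
        have "r * T powr (real m + 1) = r powr (1 + (- 2 * \<epsilon>) * (real m + 1))"
          unfolding T_def powr_powr powr_add[of r 1 "(- 2 * \<epsilon>) * (real m + 1)"] using r by simp
        also have "1 + (- 2 * \<epsilon>) * (real m + 1) = 0" using \<epsilon>(3) by (simp add: algebra_simps)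
        finally have e1: "r * (T ^ m * T) = 1" using r T by (simp add: powr_add powr_realpow)
        have "r = r * (r * (T ^ m * T))" using e1 by simp
        also have "\<dots> \<le> r * (r * (T ^ m * 1))"
          using r T by (intro mult_left_mono) auto
        finally have "r \<le> T ^ m * r\<^sup>2" by (simp add: power2_eq_square mult_ac)
        then show ?thesis using C0 by (simp add: mult.assoc)
      qed
      also have "\<dots> \<le> integral {0..T} q"
        unfolding q_def using obs[OF y T(1,2)] by (simp add: y0 r_def)
      finally have "exp (- integral {0..T} q) \<le> exp (- (C0 * r))" by simp
      also have "\<dots> \<le> 1 / (C0 * r)"
      proof -
        have "C0 * r \<le> exp (C0 * r)" using exp_ge_add_one_self[of "C0 * r"] by linarith
        then show ?thesis using C0 r by (simp add: exp_minus field_simps)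
      qed
      also have "1 / (C0 * r) \<le> 1 / C0 * \<delta>"
      proof -
        have "r powr (-1) \<le> r powr (- \<epsilon>)" using r \<epsilon> by (intro powr_mono) auto
        then show ?thesis using r C0 by (simp add: \<delta>_def powr_minus_divide field_simps)
      qed
      finally show "\<delta> + T / \<delta> + exp (- integral {0..T} q) \<le> (2 + 1 / C0) * \<delta>"
        using T by (simp add: algebra_simps)
    qed (use C1 B0 E X in \<open>simp add: B_def\<close>)
    also have "\<dots> \<le> B * ((2 + 1 / C0) * (2 * (1 + r) powr (- \<epsilon>)))"
    proof (intro mult_left_mono)
      have "\<delta> \<le> ((1 + r) / 2) powr (- \<epsilon>)" unfolding \<delta>_def using r \<epsilon> by (intro powr_mono2') auto
      also have "\<dots> = 2 powr \<epsilon> * (1 + r) powr (- \<epsilon>)" using r by (simp add: powr_divide powr_minus_divide)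
      also have "\<dots> \<le> 2 powr 1 * (1 + r) powr (- \<epsilon>)" using \<epsilon> by (intro mult_right_mono powr_mono) auto
      finally show "\<delta> \<le> 2 * (1 + r) powr (- \<epsilon>)" by simp
    qed (use C0 C1 B0 E X in \<open>auto simp: B_def\<close>)
    also have "\<dots> = 2 * (C1 + B0) * E * (2 + 1 / C0) * (1 + r) powr (\<kappa> - \<epsilon>)"
    proof -
      have "(1 + r) powr (\<kappa> - \<epsilon>) = X * (1 + r) powr (- \<epsilon>)"
        unfolding X_def by (simp add: powr_add[symmetric])
      then show ?thesis by (simp only: B_def mult_ac)
    qed
    also have "\<dots> \<le> F * (1 + r) powr (\<kappa> - \<epsilon>)"
      unfolding F_def using C1 by (intro mult_right_mono) auto
    finally show ?thesis by (simp add: y0 r_def)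
  qed
  moreover have "F \<ge> 0" unfolding F_def using C1 B0 E C0 by (intro add_nonneg_nonneg mult_nonneg_nonneg) auto
  ultimately show "\<exists>C\<ge>0. \<forall>\<xi> c. \<bar>osc u a \<xi> c\<bar> \<le> C * (1 + norm \<xi>) powr (\<kappa> - 1 / (2 * (real m + 1)))"
    unfolding \<epsilon>_def by blast
qed

text \<open>The gain in \<open>osc_order_improve\<close> depends on \<open>M\<close>,
  \<open>\<gamma>\<close> and \<open>\<theta>\<close> through \<open>m\<close> but not on the
  current order, so finitely many improvements reach any prescribed decay.\<close>

lemma osc_rapid_decay:
  fixes u :: "('n::finite phase \<Rightarrow> real) \<Rightarrow> real"
  assumes u: "distribution u" and K: "compact K" and f: "smooth_fun f"
    and eq: "\<And>\<phi>. test_fun \<phi> \<Longrightarrow> FP_dist M \<gamma> \<theta> u \<phi> = (LINT z|lborel. f z * \<phi> z)"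
    and g: "\<And>i. \<gamma> i * \<theta> i \<ge> 0"
    and obs: "\<And>\<xi>. \<xi> \<noteq> 0 \<Longrightarrow> \<exists>j i. \<gamma> i * \<theta> i > 0 \<and> (((*v) M ^^ j) \<xi>) $ Inl i \<noteq> 0"
    and a: "test_on K a"
  shows "\<exists>C\<ge>0. \<forall>\<xi> c. \<bar>osc u a \<xi> c\<bar> * (1 + norm \<xi>) ^ n \<le> C"
proof -
  have "\<exists>C0>0. \<exists>m. \<forall>y s. (\<forall>s. (y has_vector_derivative M *v y s) (at s)) \<longrightarrow> 0 < s \<longrightarrow> s \<le> 1 \<longrightarrow>
      C0 * s ^ m * (norm (y 0))\<^sup>2 \<le> integral {0..s} (\<lambda>r. \<Sum>i\<in>UNIV. \<gamma> i * \<theta> i * (y r $ Inl i)\<^sup>2)"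
  proof (rule flow_observability[of "\<lambda>i. \<gamma> i * \<theta> i" M Inl, OF g obs])
    fix C m assume "0 < C" "\<And>y s. (\<And>s. (y has_vector_derivative M *v y s) (at s)) \<Longrightarrow> 0 < s \<Longrightarrow> s \<le> 1 \<Longrightarrow>
      C * s ^ m * (norm (y 0))\<^sup>2 \<le> integral {0..s} (\<lambda>r. \<Sum>i\<in>UNIV. \<gamma> i * \<theta> i * (y r $ Inl i)\<^sup>2)"
    then show ?thesis by blast
  qed
  then obtain C0 m where C0: "C0 > 0" and ob: "\<And>y s. (\<And>s. (y has_vector_derivative M *v y s) (at s)) \<Longrightarrow>
      0 < s \<Longrightarrow> s \<le> 1 \<Longrightarrow> C0 * s ^ m * (norm (y 0))\<^sup>2 \<le>
        integral {0..s} (\<lambda>r. \<Sum>i\<in>UNIV. \<gamma> i * \<theta> i * (y r $ Inl i)\<^sup>2)"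
    by blast
  define \<epsilon> where "\<epsilon> = 1 / (2 * (real m + 1))"
  have \<epsilon>: "\<epsilon> > 0" by (simp add: \<epsilon>_def)
  obtain p :: nat where p: "osc_order u K (real p)" using osc_order_exists[OF u K] by blast
  have it: "osc_order u K (real p - real N * \<epsilon>)" for N
  proof (induction N)
    case (Suc N)
    from osc_order_improve[OF u K f eq g C0 ob Suc]
    show ?case by (simp add: \<epsilon>_def algebra_simps add_divide_distrib)
  qed (use p in simp)
  \<comment> \<open>Enough steps of size \<open>\<epsilon>\<close> to descend from the initial order
    p to -n.\<close>
  obtain N :: nat where N: "(real p + real n) / \<epsilon> \<le> real N" using real_arch_simple by blast
  then have N': "real p - real N * \<epsilon> \<le> - real n" using \<epsilon> by (simp add: field_simps)
  obtain C where C: "C \<ge> 0" "\<And>\<xi> c. \<bar>osc u a \<xi> c\<bar> \<le> C * (1 + norm \<xi>) powr (real p - real N * \<epsilon>)"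
    using it[of N] a unfolding osc_order_def by blast
  have "\<bar>osc u a \<xi> c\<bar> * (1 + norm \<xi>) ^ n \<le> C" for \<xi> c
  proof -
    have x: "1 + norm \<xi> \<ge> 1" "1 + norm \<xi> > 0" by (auto simp: add_pos_nonneg)
    have "\<bar>osc u a \<xi> c\<bar> \<le> C * (1 + norm \<xi>) powr (- real n)"
      using C(2)[of \<xi> c] mult_left_mono[OF powr_mono[OF N' x(1)] C(1)] by linarith
    then show ?thesis using x by (simp add: powr_minus powr_realpow field_simps)
  qed
  then show ?thesis using C(1) by blast
qed

subsection \<open>Cutoff functions\<close>

text \<open>The family t^(-m) exp(-1/t), extended by 0 to t \<le> 0. It contains the classical flat
  function (m = 0), and the derivative of each member is a linear combination of members, as
  \<open>smooth_alg\<close> requires.\<close>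

definition flat_exp :: "nat \<Rightarrow> real \<Rightarrow> real"
  where "flat_exp m t = (if t \<le> 0 then 0 else (1/t) ^ m * exp (- (1/t)))"

lemma flat_exp_tendsto_0: "(flat_exp m \<longlongrightarrow> 0) (at 0)"
proof -
  have "((\<lambda>t. (1/t) ^ m * exp (- (1/t))) \<longlongrightarrow> (0::real)) (at_right 0)"
  proof -
    have "((\<lambda>x. x ^ m * exp (- x)) \<longlongrightarrow> (0::real)) at_top"
      using tendsto_power_div_exp_0[of m] by (simp add: exp_minus divide_inverse)
    moreover have "filterlim (\<lambda>t. 1/t) at_top (at_right (0::real))"
      using filterlim_inverse_at_top_right by (simp add: inverse_eq_divide)
    ultimately show ?thesis by (rule filterlim_compose)
  qed
  moreover have "\<forall>\<^sub>F t in at_right 0. (1/t) ^ m * exp (- (1/t)) = flat_exp m t"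
    by (auto simp: eventually_at_right_field flat_exp_def intro!: exI[of _ 1])
  ultimately have r: "(flat_exp m \<longlongrightarrow> 0) (at_right 0)" by (rule Lim_transform_eventually)
  have "\<forall>\<^sub>F t in at_left 0. 0 = flat_exp m t"
    by (auto simp: eventually_at_left_field flat_exp_def intro!: exI[of _ "-1"])
  then have l: "(flat_exp m \<longlongrightarrow> 0) (at_left 0)" by (rule Lim_transform_eventually[OF tendsto_const])
  show ?thesis using l r by (simp add: filterlim_split_at_real)
qed

lemma flat_exp_derivative:
  "(flat_exp m has_real_derivative flat_exp (m + 2) t - real m * flat_exp (m + 1) t) (at t)"
proof -
  consider "t < 0" | "t = 0" | "t > 0" by linarith
  then show ?thesis
  proof cases
    case 1
    have "((\<lambda>_. 0) has_real_derivative 0) (at t)" by simp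
    then have "(flat_exp m has_real_derivative 0) (at t)"
      by (rule has_field_derivative_transform_within_open[of _ _ _ "{..<0}"]) (use 1 in \<open>auto simp: flat_exp_def\<close>)
    then show ?thesis using 1 by (simp add: flat_exp_def)
  next
    case 2
    have "(flat_exp m (0 + h) - flat_exp m 0) / h = flat_exp (m + 1) h" for h
      by (simp add: flat_exp_def)
    then have "(flat_exp m has_real_derivative 0) (at 0)"
      unfolding DERIV_def using flat_exp_tendsto_0[of "m + 1"] by simp
    then show ?thesis using 2 by (simp add: flat_exp_def)
  next
    case 3
    have d: "((\<lambda>t. 1/t) has_real_derivative - ((1/t)\<^sup>2)) (at t)"
      using 3 by (auto intro!: derivative_eq_intros simp: power2_eq_square)
    from DERIV_mult[OF DERIV_power[OF d, of m] DERIV_fun_exp[OF DERIV_minus[OF d]]]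
    have "((\<lambda>t. (1/t) ^ m * exp (- (1/t))) has_real_derivative
        real m * (- ((1/t)\<^sup>2) * (1/t) ^ (m - Suc 0)) * exp (- (1/t))
        + exp (- (1/t)) * - (- ((1/t)\<^sup>2)) * (1/t) ^ m) (at t)" .
    also have "real m * (- ((1/t)\<^sup>2) * (1/t) ^ (m - Suc 0)) * exp (- (1/t))
        + exp (- (1/t)) * - (- ((1/t)\<^sup>2)) * (1/t) ^ m
        = flat_exp (m + 2) t - real m * flat_exp (m + 1) t"
      using 3 by (cases m) (simp_all add: flat_exp_def power2_eq_square algebra_simps)
    finally show ?thesis
      by (rule has_field_derivative_transform_within_open[of _ _ _ "{0<..}"]) (use 3 in \<open>auto simp: flat_exp_def\<close>)
  qed
qed

lemma smooth_flat_exp: "smooth_fun (\<lambda>z. flat_exp m (\<xi> \<bullet> z + c))"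
proof (rule smooth_alg_smooth)
  let ?G = "range (\<lambda>m z. flat_exp m (\<xi> \<bullet> z + c))"
  show "smooth_alg ?G (\<lambda>z. flat_exp m (\<xi> \<bullet> z + c))" by (rule smooth_alg.base) blast
  fix f :: "'a phase \<Rightarrow> real" assume "f \<in> ?G"
  then obtain m where f: "f = (\<lambda>z. flat_exp m (\<xi> \<bullet> z + c))" by blast
  have in_G: "smooth_alg ?G (\<lambda>z. flat_exp m (\<xi> \<bullet> z + c))" for m by (rule smooth_alg.base) blast
  have "\<exists>g. smooth_alg ?G g \<and> has_pd k f g" for k
  proof (intro exI conjI)
    have "has_pd k (\<lambda>z. \<xi> \<bullet> z + c) (\<lambda>z. \<xi> $ k + 0)" by (rule has_pd_add[OF has_pd_inner has_pd_const])
    then have "has_pd k f (\<lambda>z. (flat_exp (m + 2) (\<xi> \<bullet> z + c) - real m * flat_exp (m + 1) (\<xi> \<bullet> z + c)) * (\<xi> $ k + 0))"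
      unfolding f by (rule has_pd_chain[where h = "flat_exp m"
            and h' = "\<lambda>t. flat_exp (m + 2) t - real m * flat_exp (m + 1) t"]) (rule flat_exp_derivative)
    then show "has_pd k f (\<lambda>z. (flat_exp (m + 2) (\<xi> \<bullet> z + c) + (- real m) * flat_exp (m + 1) (\<xi> \<bullet> z + c)) * \<xi> $ k)"
      by simp
    show "smooth_alg ?G (\<lambda>z. (flat_exp (m + 2) (\<xi> \<bullet> z + c) + (- real m) * flat_exp (m + 1) (\<xi> \<bullet> z + c)) * \<xi> $ k)"
      by (rule smooth_alg.mult[OF smooth_alg.add[OF in_G smooth_alg.mult[OF smooth_alg.smooth[OF smooth_const] in_G]]
            smooth_alg.smooth[OF smooth_const]])
  qed
  moreover have "continuous_on UNIV f"
  proof -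
    have "continuous_on UNIV (flat_exp m)"
      by (intro continuous_at_imp_continuous_on ballI DERIV_isCont[OF flat_exp_derivative])
    then show ?thesis unfolding f
      by (rule continuous_on_compose2) (auto intro!: continuous_intros)
  qed
  ultimately show "continuous_on UNIV f \<and> (\<forall>k. \<exists>g. smooth_alg ?G g \<and> has_pd k f g)" by blast
qed

text \<open>The classical transition from 0 to 1 over the unit interval; the two summands of the
  denominator never vanish together.\<close>

definition smooth_step :: "real \<Rightarrow> real"
  where "smooth_step t = flat_exp 0 t * inverse (flat_exp 0 t + flat_exp 0 (1 - t))"

lemma smooth_step_0: "t \<le> 0 \<Longrightarrow> smooth_step t = 0"
  and smooth_step_1: "t \<ge> 1 \<Longrightarrow> smooth_step t = 1"
  by (auto simp: smooth_step_def flat_exp_def)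

lemma smooth_smooth_step: "smooth_fun (\<lambda>z. smooth_step (\<xi> \<bullet> z + c))"
proof -
  have s: "smooth_fun (\<lambda>z. flat_exp 0 (1 - (\<xi> \<bullet> z + c)))"
    using smooth_flat_exp[of 0 "- \<xi>" "1 - c"] by (simp add: algebra_simps)
  have "flat_exp 0 t + flat_exp 0 (1 - t) > 0" for t
    by (cases "t > 0") (auto simp: flat_exp_def add_pos_nonneg)
  then have "flat_exp 0 t + flat_exp 0 (1 - t) \<noteq> 0" for t by (metis less_irrefl)
  then show ?thesis unfolding smooth_step_def
    by (intro smooth_mult[OF smooth_flat_exp smooth_inverse[OF smooth_add[OF smooth_flat_exp s]]])
qed

definition cube :: "real \<Rightarrow> 'n::finite phase set"
  where "cube R = {z. \<forall>j. \<bar>z $ j\<bar> \<le> R}"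

lemma compact_cube: "compact (cube R :: 'n::finite phase set)"
proof -
  have "(cube R :: 'n phase set) = cbox (\<chi> j. - R) (\<chi> j. R)"
    by (auto simp: cube_def mem_box_cart abs_le_iff minus_le_iff)
  then show ?thesis by simp
qed

text \<open>A product over coordinates of steps at 2 + z_j/R and 2 - z_j/R: both arguments are at
  least 1 when |z_j| \<le> R, and one of them is negative when |z_j| > 2R.\<close>

lemma cutoff_exists:
  assumes "R > 0"
  shows "\<exists>f. test_on (cube (2 * R)) f \<and> (\<forall>z\<in>cube R. f z = 1)"
proof (intro exI conjI ballI)
  define f :: "'n::finite phase \<Rightarrow> real" where
    "f z = (\<Prod>j\<in>UNIV. smooth_step (((1/R) *\<^sub>R axis j 1) \<bullet> z + 2) * smooth_step ((-(1/R) *\<^sub>R axis j 1) \<bullet> z + 2))" for z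
  have e: "((c *\<^sub>R axis j 1) \<bullet> z) = c * z $ j" for c j and z :: "'n phase"
    by (simp add: inner_axis')
  have "smooth_fun f" unfolding f_def by (intro smooth_prod smooth_mult smooth_smooth_step)
  moreover have "f z = 0" if "z \<notin> cube (2 * R)" for z
  proof -
    from that obtain j where j: "\<bar>z $ j\<bar> > 2 * R" by (auto simp: cube_def not_le)
    then have "smooth_step (((1/R) *\<^sub>R axis j 1) \<bullet> z + 2) * smooth_step ((-(1/R) *\<^sub>R axis j 1) \<bullet> z + 2) = 0"
      using assms smooth_step_0[of "(1/R) * z $ j + 2"] smooth_step_0[of "-(1/R) * z $ j + 2"]
      unfolding e by (cases "z $ j > 0") (auto simp: field_simps)
    then show ?thesis unfolding f_def by (intro prod_zero) auto
  qed
  ultimately show "test_on (cube (2 * R)) f" by (simp add: test_on_def)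
  fix z :: "'n phase" assume z: "z \<in> cube R"
  have "smooth_step (((1/R) *\<^sub>R axis j 1) \<bullet> z + 2) = 1 \<and> smooth_step ((-(1/R) *\<^sub>R axis j 1) \<bullet> z + 2) = 1" for j
  proof -
    have "\<bar>z $ j\<bar> \<le> R" using z by (simp add: cube_def)
    then have "(1/R) * z $ j + 2 \<ge> 1" "-(1/R) * z $ j + 2 \<ge> 1" using assms by (auto simp: field_simps abs_le_iff)
    then show ?thesis unfolding e by (intro conjI smooth_step_1)
  qed
  then show "f z = 1" unfolding f_def by simp
qed

subsection \<open>Rapidly convergent trigonometric series\<close>

text \<open>All polynomial weights are required because each differentiation multiplies a
  coefficient by a component of its frequency.\<close>

definition rapid :: "(nat \<Rightarrow> real) \<Rightarrow> (nat \<Rightarrow> 'n::finite phase) \<Rightarrow> bool"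
  where "rapid b \<zeta> \<longleftrightarrow> (\<forall>p. summable (\<lambda>i. \<bar>b i\<bar> * (1 + norm (\<zeta> i)) ^ p))"

definition trig_sum :: "(nat \<Rightarrow> real) \<Rightarrow> (nat \<Rightarrow> 'n::finite phase) \<Rightarrow> (nat \<Rightarrow> real) \<Rightarrow> 'n phase \<Rightarrow> real"
  where "trig_sum b \<zeta> c z = (\<Sum>i. b i * cos (\<zeta> i \<bullet> z + c i))"

lemma rapid_summable: "rapid b \<zeta> \<Longrightarrow> summable (\<lambda>i. \<bar>b i\<bar>)"
  unfolding rapid_def by (drule spec[of _ 0]) simp

lemma rapid_component: "rapid b \<zeta> \<Longrightarrow> rapid (\<lambda>i. b i * \<zeta> i $ k) \<zeta>"
  unfolding rapid_def
proof
  fix p assume "\<forall>p. summable (\<lambda>i. \<bar>b i\<bar> * (1 + norm (\<zeta> i)) ^ p)"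
  then have "summable (\<lambda>i. \<bar>b i\<bar> * (1 + norm (\<zeta> i)) ^ Suc p)" by blast
  then show "summable (\<lambda>i. \<bar>b i * \<zeta> i $ k\<bar> * (1 + norm (\<zeta> i)) ^ p)"
  proof (rule summable_comparison_test'[where N = 0])
    fix i
    have "\<bar>\<zeta> i $ k\<bar> * (1 + norm (\<zeta> i)) ^ p \<le> (1 + norm (\<zeta> i)) * (1 + norm (\<zeta> i)) ^ p"
      using component_le_norm_cart[of "\<zeta> i" k] by (intro mult_right_mono) auto
    then have "\<bar>b i\<bar> * (\<bar>\<zeta> i $ k\<bar> * (1 + norm (\<zeta> i)) ^ p) \<le> \<bar>b i\<bar> * (1 + norm (\<zeta> i)) ^ Suc p"
      by (intro mult_left_mono) auto
    then show "norm (\<bar>b i * \<zeta> i $ k\<bar> * (1 + norm (\<zeta> i)) ^ p) \<le> \<bar>b i\<bar> * (1 + norm (\<zeta> i)) ^ Suc p"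
      by (simp add: abs_mult mult.assoc)
  qed
qed

lemma trig_term_le: "norm (b * cos t) \<le> \<bar>b::real\<bar>"
  using mult_left_mono[OF abs_cos_le_one[of t] abs_ge_zero[of b]] by (simp add: abs_mult)

lemma summable_trig:
  assumes "rapid b \<zeta>"
  shows "summable (\<lambda>i. b i * cos (\<zeta> i \<bullet> z + c i))"
  by (rule summable_comparison_test'[OF rapid_summable[OF assms], where N = 0]) (rule trig_term_le)

lemma trig_sum_has_pd:
  assumes "rapid b \<zeta>"
  shows "has_pd k (trig_sum b \<zeta> c) (trig_sum (\<lambda>i. b i * \<zeta> i $ k) \<zeta> (\<lambda>i. c i + pi/2))"
  unfolding has_pd_def
proof
  fix z
  let ?f = "\<lambda>i t. b i * cos (\<zeta> i \<bullet> (z + t *\<^sub>R axis k 1) + c i)"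
  let ?f' = "\<lambda>i t. b i * \<zeta> i $ k * cos (\<zeta> i \<bullet> (z + t *\<^sub>R axis k 1) + (c i + pi/2))"
  have "((\<lambda>t. \<Sum>i. ?f i t) has_real_derivative (\<Sum>i. ?f' i 0)) (at 0)"
  proof (rule has_field_derivative_series'(2)[where S = UNIV and x0 = 0])
    fix i and t :: real
    have "((\<lambda>t. cos (\<zeta> i \<bullet> (z + t *\<^sub>R axis k 1) + c i)) has_real_derivative
        \<zeta> i $ k * cos (\<zeta> i \<bullet> (z + t *\<^sub>R axis k 1) + (c i + pi/2))) (at t)"
      using smooth_line_derivative[OF smooth_cos[of "\<zeta> i" "c i"], where k = k] by (simp add: pd_cos)
    then show "(?f i has_real_derivative ?f' i t) (at t within UNIV)"
      by (simp add: mult.assoc DERIV_cmult)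
  next
    show "uniformly_convergent_on UNIV (\<lambda>n t. \<Sum>i<n. ?f' i t)"
      by (rule Weierstrass_m_test'[OF trig_term_le rapid_summable[OF rapid_component[OF assms]]])
    show "summable (\<lambda>i. ?f i 0)" by (rule summable_trig[OF assms])
  qed auto
  then show "((\<lambda>t. trig_sum b \<zeta> c (z + t *\<^sub>R axis k 1)) has_real_derivative
      trig_sum (\<lambda>i. b i * \<zeta> i $ k) \<zeta> (\<lambda>i. c i + pi/2) z) (at 0)"
    by (simp add: trig_sum_def)
qed

text \<open>Coinduction on the class of all rapid series over the fixed frequencies: a derivative is
  again such a series, with new coefficients and phases, and uniform convergence gives
  continuity.\<close>

lemma smooth_trig_sum:
  assumes "rapid b \<zeta>"
  shows "smooth_fun (trig_sum b \<zeta> c)"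
proof (rule smooth_coinduct[of "\<lambda>f. \<exists>b c. rapid b \<zeta> \<and> f = trig_sum b \<zeta> c"])
  show "\<exists>b' c'. rapid b' \<zeta> \<and> trig_sum b \<zeta> c = trig_sum b' \<zeta> c'" using assms by blast
next
  fix f assume "\<exists>b c. rapid b \<zeta> \<and> f = trig_sum b \<zeta> c"
  then obtain b c where b: "rapid b \<zeta>" and f: "f = trig_sum b \<zeta> c" by blast
  have "uniform_limit UNIV (\<lambda>n z. \<Sum>i<n. b i * cos (\<zeta> i \<bullet> z + c i)) f sequentially"
    unfolding f trig_sum_def[abs_def] by (rule Weierstrass_m_test[OF trig_term_le rapid_summable[OF b]])
  then have "continuous_on UNIV f"
    by (rule uniform_limit_theorem[rotated]) (auto intro!: always_eventually continuous_intros)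
  moreover have "\<exists>g. (\<exists>b c. rapid b \<zeta> \<and> g = trig_sum b \<zeta> c) \<and> has_pd k f g" for k
    using trig_sum_has_pd[OF b, of k c] rapid_component[OF b, of k] unfolding f by blast
  ultimately show "continuous_on UNIV f \<and> (\<forall>k. \<exists>g. (\<exists>b c. rapid b \<zeta> \<and> g = trig_sum b \<zeta> c) \<and> has_pd k f g)"
    by blast
qed

text \<open>The constant is the same for all rapid series, which is what allows the bound to be
  applied to every tail of one series.\<close>

lemma pd_bound_mult_trig_sum:
  fixes a :: "'n::finite phase \<Rightarrow> real"
  assumes K: "compact K" and "test_on K a"
  shows "\<exists>C\<ge>0. \<forall>b \<zeta> c. rapid b \<zeta> \<longrightarrow>
    pd_bound m (\<lambda>z. a z * trig_sum b \<zeta> c z) (C * (\<Sum>i. \<bar>b i\<bar> * (1 + norm (\<zeta> i)) ^ m))"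
  using assms(2)
proof (induction m arbitrary: a)
  case 0
  obtain B where B: "B \<ge> 0" "\<And>z. \<bar>a z\<bar> \<le> B" by (rule test_on_bounded[OF K 0]) blast
  have "\<bar>a z * trig_sum b \<zeta> c z\<bar> \<le> B * (\<Sum>i. \<bar>b i\<bar>)" if "rapid b \<zeta>" for b \<zeta> c z
  proof -
    have "norm (trig_sum b \<zeta> c z) \<le> (\<Sum>i. \<bar>b i\<bar>)" unfolding trig_sum_def
      by (rule norm_suminf_le[OF trig_term_le rapid_summable[OF that]])
    then show ?thesis using B by (simp add: abs_mult mult_mono)
  qed
  then show ?case using B(1) by (intro exI[of _ B]) (simp add: pd_bound_0)
next
  case (Suc m)
  have sm: "smooth_fun a" using Suc.prems by (simp add: test_on_def)
  let ?T = "\<lambda>a b \<zeta> c z. a z * trig_sum b \<zeta> c z"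
  let ?S = "\<lambda>m b \<zeta>. \<Sum>i. \<bar>b i\<bar> * (1 + norm (\<zeta> i)) ^ m"
  have "\<exists>C\<ge>0. \<forall>b \<zeta> c. rapid b \<zeta> \<longrightarrow> pd_bound m (?T (pd k a) b \<zeta> c) (C * ?S m b \<zeta>)" for k
    by (rule Suc.IH[OF test_on_pd[OF compact_imp_closed[OF K] Suc.prems]])
  from choice[OF allI[OF this]] obtain C where C: "\<forall>k. 0 \<le> C k \<and>
    (\<forall>b \<zeta> c. rapid b \<zeta> \<longrightarrow> pd_bound m (?T (pd k a) b \<zeta> c) (C k * ?S m b \<zeta>))" ..
  obtain C' where C': "C' \<ge> 0" "\<And>b \<zeta> c. rapid b \<zeta> \<Longrightarrow> pd_bound m (?T a b \<zeta> c) (C' * ?S m b \<zeta>)"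
    using Suc.IH[OF Suc.prems] by blast
  define D where "D = (\<Sum>k\<in>UNIV. C k) + C'"
  have CD: "C k + C' \<le> D" "C' \<le> D" for k
    using member_le_sum[of k UNIV C] sum_nonneg[of UNIV C] C by (auto simp: D_def)
  have D0: "D \<ge> 0" using CD C'(1) by linarith
  have "pd_bound (Suc m) (?T a b \<zeta> c) (D * ?S (Suc m) b \<zeta>)" if r: "rapid b \<zeta>" for b \<zeta> c
  proof -
    have sumb: "summable (\<lambda>i. \<bar>b i\<bar> * (1 + norm (\<zeta> i)) ^ p)" for p using r by (simp add: rapid_def)
    have S0: "0 \<le> ?S p b \<zeta>" for p by (intro suminf_nonneg sumb) auto
    have S1: "?S m b \<zeta> \<le> ?S (Suc m) b \<zeta>"
      by (intro suminf_le sumb mult_left_mono power_increasing) auto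
    have S2: "?S m (\<lambda>i. b i * \<zeta> i $ k) \<zeta> \<le> ?S (Suc m) b \<zeta>" for k
    proof (rule suminf_le)
      show "summable (\<lambda>i. \<bar>b i * \<zeta> i $ k\<bar> * (1 + norm (\<zeta> i)) ^ m)"
        using rapid_component[OF r, of k] unfolding rapid_def by blast
      fix i
      have "\<bar>b i\<bar> * (\<bar>\<zeta> i $ k\<bar> * (1 + norm (\<zeta> i)) ^ m) \<le> \<bar>b i\<bar> * ((1 + norm (\<zeta> i)) * (1 + norm (\<zeta> i)) ^ m)"
        using component_le_norm_cart[of "\<zeta> i" k] by (intro mult_left_mono mult_right_mono) auto
      then show "\<bar>b i * \<zeta> i $ k\<bar> * (1 + norm (\<zeta> i)) ^ m \<le> \<bar>b i\<bar> * (1 + norm (\<zeta> i)) ^ Suc m"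
        by (simp add: abs_mult mult.assoc)
    qed (rule sumb)
    show ?thesis
    proof (rule pd_bound_Suc)
      have "pd_bound 0 (?T a b \<zeta> c) (C' * ?S m b \<zeta>)" by (rule pd_bound_le0[OF C'(2)[OF r]])
      moreover have "C' * ?S m b \<zeta> \<le> D * ?S (Suc m) b \<zeta>"
        using S1 S0 CD(2) C'(1) D0 by (intro mult_mono) auto
      ultimately show "\<bar>?T a b \<zeta> c z\<bar> \<le> D * ?S (Suc m) b \<zeta>" for z
        unfolding pd_bound_0 by (meson order_trans)
      fix k
      have 1: "pd_bound m (\<lambda>z. ?T (pd k a) b \<zeta> c z + ?T a (\<lambda>i. b i * \<zeta> i $ k) \<zeta> (\<lambda>i. c i + pi/2) z)
          (C k * ?S m b \<zeta> + C' * ?S m (\<lambda>i. b i * \<zeta> i $ k) \<zeta>)"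
        by (intro pd_bound_add smooth_mult smooth_pd sm smooth_trig_sum r rapid_component C'(2)
            C[rule_format, THEN conjunct2, rule_format])
      have 2: "C k * ?S m b \<zeta> + C' * ?S m (\<lambda>i. b i * \<zeta> i $ k) \<zeta> \<le> D * ?S (Suc m) b \<zeta>"
      proof -
        have "C k * ?S m b \<zeta> + C' * ?S m (\<lambda>i. b i * \<zeta> i $ k) \<zeta> \<le> C k * ?S (Suc m) b \<zeta> + C' * ?S (Suc m) b \<zeta>"
          using C C'(1) S1 S2 by (intro add_mono mult_left_mono) auto
        also have "\<dots> = (C k + C') * ?S (Suc m) b \<zeta>" by (simp add: algebra_simps)
        also have "\<dots> \<le> D * ?S (Suc m) b \<zeta>" by (rule mult_right_mono[OF CD(1) S0])
        finally show ?thesis .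
      qed
      have 3: "pd k (?T a b \<zeta> c) =
          (\<lambda>z. ?T (pd k a) b \<zeta> c z + ?T a (\<lambda>i. b i * \<zeta> i $ k) \<zeta> (\<lambda>i. c i + pi/2) z)"
        unfolding pd_mult[OF sm smooth_trig_sum[OF r]] has_pd_imp_pd[OF trig_sum_has_pd[OF r]] ..
      show "pd_bound m (pd k (?T a b \<zeta> c)) (D * ?S (Suc m) b \<zeta>)"
        unfolding 3 by (rule pd_bound_mono[OF 1 2])
    qed
  qed
  then show ?case using D0 by blast
qed

text \<open>The tails tend to 0 in the seminorm that controls \<open>u\<close> on \<open>K\<close>,
  so \<open>u\<close> may be applied term by term.\<close>

lemma distribution_trig_sum:
  assumes u: "distribution u" and K: "compact K" and a: "test_on K a" and r: "rapid b \<zeta>"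
  shows "(\<lambda>i. b i * osc u a (\<zeta> i) (c i)) sums u (\<lambda>z. a z * trig_sum b \<zeta> c z)"
proof -
  obtain C m where C: "C \<ge> 0" "\<And>\<phi> B. test_on K \<phi> \<Longrightarrow> pd_bound m \<phi> B \<Longrightarrow> \<bar>u \<phi>\<bar> \<le> C * B"
    using distribution_bound[OF u K] by blast
  obtain E where E: "E \<ge> 0" "\<And>b \<zeta> c. rapid b \<zeta> \<Longrightarrow>
      pd_bound m (\<lambda>z. a z * trig_sum b \<zeta> c z) (E * (\<Sum>i. \<bar>b i\<bar> * (1 + norm (\<zeta> i)) ^ m))"
    using pd_bound_mult_trig_sum[OF K a, of m] by blast
  define s where "s i = \<bar>b i\<bar> * (1 + norm (\<zeta> i)) ^ m" for i
  have s: "summable s" using r unfolding rapid_def s_def by blast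
  have tail: "\<bar>u (\<lambda>z. a z * trig_sum b \<zeta> c z) - (\<Sum>i<n. b i * osc u a (\<zeta> i) (c i))\<bar>
      \<le> C * (E * (\<Sum>i. s (i + n)))" for n
  proof -
    let ?b = "\<lambda>i. b (i + n)" and ?z = "\<lambda>i. \<zeta> (i + n)" and ?c = "\<lambda>i. c (i + n)"
    have r': "rapid ?b ?z" unfolding rapid_def
      using summable_ignore_initial_segment[OF r[unfolded rapid_def, rule_format], of n] by simp
    let ?P = "\<lambda>z. \<Sum>i<n. b i * (a z * cos (\<zeta> i \<bullet> z + c i))"
    let ?Q = "\<lambda>z. a z * trig_sum ?b ?z ?c z"
    have tP: "test_on K ?P" by (rule test_on_sum) (rule test_on_cmult[OF test_on_mult_cos[OF a]])
    have tQ: "test_on K ?Q" by (rule test_on_mult[OF a smooth_trig_sum[OF r']])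
    have "(\<lambda>z. a z * trig_sum b \<zeta> c z) = (\<lambda>z. ?Q z + ?P z)"
    proof
      fix z
      have "trig_sum b \<zeta> c z = trig_sum ?b ?z ?c z + (\<Sum>i<n. b i * cos (\<zeta> i \<bullet> z + c i))"
        unfolding trig_sum_def by (rule suminf_split_initial_segment[OF summable_trig[OF r]])
      then show "a z * trig_sum b \<zeta> c z = ?Q z + ?P z"
        by (simp add: algebra_simps sum_distrib_left)
    qed
    then have "u (\<lambda>z. a z * trig_sum b \<zeta> c z) = u ?Q + u ?P"
      using dist_add[OF u K tQ tP] by simp
    also have "u ?P = (\<Sum>i<n. u (\<lambda>z. b i * (a z * cos (\<zeta> i \<bullet> z + c i))))"
      by (rule dist_sum[OF u K]) (rule test_on_cmult[OF test_on_mult_cos[OF a]])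
    also have "\<dots> = (\<Sum>i<n. b i * osc u a (\<zeta> i) (c i))"
      unfolding osc_def by (intro sum.cong refl dist_cmult[OF u K] test_on_mult_cos a)
    finally have "\<bar>u (\<lambda>z. a z * trig_sum b \<zeta> c z) - (\<Sum>i<n. b i * osc u a (\<zeta> i) (c i))\<bar> = \<bar>u ?Q\<bar>" by simp
    also have "\<dots> \<le> C * (E * (\<Sum>i. s (i + n)))"
      unfolding s_def by (rule C(2)[OF tQ E(2)[OF r']])
    finally show ?thesis .
  qed
  have "(\<lambda>n. \<Sum>i. s (i + n)) \<longlonglongrightarrow> 0" by (rule suminf_exist_split2[OF s])
  then have "(\<lambda>n. C * (E * (\<Sum>i. s (i + n)))) \<longlonglongrightarrow> C * (E * 0)" by (intro tendsto_intros)
  then have lim: "(\<lambda>n. C * (E * (\<Sum>i. s (i + n)))) \<longlonglongrightarrow> 0" by simp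
  have "(\<lambda>n. (\<Sum>i<n. b i * osc u a (\<zeta> i) (c i)) - u (\<lambda>z. a z * trig_sum b \<zeta> c z)) \<longlonglongrightarrow> 0"
    by (rule Lim_null_comparison[OF _ lim]) (use tail in \<open>simp add: abs_minus_commute\<close>)
  then show ?thesis unfolding sums_def by (simp add: LIM_zero_iff)
qed

text \<open>Integration, viewed as a distribution of order 0, falls under
  \<open>distribution_trig_sum\<close>. Both sides of the representation formula can then be
  expanded by the same lemma.\<close>

lemma distribution_integral: "distribution (\<lambda>\<phi>. LINT z|lborel. \<phi> (z :: 'n::finite phase))"
  unfolding distribution_def
proof (intro conjI allI impI)
  fix \<phi> \<psi> :: "'n phase \<Rightarrow> real" and a b :: real
  assume t: "test_fun \<phi>" "test_fun \<psi>"
  have i: "integrable lborel \<phi>" if "test_fun \<phi>" for \<phi> :: "'n phase \<Rightarrow> real"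
    using integrable_test_on[OF _ test_imp_test_on[OF that]] that by (simp add: test_fun_def)
  show "(LINT z|lborel. a * \<phi> z + b * \<psi> z) = a * (LINT z|lborel. \<phi> z) + b * (LINT z|lborel. \<psi> z)"
    using i[OF t(1)] i[OF t(2)] by simp
next
  fix K :: "'n phase set" assume K: "compact K"
  have fin: "emeasure lborel K < \<infinity>" by (rule emeasure_compact_finite[OF K])
  have "\<bar>LINT z|lborel. \<phi> z\<bar> \<le> measure lborel K * (\<Sum>ks\<in>{ks. length ks \<le> 0}. (SUP z. \<bar>iterpd ks \<phi> z\<bar>))"
    if \<phi>: "test_fun \<phi> \<and> closure {z. \<phi> z \<noteq> 0} \<subseteq> K" for \<phi>
  proof -
    have tK: "test_on K \<phi>" using test_on_mono[OF test_imp_test_on] \<phi> by blast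
    obtain B where B: "\<And>z. \<bar>\<phi> z\<bar> \<le> B" by (rule test_on_bounded[OF K tK]) blast
    let ?S = "SUP z. \<bar>\<phi> z\<bar>"
    have S: "\<bar>\<phi> z\<bar> \<le> ?S" for z by (rule cSUP_upper) (auto intro!: bdd_aboveI[of _ B] B)
    have "norm (LINT z|lborel. \<phi> z) \<le> (LINT z|lborel. indicator K z * ?S)"
    proof (rule Bochner_Integration.integral_norm_bound_integral)
      show "integrable lborel \<phi>" by (rule integrable_test_on[OF K tK])
      show "integrable lborel (\<lambda>z. indicator K z * ?S)"
        using fin compact_imp_closed[OF K] by (intro integrable_mult_left integrable_real_indicator) auto
      show "norm (\<phi> z) \<le> indicator K z * ?S" for z
        using S[of z] test_onD(2)[OF tK, of z] by (cases "z \<in> K") auto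
    qed
    also have "\<dots> = measure lborel K * ?S"
      using fin compact_imp_closed[OF K] by simp
    finally show ?thesis by simp
  qed
  then show "\<exists>C m. \<forall>\<phi>. test_fun \<phi> \<and> closure {z. \<phi> z \<noteq> 0} \<subseteq> K \<longrightarrow>
      \<bar>LINT z|lborel. \<phi> z\<bar> \<le> C * (\<Sum>ks\<in>{ks. length ks \<le> m}. (SUP z. \<bar>iterpd ks \<phi> z\<bar>))"
    by blast
qed

subsection \<open>Fourier inversion\<close>

text \<open>Up to pi/3 the derivative cos is at least 1/2; beyond that point the sine is at least
  sin (pi/3), which exceeds 0.8, while x/2 is at most pi/4.\<close>

lemma sin_ge_half:
  assumes "0 \<le> x" "x \<le> pi / 2"
  shows "x / 2 \<le> sin x"
proof (cases "x \<le> pi / 3")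
  case True
  have "sin 0 - 0 / 2 \<le> sin x - x / 2"
  proof (rule DERIV_nonneg_imp_nondecreasing[OF assms(1)])
    fix t assume t: "0 \<le> t" "t \<le> x"
    have "cos (pi / 3) \<le> cos t" using t True by (intro cos_monotone_0_pi_le) auto
    then have "0 \<le> cos t - 1/2" by (simp add: cos_60)
    moreover have "((\<lambda>t. sin t - t / 2) has_real_derivative cos t - 1/2) (at t)"
      by (auto intro!: derivative_eq_intros)
    ultimately show "\<exists>y. ((\<lambda>t. sin t - t / 2) has_real_derivative y) (at t) \<and> 0 \<le> y" by blast
  qed
  then show ?thesis by simp
next
  case False
  have "sin (pi / 3) \<le> sin x" using assms False by (intro sin_monotone_2pi_le) auto
  moreover have "sin (pi / 3) \<ge> 1.6 / 2"
  proof -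
    have "sqrt (1.6\<^sup>2) \<le> sqrt 3" by (rule real_sqrt_le_mono) (simp add: power2_eq_square)
    then show ?thesis by (simp add: sin_60)
  qed
  moreover have "x / 2 \<le> 1.6 / 2" using assms pi_less_4 pi_approx by simp
  ultimately show ?thesis by linarith
qed

lemma square_le_one_minus_cos:
  assumes "\<bar>\<theta>\<bar> \<le> pi"
  shows "\<theta>\<^sup>2 \<le> 8 * (1 - cos \<theta>)"
proof -
  have "\<bar>\<theta>\<bar> / 4 \<le> sin (\<bar>\<theta>\<bar> / 2)" using sin_ge_half[of "\<bar>\<theta>\<bar> / 2"] assms by simp
  then have "(\<bar>\<theta>\<bar> / 4)\<^sup>2 \<le> (sin (\<bar>\<theta>\<bar> / 2))\<^sup>2" by (intro power_mono) auto
  moreover have "cos \<theta> = 1 - 2 * (sin (\<theta> / 2))\<^sup>2" using cos_double_sin[of "\<theta> / 2"] by simp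
  moreover have "(sin (\<bar>\<theta>\<bar> / 2))\<^sup>2 = (sin (\<theta> / 2))\<^sup>2" by (cases "\<theta> \<ge> 0") simp_all
  ultimately show ?thesis by (simp add: power_divide)
qed

text \<open>The Fourier multipliers of the de la Vallee Poussin mean: ratios of binomial
  coefficients to the central one, hence 1 at frequency 0 and increasing to 1 at every fixed
  frequency.\<close>

definition kernel_coeff :: "nat \<Rightarrow> int \<Rightarrow> real"
  where "kernel_coeff n m = (if \<bar>m\<bar> \<le> int n
    then real ((2 * n) choose nat (int n + m)) / real ((2 * n) choose n) else 0)"

text \<open>The de la Vallee Poussin kernel, of total mass 1 on a period \<open>[- L, L]\<close>.\<close>

definition trig_kernel :: "real \<Rightarrow> nat \<Rightarrow> real \<Rightarrow> real"
  where "trig_kernel L n t = (2 * cos (pi * t / L / 2)) ^ (2 * n) / real ((2 * n) choose n) / (2 * L)"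

lemma kernel_nonneg: "L > 0 \<Longrightarrow> trig_kernel L n t \<ge> 0"
  unfolding trig_kernel_def by (intro divide_nonneg_nonneg) (auto simp: zero_le_even_power)

lemma kernel_coeff_bounds: "0 \<le> kernel_coeff n m" "kernel_coeff n m \<le> 1"
proof -
  have "(2 * n) choose nat (int n + m) \<le> (2 * n) choose n" by (rule binomial_maximum')
  then show "0 \<le> kernel_coeff n m" "kernel_coeff n m \<le> 1"
    by (auto simp: kernel_coeff_def divide_le_eq)
qed

lemma kernel_coeff_0: "kernel_coeff n 0 = 1"
  by (simp add: kernel_coeff_def)

lemma kernel_coeff_minus: "kernel_coeff n (- m) = kernel_coeff n m"
proof (cases "\<bar>m\<bar> \<le> int n")
  case True
  have "(2 * n) choose nat (int n + - m) = (2 * n) choose (2 * n - nat (int n + - m))"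
    by (rule binomial_symmetric) (use True in auto)
  moreover have "2 * n - nat (int n + - m) = nat (int n + m)" using True by auto
  ultimately show ?thesis using True by (simp add: kernel_coeff_def)
qed (simp add: kernel_coeff_def)

text \<open>The ratio of neighbouring binomial coefficients. It yields the limit 1 by induction on
  the frequency, and the exact coefficient at frequency 1 on which the concentration of the kernel
  rests.\<close>

lemma kernel_coeff_Suc:
  assumes "k < n"
  shows "kernel_coeff n (int (Suc k)) = kernel_coeff n (int k) * (real (n - k) / real (n + k + 1))"
proof -
  have "(n + k + 1) * ((2 * n) choose Suc (n + k)) = (2 * n - (n + k)) * ((2 * n) choose (n + k))"
    using binomial_absorb_comp[of "2 * n" "n + k"] binomial_absorption[of "n + k" "2 * n"] by simp
  also have "2 * n - (n + k) = n - k" by simp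
  finally have "real (n + k + 1) * real ((2 * n) choose Suc (n + k)) = real (n - k) * real ((2 * n) choose (n + k))"
    by (metis of_nat_mult)
  then have "real ((2 * n) choose Suc (n + k)) = real ((2 * n) choose (n + k)) * (real (n - k) / real (n + k + 1))"
    by (simp add: field_simps)
  moreover have "nat (int n + int (Suc k)) = Suc (n + k)" "nat (int n + int k) = n + k" by auto
  ultimately show ?thesis using assms by (simp add: kernel_coeff_def)
qed

lemma kernel_coeff_tendsto: "(\<lambda>n. kernel_coeff n m) \<longlonglongrightarrow> 1"
proof -
  have nat: "(\<lambda>n. kernel_coeff n (int k)) \<longlonglongrightarrow> 1" for k
  proof (induction k)
    case 0
    show ?case by (simp add: kernel_coeff_0)
  next
    case (Suc k)
    have "(\<lambda>n. real (n - k) / real (n + k + 1)) \<longlonglongrightarrow> 1"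
    proof -
      have "(\<lambda>n. 1 - real (2 * k + 1) * inverse (real (Suc (n + k)))) \<longlonglongrightarrow> 1 - real (2 * k + 1) * 0"
        by (intro tendsto_intros LIMSEQ_ignore_initial_segment[OF LIMSEQ_inverse_real_of_nat])
      then have "(\<lambda>n. 1 - real (2 * k + 1) * inverse (real (Suc (n + k)))) \<longlonglongrightarrow> 1" by simp
      moreover have "\<forall>\<^sub>F n in sequentially.
          1 - real (2 * k + 1) * inverse (real (Suc (n + k))) = real (n - k) / real (n + k + 1)"
        by (rule eventually_sequentiallyI[of k]) (auto simp: field_simps of_nat_diff)
      ultimately show ?thesis by (rule Lim_transform_eventually)
    qed
    from tendsto_mult[OF Suc this]
    have "(\<lambda>n. kernel_coeff n (int k) * (real (n - k) / real (n + k + 1))) \<longlonglongrightarrow> 1" by simp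
    moreover have "\<forall>\<^sub>F n in sequentially.
        kernel_coeff n (int k) * (real (n - k) / real (n + k + 1)) = kernel_coeff n (int (Suc k))"
      by (rule eventually_sequentiallyI[of "Suc k"]) (simp add: kernel_coeff_Suc del: of_nat_Suc)
    ultimately show ?case by (rule Lim_transform_eventually)
  qed
  show ?thesis
  proof (cases "m \<ge> 0")
    case True
    then show ?thesis using nat[of "nat m"] by simp
  next
    case False
    then show ?thesis using nat[of "nat (- m)"] by (simp add: kernel_coeff_minus)
  qed
qed

text \<open>The binomial theorem for (exp(ix) + exp(-ix))^(2n); the index k of the expansion
  contributes the frequency k - n.\<close>

lemma kernel_expansion_cis:
  assumes "L > 0"
  shows "complex_of_real (trig_kernel L n t) =
    (\<Sum>m\<in>{- int n..int n}. complex_of_real (kernel_coeff n m / (2 * L)) * cis (pi / L * of_int m * t))"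
proof -
  let ?x = "pi * t / L / 2"
  have e0: "complex_of_real (2 * cos ?x) = cis ?x + cis (- ?x)" by (simp add: complex_eq_iff)
  have "complex_of_real ((2 * cos ?x) ^ (2 * n)) = (cis ?x + cis (- ?x)) ^ (2 * n)"
    by (simp only: of_real_power e0)
  also have "\<dots> = (\<Sum>k\<le>2 * n. of_nat ((2 * n) choose k) * cis ?x ^ k * cis (- ?x) ^ (2 * n - k))"
    by (rule binomial_ring)
  also have "\<dots> = (\<Sum>k\<le>2 * n. of_nat ((2 * n) choose k) * cis (pi / L * of_int (int k - int n) * t))"
  proof (rule sum.cong[OF refl])
    fix k assume "k \<in> {..2 * n}"
    then have "cis ?x ^ k * cis (- ?x) ^ (2 * n - k) = cis (pi / L * of_int (int k - int n) * t)"
      unfolding Complex.DeMoivre cis_mult using assms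
      by (intro arg_cong[of _ _ cis]) (simp add: of_nat_diff field_simps)
    then show "of_nat ((2 * n) choose k) * cis ?x ^ k * cis (- ?x) ^ (2 * n - k) =
        of_nat ((2 * n) choose k) * cis (pi / L * of_int (int k - int n) * t)"
      by (simp add: mult.assoc)
  qed
  also have "\<dots> = (\<Sum>m\<in>{- int n..int n}. of_nat ((2 * n) choose nat (int n + m)) * cis (pi / L * of_int m * t))"
    by (rule sum.reindex_bij_witness[of _ "\<lambda>m. nat (int n + m)" "\<lambda>k. int k - int n"]) auto
  finally have e: "complex_of_real ((2 * cos ?x) ^ (2 * n)) =
      (\<Sum>m\<in>{- int n..int n}. of_nat ((2 * n) choose nat (int n + m)) * cis (pi / L * of_int m * t))" .
  have "complex_of_real (trig_kernel L n t) = complex_of_real ((2 * cos ?x) ^ (2 * n)) / of_real (real ((2 * n) choose n) * (2 * L))"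
    by (simp add: trig_kernel_def)
  also have "\<dots> = (\<Sum>m\<in>{- int n..int n}. of_nat ((2 * n) choose nat (int n + m)) * cis (pi / L * of_int m * t)
      / of_real (real ((2 * n) choose n) * (2 * L)))"
    unfolding e by (rule sum_divide_distrib)
  also have "\<dots> = (\<Sum>m\<in>{- int n..int n}. complex_of_real (kernel_coeff n m / (2 * L)) * cis (pi / L * of_int m * t))"
    by (rule sum.cong) (auto simp: kernel_coeff_def abs_le_iff)
  finally show ?thesis .
qed

lemma kernel_expansion_cos:
  assumes "L > 0"
  shows "trig_kernel L n t = (\<Sum>m\<in>{- int n..int n}. kernel_coeff n m / (2 * L) * cos (pi / L * of_int m * t))"
  using arg_cong[OF kernel_expansion_cis[OF assms, of n t], of Re] by (simp add: Re_sum)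

lemma has_integral_cos_period:
  assumes L: "L > 0"
  shows "((\<lambda>t. cos (pi / L * of_int m * t)) has_integral (if m = 0 then 2 * L else 0)) {-L..L}"
proof (cases "m = 0")
  case True
  then show ?thesis using has_integral_const_real[of "1::real" "- L" L] L by simp
next
  case False
  let ?c = "pi / L * of_int m"
  have c: "?c \<noteq> 0" using False L by simp
  have "((\<lambda>t. cos (?c * t)) has_integral (sin (?c * L) / ?c - sin (?c * (- L)) / ?c)) {-L..L}"
  proof (rule fundamental_theorem_of_calculus)
    fix t
    have "((\<lambda>t. sin (?c * t) / ?c) has_real_derivative cos (?c * t)) (at t within {-L..L})"
      using c by (auto intro!: derivative_eq_intros)
    then show "((\<lambda>t. sin (?c * t) / ?c) has_vector_derivative cos (?c * t)) (at t within {-L..L})"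
      by (simp add: has_real_derivative_iff_has_vector_derivative)
  qed (use L in simp)
  moreover have "sin (?c * L) = 0"
    using L sin_zero_iff_int2[of "?c * L"] by (auto simp: mult.commute)
  ultimately show ?thesis using False by simp
qed

lemma has_integral_kernel:
  assumes L: "L > 0"
  shows "(trig_kernel L n has_integral 1) {-L..L}"
proof -
  have "((\<lambda>t. \<Sum>m\<in>{- int n..int n}. kernel_coeff n m / (2 * L) * cos (pi / L * of_int m * t)) has_integral
      (\<Sum>m\<in>{- int n..int n}. kernel_coeff n m / (2 * L) * (if m = 0 then 2 * L else 0))) {-L..L}"
    by (intro has_integral_sum has_integral_mult_right has_integral_cos_period L) auto
  moreover have "(\<Sum>m\<in>{- int n..int n}. kernel_coeff n m / (2 * L) * (if m = 0 then 2 * L else 0)) = 1"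
    using L by (simp add: if_distrib[of "\<lambda>x. _ * x"] sum.delta kernel_coeff_0 cong: if_cong)
  moreover have "trig_kernel L n = (\<lambda>t. \<Sum>m\<in>{- int n..int n}. kernel_coeff n m / (2 * L) * cos (pi / L * of_int m * t))"
    by (rule ext) (rule kernel_expansion_cos[OF L])
  ultimately show ?thesis by (simp only:)
qed

text \<open>Only the frequencies 1 and -1 survive the integration against the cosine, so the value
  is 1 minus the coefficient at frequency 1; for \<open>Suc n\<close> that coefficient is
  (n+1)/(n+2).\<close>

lemma has_integral_kernel_one_minus_cos:
  assumes L: "L > 0"
  shows "((\<lambda>t. trig_kernel L (Suc n) t * (1 - cos (pi / L * t))) has_integral (1 / (real n + 2))) {-L..L}"
proof -
  let ?N = "Suc n" and ?I = "{- int (Suc n)..int (Suc n)}"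
  have ct: "trig_kernel L ?N t * cos (pi / L * t) = (\<Sum>m\<in>?I. kernel_coeff ?N m / (4 * L) *
      (cos (pi / L * of_int (m + 1) * t) + cos (pi / L * of_int (m - 1) * t)))" for t
  proof -
    have P: "cos (pi / L * of_int m * t) * cos (pi / L * t) =
        (cos (pi / L * of_int (m - 1) * t) + cos (pi / L * of_int (m + 1) * t)) / 2" for m
      unfolding cos_times_cos by (simp add: algebra_simps add_divide_distrib diff_divide_distrib)
    have "kernel_coeff ?N m / (2 * L) * cos (pi / L * of_int m * t) * cos (pi / L * t) =
        kernel_coeff ?N m / (4 * L) * (cos (pi / L * of_int (m + 1) * t) + cos (pi / L * of_int (m - 1) * t))" for m
      unfolding mult.assoc[of "kernel_coeff ?N m / (2 * L)"] P by (simp add: add.commute)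
    then show ?thesis unfolding kernel_expansion_cos[OF L] sum_distrib_right by simp
  qed
  have "((\<lambda>t. \<Sum>m\<in>?I. kernel_coeff ?N m / (4 * L) *
      (cos (pi / L * of_int (m + 1) * t) + cos (pi / L * of_int (m - 1) * t))) has_integral
      (\<Sum>m\<in>?I. kernel_coeff ?N m / (4 * L) * ((if m + 1 = 0 then 2 * L else 0) + (if m - 1 = 0 then 2 * L else 0)))) {-L..L}"
    by (intro has_integral_sum has_integral_mult_right has_integral_add has_integral_cos_period L) auto
  moreover have "(\<Sum>m\<in>?I. kernel_coeff ?N m / (4 * L) * ((if m + 1 = 0 then 2 * L else 0) + (if m - 1 = 0 then 2 * L else 0)))
      = (\<Sum>m\<in>?I. (if m = - 1 then kernel_coeff ?N (- 1) / 2 else 0) + (if m = 1 then kernel_coeff ?N 1 / 2 else 0))"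
    using L by (intro sum.cong refl) (auto simp: field_simps dest!: eq_neg_iff_add_eq_0[THEN iffD2])
  moreover have "\<dots> = kernel_coeff ?N 1"
    unfolding sum.distrib by (simp add: sum.delta kernel_coeff_minus)
  moreover have "kernel_coeff ?N 1 = 1 - 1 / (real n + 2)"
    using kernel_coeff_Suc[of 0 ?N] by (simp add: kernel_coeff_0 field_simps)
  ultimately have "((\<lambda>t. trig_kernel L ?N t * cos (pi / L * t)) has_integral (1 - 1 / (real n + 2))) {-L..L}"
    unfolding ct by simp
  from has_integral_diff[OF has_integral_kernel[OF L, of ?N] this]
  show ?thesis by (simp add: algebra_simps)
qed

lemma continuous_kernel: "L > 0 \<Longrightarrow> continuous_on S (trig_kernel L n)"
  unfolding trig_kernel_def[abs_def] by (intro continuous_intros) auto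

text \<open>Concentration at 0: the square is dominated on a period by 1 - cos, whose mean under the
  kernel is explicit. Nonnegativity of the kernel is what lets the pointwise bound be
  integrated.\<close>

lemma has_integral_kernel_square:
  assumes L: "L > 0"
  shows "\<exists>v\<ge>0. v \<le> 8 * L\<^sup>2 / (real n + 2) \<and>
    ((\<lambda>t. trig_kernel L (Suc n) t * t\<^sup>2) has_integral v) {-L..L}"
proof -
  let ?k = "trig_kernel L (Suc n)"
  have "(\<lambda>t. ?k t * t\<^sup>2) integrable_on {-L..L}"
    by (intro integrable_continuous_interval continuous_intros continuous_kernel L)
  then obtain v where v: "((\<lambda>t. ?k t * t\<^sup>2) has_integral v) {-L..L}" by blast
  have "v \<ge> 0" by (rule has_integral_nonneg[OF v]) (simp add: kernel_nonneg[OF L])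
  moreover have "v \<le> 8 * L\<^sup>2 * (1 / (real n + 2))"
  proof (rule has_integral_le[OF v has_integral_mult_right[OF has_integral_kernel_one_minus_cos[OF L]]])
    fix t assume t: "t \<in> {-L..L}"
    have "\<bar>pi / L * t\<bar> \<le> pi" using t L by (auto simp: abs_mult field_simps abs_le_iff)
    then have "(pi / L * t)\<^sup>2 \<le> 8 * (1 - cos (pi / L * t))" by (rule square_le_one_minus_cos)
    moreover have "t\<^sup>2 \<le> L\<^sup>2 * (pi / L * t)\<^sup>2"
    proof -
      have "1\<^sup>2 \<le> pi\<^sup>2" using pi_gt3 by (intro power_mono) auto
      then have "1 * t\<^sup>2 \<le> pi\<^sup>2 * t\<^sup>2" by (intro mult_right_mono) auto
      then show ?thesis using L by (simp add: power_mult_distrib power_divide)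
    qed
    ultimately have "t\<^sup>2 \<le> L\<^sup>2 * (8 * (1 - cos (pi / L * t)))"
      by (meson mult_left_mono order_trans zero_le_power2)
    then have "?k t * t\<^sup>2 \<le> ?k t * (L\<^sup>2 * (8 * (1 - cos (pi / L * t))))"
      by (rule mult_left_mono) (rule kernel_nonneg[OF L])
    then show "?k t * t\<^sup>2 \<le> 8 * L\<^sup>2 * (?k t * (1 - cos (pi / L * t)))"
      by (simp only: mult_ac)
  qed
  ultimately show ?thesis using v by auto
qed

section \<open>Product kernels in several variables\<close>

lemma nn_integral_prod_vec:
  fixes f :: "'d::finite \<Rightarrow> real \<Rightarrow> ennreal"
  assumes "\<And>j. f j \<in> borel_measurable borel"
  shows "(\<integral>\<^sup>+x. (\<Prod>j\<in>UNIV. f j ((x :: real ^ 'd) $ j)) \<partial>lborel) = (\<Prod>j\<in>UNIV. \<integral>\<^sup>+t. f j t \<partial>lborel)"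
proof -
  define ax :: "'d \<Rightarrow> real ^ 'd" where "ax j = axis j 1" for j
  have inj: "inj ax" by (auto simp: inj_def ax_def axis_eq_axis)
  have B: "Basis = range ax" by (auto simp: Basis_vec_def ax_def)
  define F where "F b = f (inv ax b)" for b
  have F: "F (ax j) = f j" for j by (simp add: F_def inj)
  have "(\<integral>\<^sup>+x. (\<Prod>b\<in>Basis. F b (x \<bullet> b)) \<partial>lborel) = (\<Prod>b\<in>Basis. (\<integral>\<^sup>+x. F b x \<partial>lborel))"
    by (rule nn_integral_lborel_prod) (auto simp: F_def assms)
  then show ?thesis
    unfolding B prod.reindex[OF inj] o_def F by (simp add: ax_def inner_axis)
qed

lemma has_bochner_integral_prod_vec:
  fixes f :: "'d::finite \<Rightarrow> real \<Rightarrow> real"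
  assumes L: "L \<ge> 0" and f: "\<And>j. continuous_on {-L..L} (f j)" "\<And>j t. f j t \<ge> 0"
    and I: "\<And>j. (f j has_integral I j) {-L..L}"
  shows "has_bochner_integral lborel
    (\<lambda>x :: real ^ 'd. \<Prod>j\<in>UNIV. indicator {-L..L} (x $ j) * f j (x $ j)) (\<Prod>j\<in>UNIV. I j)"
proof -
  have I0: "I j \<ge> 0" for j by (rule has_integral_nonneg[OF I]) (rule f)
  have m: "(\<lambda>t. indicator {-L..L} t * f j t) \<in> borel_measurable borel" for j
    using borel_measurable_continuous_on_indicator[OF _ f(1), of j] by simp
  have "(\<integral>\<^sup>+x. ennreal (\<Prod>j\<in>UNIV. indicator {-L..L} ((x :: real ^ 'd) $ j) * f j (x $ j)) \<partial>lborel) =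
      (\<integral>\<^sup>+x. (\<Prod>j\<in>UNIV. ennreal (indicator {-L..L} ((x :: real ^ 'd) $ j) * f j (x $ j))) \<partial>lborel)"
    by (intro nn_integral_cong) (simp add: prod_ennreal f)
  also have "\<dots> = (\<Prod>j\<in>UNIV. \<integral>\<^sup>+t. ennreal (indicator {-L..L} t * f j t) \<partial>lborel)"
    by (rule nn_integral_prod_vec[of "\<lambda>j t. ennreal (indicator {-L..L} t * f j t)"]) (use m in simp)
  also have "\<dots> = (\<Prod>j\<in>UNIV. ennreal (I j))"
    by (intro prod.cong refl nn_integral_has_integral_lebesgue f I)
  also have "\<dots> = ennreal (\<Prod>j\<in>UNIV. I j)" by (rule prod_ennreal) (rule I0)
  finally have eq: "(\<integral>\<^sup>+x. ennreal (\<Prod>j\<in>UNIV. indicator {-L..L} ((x :: real ^ 'd) $ j) * f j (x $ j)) \<partial>lborel) =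
      ennreal (\<Prod>j\<in>UNIV. I j)" .
  show ?thesis
  proof (rule has_bochner_integral_nn_integral[OF _ _ _ eq])
    have "(\<lambda>x :: real ^ 'd. indicator {-L..L} (x $ j) * f j (x $ j)) \<in> borel_measurable borel" for j
      using measurable_compose[OF borel_measurable_continuous_onI[OF continuous_on_component[OF continuous_on_id]] m, of j]
      by simp
    then show "(\<lambda>x :: real ^ 'd. \<Prod>j\<in>UNIV. indicator {-L..L} (x $ j) * f j (x $ j)) \<in> borel_measurable lborel"
      by (simp add: borel_measurable_prod)
  qed (use I0 f in \<open>auto intro!: prod_nonneg AE_I2\<close>)
qed

definition freq :: "real \<Rightarrow> ('n::finite + 'n \<Rightarrow> int) \<Rightarrow> 'n phase"
  where "freq L k = (\<chi> j. pi / L * of_int (k j))"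

definition box_coeff :: "real \<Rightarrow> nat \<Rightarrow> ('n::finite + 'n \<Rightarrow> int) \<Rightarrow> real"
  where "box_coeff L n k = (\<Prod>j\<in>UNIV. kernel_coeff n (k j) / (2 * L))"

lemma cis_sum: "finite J \<Longrightarrow> cis (\<Sum>j\<in>J. a j) = (\<Prod>j\<in>J. cis (a j))"
  by (induction J rule: finite_induct) (simp_all add: cis_mult[symmetric])

text \<open>The expansion passes through complex exponentials because their products stay
  exponentials of sums of angles; the real part at the end leaves a single cosine for each lattice
  frequency.\<close>

lemma prod_kernel_expansion:
  fixes t :: "'n::finite phase"
  assumes L: "L > 0"
  shows "(\<Prod>j\<in>UNIV. trig_kernel L n (t $ j)) =
    (\<Sum>k\<in>PiE UNIV (\<lambda>_. {- int n..int n}). box_coeff L n k * cos (freq L k \<bullet> t))"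
proof -
  have "complex_of_real (\<Prod>j\<in>UNIV. trig_kernel L n (t $ j)) =
      (\<Prod>j\<in>UNIV. \<Sum>m\<in>{- int n..int n}. complex_of_real (kernel_coeff n m / (2 * L)) * cis (pi / L * of_int m * t $ j))"
    unfolding of_real_prod kernel_expansion_cis[OF L] ..
  also have "\<dots> = (\<Sum>k\<in>PiE UNIV (\<lambda>_. {- int n..int n}). \<Prod>j\<in>UNIV.
      complex_of_real (kernel_coeff n (k j) / (2 * L)) * cis (pi / L * of_int (k j) * t $ j))"
    by (rule prod_sum_PiE) auto
  also have "\<dots> = (\<Sum>k\<in>PiE UNIV (\<lambda>_. {- int n..int n}). complex_of_real (box_coeff L n k) * cis (freq L k \<bullet> t))"
    unfolding prod.distrib box_coeff_def of_real_prod freq_def inner_vec_def cis_sum[OF finite] by simp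
  finally have e: "complex_of_real (\<Prod>j\<in>UNIV. trig_kernel L n (t $ j)) =
      (\<Sum>k\<in>PiE UNIV (\<lambda>_. {- int n..int n}). complex_of_real (box_coeff L n k) * cis (freq L k \<bullet> t))" .
  show ?thesis using arg_cong[OF e, of Re] unfolding Re_complex_of_real Re_sum by simp
qed

text \<open>Only partial derivatives are bounded, so y is moved to y + t one coordinate at a
  time.\<close>

lemma test_fun_lipschitz:
  fixes \<psi> :: "'n::finite phase \<Rightarrow> real"
  assumes sm: "smooth_fun \<psi>" and B: "\<And>k z. \<bar>pd k \<psi> z\<bar> \<le> B"
  shows "\<bar>\<psi> (y + t) - \<psi> y\<bar> \<le> B * (\<Sum>j\<in>UNIV. \<bar>t $ j\<bar>)"
proof -
  have key: "\<bar>\<psi> (y + (\<Sum>j\<in>J. t $ j *\<^sub>R axis j 1)) - \<psi> y\<bar> \<le> B * (\<Sum>j\<in>J. \<bar>t $ j\<bar>)" if "finite J" for J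
    using that
  proof (induction J rule: finite_induct)
    case (insert j J)
    let ?x = "y + (\<Sum>j\<in>J. t $ j *\<^sub>R axis j 1)"
    have "norm (\<psi> (?x + t $ j *\<^sub>R axis j 1) - \<psi> (?x + 0 *\<^sub>R axis j 1)) \<le> B * norm (t $ j - 0)"
      by (rule field_differentiable_bound[of UNIV _ "\<lambda>s. pd j \<psi> (?x + s *\<^sub>R axis j 1)"])
        (auto intro: smooth_line_derivative[OF sm] B)
    then have "\<bar>\<psi> (?x + t $ j *\<^sub>R axis j 1) - \<psi> ?x\<bar> \<le> B * \<bar>t $ j\<bar>" by simp
    moreover have e: "y + (\<Sum>j\<in>insert j J. t $ j *\<^sub>R axis j 1) = ?x + t $ j *\<^sub>R axis j 1"
      using insert by (simp add: add_ac)
    moreover have "B * (\<Sum>j\<in>insert j J. \<bar>t $ j\<bar>) = B * \<bar>t $ j\<bar> + B * (\<Sum>j\<in>J. \<bar>t $ j\<bar>)"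
      using insert by (simp add: algebra_simps)
    ultimately show ?case using insert.IH unfolding e by linarith
  qed simp
  have t: "(\<Sum>j\<in>UNIV. t $ j *\<^sub>R axis j 1) = t"
    using basis_expansion[of t] by (simp add: scalar_mult_eq_scaleR)
  show ?thesis using key[OF finite[of UNIV]] unfolding t .
qed

text \<open>Only second moments of the kernel are known. The first-order error |t_j| is therefore
  replaced by (a t_j^2 + 1/a)/2, and a = sqrt (n + 2) balances the two terms at the rate
  1/a.\<close>

lemma kernel_mean:
  fixes \<psi> :: "'n::finite phase \<Rightarrow> real"
  assumes L: "L > 0" and sm: "smooth_fun \<psi>" and B: "B \<ge> 0" "\<And>k z. \<bar>pd k \<psi> z\<bar> \<le> B"
    and int: "integrable lborel (\<lambda>t. \<psi> (y + t) * (\<Prod>j\<in>UNIV. indicator {-L..L} (t $ j) * trig_kernel L (Suc n) (t $ j)))"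
  shows "\<bar>(LINT t|lborel. \<psi> (y + t) * (\<Prod>j\<in>UNIV. indicator {-L..L} (t $ j) * trig_kernel L (Suc n) (t $ j))) - \<psi> y\<bar>
    \<le> B / 2 * (real CARD('n + 'n) * ((8 * L\<^sup>2 + 1) / sqrt (real n + 2)))"
proof -
  let ?k = "trig_kernel L (Suc n)"
  define \<rho> where "\<rho> = (\<lambda>t :: 'n phase. \<Prod>j\<in>UNIV. indicator {-L..L} (t $ j) * ?k (t $ j))"
  have int': "integrable lborel (\<lambda>t. \<psi> (y + t) * \<rho> t)" unfolding \<rho>_def by (rule int)
  define a where "a = sqrt (real n + 2)"
  have a: "a > 0" "a\<^sup>2 = real n + 2" by (auto simp: a_def)
  obtain v where v: "v \<ge> 0" "v \<le> 8 * L\<^sup>2 / (real n + 2)" "((\<lambda>t. ?k t * t\<^sup>2) has_integral v) {-L..L}"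
    using has_integral_kernel_square[OF L, of n] by blast
  have \<rho>: "has_bochner_integral lborel \<rho> 1"
    using has_bochner_integral_prod_vec[of L "\<lambda>j. ?k" "\<lambda>j. 1"] L
    by (simp add: \<rho>_def continuous_kernel kernel_nonneg has_integral_kernel)
  have \<rho>0: "\<rho> t \<ge> 0" for t unfolding \<rho>_def by (intro prod_nonneg) (simp add: kernel_nonneg[OF L])
  have mom: "has_bochner_integral lborel (\<lambda>t. (t $ i)\<^sup>2 * \<rho> t) v" for i
  proof -
    let ?f = "\<lambda>j s. if j = i then ?k s * s\<^sup>2 else ?k s"
    have "has_bochner_integral lborel
        (\<lambda>t :: 'n phase. \<Prod>j\<in>UNIV. indicator {-L..L} (t $ j) * ?f j (t $ j)) (\<Prod>j\<in>UNIV. if j = i then v else 1)"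
    proof (rule has_bochner_integral_prod_vec)
      show "continuous_on {-L..L} (?f j)" for j
        by (cases "j = i") (auto intro!: continuous_intros continuous_kernel L)
      show "(?f j has_integral (if j = i then v else 1)) {-L..L}" for j
        by (cases "j = i") (auto intro: v has_integral_kernel L)
    qed (use L kernel_nonneg[OF L] in auto)
    moreover have "(\<Prod>j\<in>UNIV. indicator {-L..L} (t $ j) * ?f j (t $ j)) = (t $ i)\<^sup>2 * \<rho> t" for t
    proof -
      have "(\<Prod>j\<in>UNIV. indicator {-L..L} (t $ j) * ?f j (t $ j)) =
          (\<Prod>j\<in>UNIV. (if j = i then (t $ i)\<^sup>2 else 1) * (indicator {-L..L} (t $ j) * ?k (t $ j)))"
        by (rule prod.cong) auto
      then show ?thesis by (simp add: \<rho>_def prod.distrib prod.delta)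
    qed
    ultimately show ?thesis by (simp add: prod.delta)
  qed
  let ?g = "\<lambda>t. B / 2 * (\<Sum>j\<in>UNIV. a * ((t $ j)\<^sup>2 * \<rho> t) + (1 / a) * \<rho> t)"
  have g: "has_bochner_integral lborel ?g (B / 2 * (\<Sum>j\<in>(UNIV :: ('n + 'n) set). a * v + (1 / a) * 1))"
    by (intro has_bochner_integral_mult_right has_bochner_integral_sum has_bochner_integral_add mom \<rho>)
  have "(LINT t|lborel. \<psi> (y + t) * \<rho> t) - \<psi> y = (LINT t|lborel. \<psi> (y + t) * \<rho> t - \<psi> y * \<rho> t)"
    using int' \<rho> by (simp add: has_bochner_integral_iff)
  also have "norm \<dots> \<le> (LINT t|lborel. ?g t)"
  proof (rule Bochner_Integration.integral_norm_bound_integral)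
    show "integrable lborel (\<lambda>t. \<psi> (y + t) * \<rho> t - \<psi> y * \<rho> t)"
      using int' \<rho> by (simp add: has_bochner_integral_iff)
    show "integrable lborel ?g" using g by (simp add: has_bochner_integral_iff)
    fix t :: "'n phase"
    have am: "\<bar>t $ j\<bar> \<le> (a * (t $ j)\<^sup>2 + 1 / a) / 2" for j
    proof -
      have "0 \<le> (a * \<bar>t $ j\<bar> - 1)\<^sup>2" by simp
      also have "\<dots> = a * (a * (t $ j)\<^sup>2 - 2 * \<bar>t $ j\<bar>) + 1"
        by (simp add: power2_eq_square algebra_simps)
      finally show ?thesis using a by (simp add: field_simps)
    qed
    have "\<bar>\<psi> (y + t) - \<psi> y\<bar> \<le> B * (\<Sum>j\<in>UNIV. \<bar>t $ j\<bar>)" by (rule test_fun_lipschitz[OF sm B(2)])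
    also have "\<dots> \<le> B * (\<Sum>j\<in>UNIV. (a * (t $ j)\<^sup>2 + 1 / a) / 2)"
      by (intro mult_left_mono sum_mono am B)
    finally have "\<bar>\<psi> (y + t) - \<psi> y\<bar> * \<rho> t \<le> B * (\<Sum>j\<in>UNIV. (a * (t $ j)\<^sup>2 + 1 / a) / 2) * \<rho> t"
      by (rule mult_right_mono) (rule \<rho>0)
    also have "\<dots> = ?g t"
      by (simp add: sum_distrib_left sum_distrib_right algebra_simps add_divide_distrib)
    finally show "norm (\<psi> (y + t) * \<rho> t - \<psi> y * \<rho> t) \<le> ?g t"
      using \<rho>0[of t] by (simp only: left_diff_distrib[symmetric] real_norm_def abs_mult abs_of_nonneg)
  qed
  also have "\<dots> = B / 2 * (real CARD('n + 'n) * (a * v + 1 / a))"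
    unfolding has_bochner_integral_integral_eq[OF g] by simp
  also have "\<dots> \<le> B / 2 * (real CARD('n + 'n) * ((8 * L\<^sup>2 + 1) / a))"
  proof (intro mult_left_mono)
    have "a * v \<le> a * (8 * L\<^sup>2 / a\<^sup>2)" using v(2) a by (intro mult_left_mono) auto
    then show "a * v + 1 / a \<le> (8 * L\<^sup>2 + 1) / a" using a(1)
      by (simp add: power2_eq_square add_divide_distrib)
  qed (use B in auto)
  finally show ?thesis by (simp add: a_def \<rho>_def)
qed

text \<open>The weighted partial Fourier sum is the convolution of \<psi> with the product kernel,
  which is an approximate identity.\<close>

lemma fejer_sum_tendsto:
  fixes \<psi> :: "'n::finite phase \<Rightarrow> real"
  assumes R: "R > 0" and \<psi>: "test_on (cube R) \<psi>" and y: "y \<in> cube (2 * R)"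
  defines "L \<equiv> 4 * R"
  shows "(\<lambda>n. \<Sum>k\<in>PiE UNIV (\<lambda>_. {- int (Suc n)..int (Suc n)}). box_coeff L (Suc n) k *
      (LINT x|lborel. \<psi> x * cos (freq L k \<bullet> x + - (freq L k \<bullet> y)))) \<longlonglongrightarrow> \<psi> y"
proof -
  have L: "L > 0" using R by (simp add: L_def)
  have sm: "smooth_fun \<psi>" using \<psi> by (simp add: test_on_def)
  have "\<exists>B\<ge>0. \<forall>z. \<bar>pd k \<psi> z\<bar> \<le> B" for k
    by (rule test_on_bounded[OF compact_cube test_on_pd[OF compact_imp_closed[OF compact_cube] \<psi>]]) blast
  from choice[OF allI[OF this]] obtain Bk where Bk: "\<forall>k. 0 \<le> Bk k \<and> (\<forall>z. \<bar>pd k \<psi> z\<bar> \<le> Bk k)" ..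
  define B where "B = (\<Sum>k\<in>UNIV. Bk k)"
  have B: "B \<ge> 0" "\<And>k z. \<bar>pd k \<psi> z\<bar> \<le> B"
  proof -
    show "B \<ge> 0" unfolding B_def using Bk by (intro sum_nonneg) auto
    fix k z
    have "Bk k \<le> B" unfolding B_def using Bk by (intro member_le_sum) auto
    then show "\<bar>pd k \<psi> z\<bar> \<le> B" using Bk by (meson order_trans)
  qed
  define S where "S n = (\<Sum>k\<in>PiE UNIV (\<lambda>_. {- int (Suc n)..int (Suc n)}). box_coeff L (Suc n) k *
      (LINT x|lborel. \<psi> x * cos (freq L k \<bullet> x + - (freq L k \<bullet> y))))" for n
  have est: "\<bar>S n - \<psi> y\<bar> \<le> B / 2 * (real CARD('n + 'n) * ((8 * L\<^sup>2 + 1) / sqrt (real n + 2)))" for n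
  proof -
    define P where "P = PiE UNIV (\<lambda>_::'n + 'n. {- int (Suc n)..int (Suc n)})"
    let ?k = "trig_kernel L (Suc n)"
    let ?\<kappa> = "\<lambda>t :: 'n phase. \<Prod>j\<in>UNIV. ?k (t $ j)"
    have fin: "finite P" unfolding P_def by (intro finite_PiE) auto
    have ti: "integrable lborel (\<lambda>x. box_coeff L (Suc n) k * (\<psi> x * cos (freq L k \<bullet> x + c)))" for k c
      by (rule integrable_test_on[OF compact_cube test_on_cmult[OF test_on_mult_cos[OF \<psi>]]])
    have cont\<kappa>: "continuous_on UNIV ?\<kappa>"
      by (intro continuous_on_prod continuous_on_compose2[OF continuous_kernel[OF L, of UNIV]] continuous_intros) auto
    have "S n = (LINT x|lborel. (\<Sum>k\<in>P. box_coeff L (Suc n) k * (\<psi> x * cos (freq L k \<bullet> x + - (freq L k \<bullet> y)))))"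
      unfolding S_def P_def[symmetric] by (subst Bochner_Integration.integral_sum[OF ti]) simp
    also have "\<dots> = (LINT x|lborel. \<psi> x * ?\<kappa> (x - y))"
    proof (rule Bochner_Integration.integral_cong[OF refl])
      fix x
      have e: "freq L k \<bullet> x + - (freq L k \<bullet> y) = freq L k \<bullet> (x - y)" for k by (simp add: inner_diff_right)
      show "(\<Sum>k\<in>P. box_coeff L (Suc n) k * (\<psi> x * cos (freq L k \<bullet> x + - (freq L k \<bullet> y)))) = \<psi> x * ?\<kappa> (x - y)"
        unfolding prod_kernel_expansion[OF L] P_def[symmetric] sum_distrib_left e by (simp only: mult.left_commute)
    qed
    finally have S1: "S n = (LINT x|lborel. \<psi> x * ?\<kappa> (x - y))" .
    have c1: "continuous_on UNIV (\<lambda>x. \<psi> x * ?\<kappa> (x - y))"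
      by (intro continuous_on_mult smooth_continuous[OF sm] continuous_on_compose2[OF cont\<kappa>] continuous_intros) auto
    have i1: "integrable lborel (\<lambda>x. \<psi> x * ?\<kappa> (x - y))"
      by (rule integrable_compact_support[OF compact_cube c1, of R]) (use \<psi> in \<open>simp add: test_on_def\<close>)
    have S2: "S n = (LINT t|lborel. \<psi> (y + t) * ?\<kappa> t)" "integrable lborel (\<lambda>t. \<psi> (y + t) * ?\<kappa> t)"
      using integral_translate[OF c1 i1, of y] integrable_translate[OF c1 i1, of y] unfolding S1
      by (simp_all add: add.commute)
    \<comment> \<open>The origin of the period 8R: for y + t in \<open>cube R\<close> and y in
      \<open>cube (2 * R)\<close> each |t_j| is at most 3R < L, so the integrand meets a single
      period of the kernel.\<close>
    have ind: "\<psi> (y + t) * ?\<kappa> t = \<psi> (y + t) * (\<Prod>j\<in>UNIV. indicator {-L..L} (t $ j) * ?k (t $ j))" for t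
    proof (cases "y + t \<in> cube R")
      case True
      have "t $ j \<in> {-L..L}" for j
      proof -
        have "\<bar>y $ j + t $ j\<bar> \<le> R" "\<bar>y $ j\<bar> \<le> 2 * R" using True y by (auto simp: cube_def)
        then show ?thesis using R by (auto simp: L_def)
      qed
      then show ?thesis by simp
    next
      case False
      then show ?thesis using \<psi> by (simp add: test_on_def)
    qed
    show ?thesis
      using kernel_mean[OF L sm B, of y n] S2 unfolding ind by simp
  qed
  have lim: "(\<lambda>n. B / 2 * (real CARD('n + 'n) * ((8 * L\<^sup>2 + 1) / sqrt (real n + 2)))) \<longlonglongrightarrow>
      B / 2 * (real CARD('n + 'n) * 0)"
  proof (intro tendsto_intros tendsto_divide_0[OF tendsto_const] filterlim_at_top_imp_at_infinity)
    have "filterlim (\<lambda>n. real n + 2) at_top sequentially"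
      by (intro filterlim_at_top_mono[OF filterlim_real_sequentially]) auto
    then show "filterlim (\<lambda>n. sqrt (real n + 2)) at_top sequentially"
      by (rule filterlim_compose[OF sqrt_at_top])
  qed
  have "(\<lambda>n. S n - \<psi> y) \<longlonglongrightarrow> 0"
    by (rule Lim_null_comparison[of _ "\<lambda>n. B / 2 * (real CARD('n + 'n) * ((8 * L\<^sup>2 + 1) / sqrt (real n + 2)))"])
      (use est lim in auto)
  then show ?thesis unfolding S_def by (simp add: LIM_zero_iff)
qed

section \<open>Summation over the frequency lattice and Fourier inversion\<close>

definition freq_enum :: "nat \<Rightarrow> ('n::finite + 'n \<Rightarrow> int)"
  where "freq_enum = from_nat_into UNIV"

lemma bij_freq_enum: "bij (freq_enum :: nat \<Rightarrow> ('n::finite + 'n \<Rightarrow> int))"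
proof -
  have "inj (\<lambda>m :: int. (\<lambda>_ :: 'n + 'n. m))" by (auto simp: inj_def fun_eq_iff)
  then have "infinite (range (\<lambda>m :: int. (\<lambda>_ :: 'n + 'n. m)))"
    using finite_imageD infinite_UNIV_int by blast
  then have "infinite (UNIV :: ('n + 'n \<Rightarrow> int) set)" by (rule infinite_super[OF subset_UNIV])
  then show ?thesis
    unfolding freq_enum_def by (intro bij_betw_from_nat_into) auto
qed

lemma sum_inverse_squares_bounded:
  "\<exists>S\<ge>0. \<forall>m. (\<Sum>k\<in>{- int m..int m}. 1 / (1 + (real_of_int k)\<^sup>2)) \<le> S"
proof -
  have "summable (\<lambda>n. 1 / (1 + (real n)\<^sup>2))"
  proof (rule summable_comparison_test'[where N = 1])
    show "summable (\<lambda>n. 1 / (real n)\<^sup>2)" using inverse_power_summable[of 2, where 'a = real] by (simp add: inverse_eq_divide)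
    fix n :: nat assume "n \<ge> 1"
    then show "norm (1 / (1 + (real n)\<^sup>2)) \<le> 1 / (real n)\<^sup>2"
      by (simp add: divide_left_mono mult_pos_pos add_pos_pos)
  qed
  then have S: "(\<Sum>n\<le>m. 1 / (1 + (real n)\<^sup>2)) \<le> (\<Sum>n. 1 / (1 + (real n)\<^sup>2))" for m
    by (intro sum_le_suminf) auto
  have "(\<Sum>k\<in>{- int m..int m}. 1 / (1 + (real_of_int k)\<^sup>2)) \<le> 2 * (\<Sum>n. 1 / (1 + (real n)\<^sup>2))" for m
  proof -
    have "{- int m..int m} \<subseteq> int ` {..m} \<union> (\<lambda>n. - int n) ` {..m}"
    proof
      fix k assume "k \<in> {- int m..int m}"
      then show "k \<in> int ` {..m} \<union> (\<lambda>n. - int n) ` {..m}"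
        by (cases "k \<ge> 0") (auto simp: image_iff intro: bexI[of _ "nat k"] bexI[of _ "nat (- k)"])
    qed
    then have "(\<Sum>k\<in>{- int m..int m}. 1 / (1 + (real_of_int k)\<^sup>2)) \<le>
        (\<Sum>k\<in>int ` {..m} \<union> (\<lambda>n. - int n) ` {..m}. 1 / (1 + (real_of_int k)\<^sup>2))"
      by (intro sum_mono2) auto
    also have "\<dots> \<le> (\<Sum>k\<in>int ` {..m}. 1 / (1 + (real_of_int k)\<^sup>2)) + (\<Sum>k\<in>(\<lambda>n. - int n) ` {..m}. 1 / (1 + (real_of_int k)\<^sup>2))"
      by (subst sum.union_inter[symmetric]) (auto intro: sum_nonneg)
    also have "\<dots> = 2 * (\<Sum>n\<le>m. 1 / (1 + (real n)\<^sup>2))"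
      by (simp add: sum.reindex inj_on_def)
    finally show ?thesis using S[of m] by linarith
  qed
  moreover have "0 \<le> 2 * (\<Sum>n. 1 / (1 + (real n)\<^sup>2))" using order_trans[OF sum_nonneg S[of 0]] by simp
  ultimately show ?thesis by blast
qed

text \<open>Each squared weight dominates 1 + k_j^2 up to a constant. The exponent, twice the
  dimension, supplies one square per coordinate, and the resulting majorant is a product of
  one-dimensional convergent sums.\<close>

lemma summable_freq:
  assumes L: "L > 0"
  shows "summable (\<lambda>i. 1 / (1 + norm (freq L (freq_enum i) :: 'n::finite phase)) ^ (2 * CARD('n + 'n)))"
proof -
  obtain S where S: "S \<ge> 0" "\<And>m. (\<Sum>k\<in>{- int m..int m}. 1 / (1 + (real_of_int k)\<^sup>2)) \<le> S"
    using sum_inverse_squares_bounded by blast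
  define p where "p k = (\<Prod>j\<in>UNIV. 1 / (1 + (real_of_int (k j))\<^sup>2))" for k :: "'n + 'n \<Rightarrow> int"
  have p0: "p k \<ge> 0" for k unfolding p_def by (intro prod_nonneg) auto
  have "p summable_on UNIV"
  proof (rule nonneg_bdd_above_summable_on[OF p0])
    have "sum p F \<le> S ^ CARD('n + 'n)" if F: "finite F" for F
    proof -
      have "\<exists>m. \<forall>k\<in>F. \<forall>j. \<bar>k j\<bar> \<le> int m"
      proof -
        have "finite ((\<lambda>(k, j). nat \<bar>k j\<bar>) ` (F \<times> UNIV))" using F by simp
        then obtain m where "\<forall>x\<in>(\<lambda>(k, j). nat \<bar>k j\<bar>) ` (F \<times> UNIV). x \<le> m"
          using finite_nat_set_iff_bounded_le by blast
        then show ?thesis by (intro exI[of _ m]) (auto simp: nat_le_iff)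
      qed
      then obtain m where m: "\<forall>k\<in>F. \<forall>j. \<bar>k j\<bar> \<le> int m" by blast
      let ?P = "PiE UNIV (\<lambda>_ :: 'n + 'n. {- int m..int m})"
      have "sum p F \<le> sum p ?P"
      proof (rule sum_mono2)
        show "finite ?P" by (intro finite_PiE) auto
        show "F \<subseteq> ?P" using m by (auto simp: PiE_iff abs_le_iff minus_le_iff)
      qed (rule p0)
      also have "\<dots> = (\<Prod>j\<in>(UNIV :: ('n + 'n) set). \<Sum>k\<in>{- int m..int m}. 1 / (1 + (real_of_int k)\<^sup>2))"
        unfolding p_def by (rule prod_sum_PiE[symmetric]) auto
      also have "\<dots> = (\<Sum>k\<in>{- int m..int m}. 1 / (1 + (real_of_int k)\<^sup>2)) ^ CARD('n + 'n)" by simp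
      also have "\<dots> \<le> S ^ CARD('n + 'n)" by (intro power_mono S sum_nonneg) auto
      finally show ?thesis .
    qed
    then show "bdd_above (sum p ` {F. F \<subseteq> UNIV \<and> finite F})" by (intro bdd_aboveI[of _ "S ^ CARD('n + 'n)"]) auto
  qed
  then have "(\<lambda>i. p (freq_enum i)) summable_on UNIV"
    using summable_on_reindex_bij_betw[OF bij_freq_enum, of p] by simp
  then have sp: "summable (\<lambda>i. p (freq_enum i))" by (rule summable_on_imp_summable)
  define C where "C = 1 + (L / pi)\<^sup>2"
  have C: "C > 0" unfolding C_def by (simp add: add_pos_nonneg)
  have le: "1 / (1 + norm (freq L k :: 'n phase)) ^ (2 * CARD('n + 'n)) \<le> C ^ CARD('n + 'n) * p k" for k
  proof -
    let ?x = "1 + norm (freq L k :: 'n phase)"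
    have x: "?x \<ge> 1" by simp
    have "1 / ?x\<^sup>2 \<le> C * (1 / (1 + (real_of_int (k j))\<^sup>2))" for j
    proof -
      have "\<bar>real_of_int (k j)\<bar> = (L / pi) * \<bar>(freq L k :: 'n phase) $ j\<bar>"
        using L by (simp add: freq_def abs_mult)
      also have "\<dots> \<le> (L / pi) * ?x"
        using L component_le_norm_cart[of "freq L k :: 'n phase" j] by (intro mult_left_mono) auto
      finally have "\<bar>real_of_int (k j)\<bar>\<^sup>2 \<le> ((L / pi) * ?x)\<^sup>2" by (intro power_mono) auto
      moreover have "1 \<le> ?x\<^sup>2" using x by (intro one_le_power)
      moreover have "C * ?x\<^sup>2 = ?x\<^sup>2 + (L / pi)\<^sup>2 * ?x\<^sup>2" by (simp add: C_def distrib_right)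
      ultimately have "1 + (real_of_int (k j))\<^sup>2 \<le> C * ?x\<^sup>2"
        unfolding power_mult_distrib power2_abs by linarith
      moreover have "1 / X \<le> C * (1 / Y)" if "Y \<le> C * X" "X > 0" "Y > 0" for X Y
        using that by (simp add: field_simps)
      moreover have "?x\<^sup>2 > 0" using x by (intro zero_less_power) linarith
      ultimately show ?thesis by (meson add_pos_nonneg zero_le_power2 zero_less_one)
    qed
    then have "(\<Prod>j\<in>(UNIV :: ('n + 'n) set). 1 / ?x\<^sup>2) \<le> (\<Prod>j\<in>UNIV. C * (1 / (1 + (real_of_int (k j))\<^sup>2)))"
      by (intro prod_mono) auto
    then show ?thesis unfolding prod.distrib p_def by (simp only: prod_constant power_mult power_one_over)
  qed
  show ?thesis
    by (rule summable_comparison_test'[OF summable_mult[OF sp, of "C ^ CARD('n + 'n)"], where N = 0])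
      (use le in simp)
qed

text \<open>Decay beyond the weight p by twice the dimension leaves a summable series over the
  lattice.\<close>

lemma rapid_freqI:
  assumes L: "L > 0" and b: "\<And>n. \<exists>C. \<forall>i. \<bar>b i\<bar> * (1 + norm (freq L (freq_enum i) :: 'n::finite phase)) ^ n \<le> C"
  shows "rapid b (\<lambda>i. freq L (freq_enum i) :: 'n phase)"
  unfolding rapid_def
proof
  fix p
  let ?x = "\<lambda>i. 1 + norm (freq L (freq_enum i) :: 'n phase)" and ?N = "2 * CARD('n + 'n)"
  obtain C where C: "\<And>i. \<bar>b i\<bar> * ?x i ^ (p + ?N) \<le> C" using b by blast
  show "summable (\<lambda>i. \<bar>b i\<bar> * ?x i ^ p)"
  proof (rule summable_comparison_test'[OF summable_mult[OF summable_freq[OF L], of C], where N = 0])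
    fix i
    have "?x i > 0" by (simp add: add_pos_nonneg)
    then show "norm (\<bar>b i\<bar> * ?x i ^ p) \<le> C * (1 / ?x i ^ ?N)"
      using C[of i] by (simp add: abs_mult power_add field_simps)
  qed
qed

text \<open>The weighted means converge to \<psi> y, and by Tannery's theorem also to the unweighted
  series: the weights are bounded and converge for each frequency, while the Fourier integrals of a
  test function decay fast enough to dominate.\<close>

lemma fourier_inversion:
  fixes \<psi> :: "'n::finite phase \<Rightarrow> real"
  assumes R: "R > 0" and \<psi>: "test_on (cube R) \<psi>" and y: "y \<in> cube (2 * R)"
  defines "L \<equiv> 4 * R"
  shows "(\<lambda>i. (1 / (2 * L)) ^ CARD('n + 'n) *
    (LINT x|lborel. \<psi> x * cos (freq L (freq_enum i) \<bullet> x + - (freq L (freq_enum i) \<bullet> y)))) sums \<psi> y"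
proof -
  have L: "L > 0" using R by (simp add: L_def)
  define I where "I k = (LINT x|lborel. \<psi> x * cos (freq L k \<bullet> x + - (freq L k \<bullet> y)))" for k
  define w where "w = (1 / (2 * L)) ^ CARD('n + 'n)"
  have w: "w \<ge> 0" using L by (simp add: w_def)
  define a where "a i n = box_coeff L (Suc n) (freq_enum i :: 'n + 'n \<Rightarrow> int) * I (freq_enum i)" for i n
  obtain C where C: "\<And>\<xi> c. \<bar>LINT z|lborel. \<psi> z * cos (\<xi> \<bullet> z + c)\<bar> * (1 + norm \<xi>) ^ (2 * CARD('n + 'n)) \<le> C"
    using integral_cos_decay[OF compact_cube \<psi>] by blast
  let ?x = "\<lambda>i. 1 + norm (freq L (freq_enum i) :: 'n phase)" and ?N = "2 * CARD('n + 'n)"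
  have I: "\<bar>I (freq_enum i)\<bar> \<le> C * (1 / ?x i ^ ?N)" for i
  proof -
    have "?x i > 0" by (simp add: add_pos_nonneg)
    then show ?thesis using C[of "freq L (freq_enum i)" "- (freq L (freq_enum i) \<bullet> y)"]
      unfolding I_def by (simp add: field_simps)
  qed
  have box: "0 \<le> box_coeff L n k" "box_coeff L n k \<le> w" for n and k :: "'n + 'n \<Rightarrow> int"
  proof -
    show "0 \<le> box_coeff L n k" unfolding box_coeff_def using L kernel_coeff_bounds by (intro prod_nonneg) auto
    have "box_coeff L n k \<le> (\<Prod>j\<in>(UNIV :: ('n + 'n) set). 1 / (2 * L))"
      unfolding box_coeff_def using L by (intro prod_mono) (simp add: kernel_coeff_bounds divide_right_mono)
    then show "box_coeff L n k \<le> w" by (simp add: w_def)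
  qed
  have lim: "(\<lambda>n. a i n) \<longlonglongrightarrow> w * I (freq_enum i)" for i
  proof -
    have "(\<lambda>n. box_coeff L (Suc n) (freq_enum i :: 'n + 'n \<Rightarrow> int)) \<longlonglongrightarrow> (\<Prod>j\<in>(UNIV :: ('n + 'n) set). 1 / (2 * L))"
      unfolding box_coeff_def using L
      by (intro tendsto_prod tendsto_divide LIMSEQ_Suc[OF kernel_coeff_tendsto] tendsto_const) auto
    then show ?thesis unfolding a_def by (intro tendsto_mult tendsto_const) (simp add: w_def)
  qed
  have "norm (a i n) \<le> w * (C * (1 / ?x i ^ ?N))" for i n
    unfolding a_def real_norm_def abs_mult using box I w by (intro mult_mono) auto
  then have bd: "eventually (\<lambda>(k, n). norm (a k n) \<le> w * (C * (1 / ?x k ^ ?N))) (at_top \<times>\<^sub>F sequentially)"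
    by (intro always_eventually) auto
  have sM: "summable (\<lambda>i. w * (C * (1 / ?x i ^ ?N)))" by (intro summable_mult summable_freq L)
  from tannerys_theorem[OF lim bd sM]
  have T: "summable (\<lambda>i. norm (w * I (freq_enum i)))" "(\<lambda>n. \<Sum>i. a i n) \<longlonglongrightarrow> (\<Sum>i. w * I (freq_enum i))"
    by auto
  have "(\<Sum>i. a i n) = (\<Sum>k\<in>PiE UNIV (\<lambda>_. {- int (Suc n)..int (Suc n)}). box_coeff L (Suc n) k * I k)" for n
  proof -
    define P where "P = PiE UNIV (\<lambda>_ :: 'n + 'n. {- int (Suc n)..int (Suc n)})"
    have fin: "finite P" unfolding P_def by (intro finite_PiE) auto
    define J where "J = freq_enum -` P"
    have bJ: "bij_betw freq_enum J P"
      using bij_freq_enum unfolding bij_betw_def J_def by (auto simp: inj_on_def image_vimage_eq)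
    then have "finite J" using fin bij_betw_finite by blast
    then have "(\<Sum>i. a i n) = (\<Sum>i\<in>J. a i n)"
    proof (rule suminf_finite)
      fix i assume "i \<notin> J"
      then obtain j where j: "(freq_enum i :: 'n + 'n \<Rightarrow> int) j \<notin> {- int (Suc n)..int (Suc n)}"
        by (auto simp: J_def P_def PiE_iff simp del: atLeastAtMost_iff)
      then have "kernel_coeff (Suc n) ((freq_enum i :: 'n + 'n \<Rightarrow> int) j) = 0" by (auto simp: kernel_coeff_def)
      then have "box_coeff L (Suc n) (freq_enum i :: 'n + 'n \<Rightarrow> int) = 0" unfolding box_coeff_def by (intro prod_zero) auto
      then show "a i n = 0" by (simp add: a_def)
    qed
    also have "\<dots> = (\<Sum>k\<in>P. box_coeff L (Suc n) k * I k)"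
      unfolding a_def by (rule sum.reindex_bij_betw[OF bJ])
    finally show ?thesis unfolding P_def .
  qed
  then have "(\<lambda>n. \<Sum>i. a i n) \<longlonglongrightarrow> \<psi> y"
    using fejer_sum_tendsto[OF R \<psi> y] unfolding I_def L_def by simp
  then have "(\<Sum>i. w * I (freq_enum i)) = \<psi> y" using T(2) LIMSEQ_unique by blast
  then show ?thesis using summable_sums[OF summable_norm_cancel[OF T(1)]]
    unfolding w_def I_def by simp
qed

text \<open>The addition formula separates the variables in cos (\<zeta> \<bullet> x - \<zeta>
  \<bullet> y); the sine part is again a cosine, with phase -pi/2, hence the two series. The larger
  cube for y is where the cutoff of the representation lives.\<close>

lemma fourier_series_trig_sum:
  fixes \<psi> :: "'n::finite phase \<Rightarrow> real"
  assumes R: "R > 0" and \<psi>: "test_on (cube R) \<psi>"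
  defines "\<zeta> \<equiv> (\<lambda>i. freq (4 * R) (freq_enum i))" and "w \<equiv> (1 / (2 * (4 * R))) ^ CARD('n + 'n)"
  defines "\<alpha> \<equiv> (\<lambda>c i. w * (LINT x|lborel. \<psi> x * cos (\<zeta> i \<bullet> x + c)))"
  shows "rapid (\<alpha> c) \<zeta>"
    and "y \<in> cube (2 * R) \<Longrightarrow>
      \<psi> y = trig_sum (\<alpha> 0) \<zeta> (\<lambda>_. 0) y + trig_sum (\<alpha> (- (pi/2))) \<zeta> (\<lambda>_. - (pi/2)) y"
proof -
  have L: "4 * R > 0" using R by simp
  have w: "w \<ge> 0" using R by (simp add: w_def)
  have rap: "rapid (\<alpha> c) \<zeta>" for c
    unfolding \<zeta>_def
  proof (rule rapid_freqI[OF L])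
    fix n
    obtain C where C: "\<And>\<xi> c. \<bar>LINT z|lborel. \<psi> z * cos (\<xi> \<bullet> z + c)\<bar> * (1 + norm \<xi>) ^ n \<le> C"
      using integral_cos_decay[OF compact_cube \<psi>] by blast
    have "\<bar>\<alpha> c i\<bar> * (1 + norm (\<zeta> i)) ^ n \<le> w * C" for i
      using mult_left_mono[OF C[of "\<zeta> i" c] w] w by (simp add: \<alpha>_def abs_mult mult.assoc)
    then show "\<exists>C. \<forall>i. \<bar>\<alpha> c i\<bar> * (1 + norm (freq (4 * R) (freq_enum i) :: 'n phase)) ^ n \<le> C"
      unfolding \<zeta>_def by blast
  qed
  show "rapid (\<alpha> c) \<zeta>" by (rule rap)
  assume y: "y \<in> cube (2 * R)"
  have "w * (LINT x|lborel. \<psi> x * cos (\<zeta> i \<bullet> x + - (\<zeta> i \<bullet> y))) =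
      \<alpha> 0 i * cos (\<zeta> i \<bullet> y + 0) + \<alpha> (- (pi/2)) i * cos (\<zeta> i \<bullet> y + - (pi/2))" for i
  proof -
    have cs: "cos (t + - (pi/2)) = sin t" for t by (simp add: cos_diff)
    have "\<psi> x * cos (\<zeta> i \<bullet> x + - (\<zeta> i \<bullet> y)) =
        \<psi> x * cos (\<zeta> i \<bullet> x + 0) * cos (\<zeta> i \<bullet> y) + \<psi> x * cos (\<zeta> i \<bullet> x + - (pi/2)) * sin (\<zeta> i \<bullet> y)" for x
      unfolding cs by (simp add: cos_diff algebra_simps)
    then have "(LINT x|lborel. \<psi> x * cos (\<zeta> i \<bullet> x + - (\<zeta> i \<bullet> y))) =
        (LINT x|lborel. (\<psi> x * cos (\<zeta> i \<bullet> x + 0) * cos (\<zeta> i \<bullet> y) + \<psi> x * cos (\<zeta> i \<bullet> x + - (pi/2)) * sin (\<zeta> i \<bullet> y)))"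
      by (simp only:)
    also have "\<dots> = (LINT x|lborel. \<psi> x * cos (\<zeta> i \<bullet> x + 0)) * cos (\<zeta> i \<bullet> y)
        + (LINT x|lborel. \<psi> x * cos (\<zeta> i \<bullet> x + - (pi/2))) * sin (\<zeta> i \<bullet> y)"
    proof -
      have i: "integrable lborel (\<lambda>x. \<psi> x * cos (\<zeta> i \<bullet> x + c))" for c
        by (rule integrable_test_on[OF compact_cube test_on_mult_cos[OF \<psi>]])
      show ?thesis
        by (subst Bochner_Integration.integral_add) (intro integrable_mult_left i, intro integrable_mult_left i, simp only: integral_mult_left_zero)
    qed
    finally have e: "(LINT x|lborel. \<psi> x * cos (\<zeta> i \<bullet> x + - (\<zeta> i \<bullet> y))) =
        (LINT x|lborel. \<psi> x * cos (\<zeta> i \<bullet> x + 0)) * cos (\<zeta> i \<bullet> y)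
        + (LINT x|lborel. \<psi> x * cos (\<zeta> i \<bullet> x + - (pi/2))) * sin (\<zeta> i \<bullet> y)" .
    show ?thesis unfolding e cs \<alpha>_def by (simp add: algebra_simps)
  qed
  then have "(\<lambda>i. \<alpha> 0 i * cos (\<zeta> i \<bullet> y + 0) + \<alpha> (- (pi/2)) i * cos (\<zeta> i \<bullet> y + - (pi/2))) sums \<psi> y"
    using fourier_inversion[OF R \<psi> y] unfolding w_def \<zeta>_def by simp
  moreover have "(\<lambda>i. \<alpha> 0 i * cos (\<zeta> i \<bullet> y + 0) + \<alpha> (- (pi/2)) i * cos (\<zeta> i \<bullet> y + - (pi/2))) sums
      (trig_sum (\<alpha> 0) \<zeta> (\<lambda>_. 0) y + trig_sum (\<alpha> (- (pi/2))) \<zeta> (\<lambda>_. - (pi/2)) y)"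
    unfolding trig_sum_def by (intro sums_add summable_sums summable_trig rap)
  ultimately show "\<psi> y = trig_sum (\<alpha> 0) \<zeta> (\<lambda>_. 0) y + trig_sum (\<alpha> (- (pi/2))) \<zeta> (\<lambda>_. - (pi/2)) y"
    by (rule sums_unique2)
qed

subsection \<open>Hypoellipticity\<close>

text \<open>A form of Parseval's identity. Writing \<phi> = \<sigma> \<phi> and expanding the second
  factor, \<open>u \<phi>\<close> becomes the sum of Fourier coefficients of \<phi> times transforms
  of \<open>u\<close> with amplitude \<sigma>; expanding g, whose coefficients are those transforms,
  in the integral of g \<phi> gives the same sum.\<close>

lemma local_representation:
  fixes u :: "('n::finite phase \<Rightarrow> real) \<Rightarrow> real"
  assumes u: "distribution u" and R: "R > 0"
    and decay: "\<And>a n. test_on (cube (2 * R)) a \<Longrightarrow> \<exists>C\<ge>0. \<forall>\<xi> c. \<bar>osc u a \<xi> c\<bar> * (1 + norm \<xi>) ^ n \<le> C"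
  shows "\<exists>g. smooth_fun g \<and> (\<forall>\<phi>. test_on (cube R) \<phi> \<longrightarrow> u \<phi> = (LINT z|lborel. g z * \<phi> z))"
proof -
  have L: "4 * R > 0" using R by simp
  obtain \<sigma> :: "'n phase \<Rightarrow> real" where \<sigma>: "test_on (cube (2 * R)) \<sigma>" "\<And>z. z \<in> cube R \<Longrightarrow> \<sigma> z = 1"
    using cutoff_exists[OF R] by blast
  define \<zeta> :: "nat \<Rightarrow> 'n phase" where "\<zeta> = (\<lambda>i. freq (4 * R) (freq_enum i))"
  define w where "w = (1 / (2 * (4 * R))) ^ CARD('n + 'n)"
  have w: "w \<ge> 0" using R by (simp add: w_def)
  define A where "A c i = w * osc u \<sigma> (\<zeta> i) c" for c i
  have rA: "rapid (A c) \<zeta>" for c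
    unfolding \<zeta>_def
  proof (rule rapid_freqI[OF L])
    fix n
    obtain C where C: "\<And>\<xi> c. \<bar>osc u \<sigma> \<xi> c\<bar> * (1 + norm \<xi>) ^ n \<le> C" using decay[OF \<sigma>(1)] by blast
    have "\<bar>A c i\<bar> * (1 + norm (\<zeta> i)) ^ n \<le> w * C" for i
      using mult_left_mono[OF C[of "\<zeta> i" c] w] w by (simp add: A_def abs_mult mult.assoc)
    then show "\<exists>C. \<forall>i. \<bar>A c i\<bar> * (1 + norm (freq (4 * R) (freq_enum i) :: 'n phase)) ^ n \<le> C"
      unfolding \<zeta>_def by blast
  qed
  define g where "g z = trig_sum (A 0) \<zeta> (\<lambda>_. 0) z + trig_sum (A (- (pi/2))) \<zeta> (\<lambda>_. - (pi/2)) z" for z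
  have sg: "smooth_fun g" unfolding g_def by (intro smooth_add smooth_trig_sum rA)
  have "u \<phi> = (LINT z|lborel. g z * \<phi> z)" if \<phi>: "test_on (cube R) \<phi>" for \<phi>
  proof -
    define \<alpha> where "\<alpha> c i = w * (LINT x|lborel. \<phi> x * cos (\<zeta> i \<bullet> x + c))" for c i
    have r\<alpha>: "rapid (\<alpha> c) \<zeta>" for c
      using fourier_series_trig_sum(1)[OF R \<phi>, of c] unfolding \<alpha>_def \<zeta>_def w_def .
    have inv: "\<phi> y = trig_sum (\<alpha> 0) \<zeta> (\<lambda>_. 0) y + trig_sum (\<alpha> (- (pi/2))) \<zeta> (\<lambda>_. - (pi/2)) y"
      if "y \<in> cube (2 * R)" for y
      using fourier_series_trig_sum(2)[OF R \<phi> that] unfolding \<alpha>_def \<zeta>_def w_def .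
    have \<phi>\<sigma>: "\<phi> = (\<lambda>z. \<sigma> z * trig_sum (\<alpha> 0) \<zeta> (\<lambda>_. 0) z + \<sigma> z * trig_sum (\<alpha> (- (pi/2))) \<zeta> (\<lambda>_. - (pi/2)) z)"
    proof
      fix z
      have "\<phi> z = \<sigma> z * \<phi> z" using \<sigma>(2)[of z] test_onD(2)[OF \<phi>, of z] by (cases "z \<in> cube R") auto
      also have "\<dots> = \<sigma> z * (trig_sum (\<alpha> 0) \<zeta> (\<lambda>_. 0) z + trig_sum (\<alpha> (- (pi/2))) \<zeta> (\<lambda>_. - (pi/2)) z)"
        using inv[of z] test_onD(2)[OF \<sigma>(1), of z] by (cases "z \<in> cube (2 * R)") auto
      finally show "\<phi> z = \<sigma> z * trig_sum (\<alpha> 0) \<zeta> (\<lambda>_. 0) z + \<sigma> z * trig_sum (\<alpha> (- (pi/2))) \<zeta> (\<lambda>_. - (pi/2)) z"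
        by (simp only: distrib_left)
    qed
    have t1: "test_on (cube (2 * R)) (\<lambda>z. \<sigma> z * trig_sum (\<alpha> c) \<zeta> d z)" for c d
      by (rule test_on_mult[OF \<sigma>(1) smooth_trig_sum[OF r\<alpha>]])
    let ?J = "\<lambda>\<phi>. LINT z|lborel. \<phi> (z :: 'n phase)"
    have t2: "integrable lborel (\<lambda>z. \<phi> z * trig_sum (A c) \<zeta> d z)" for c d
      by (rule integrable_test_on[OF compact_cube test_on_mult[OF \<phi> smooth_trig_sum[OF rA]]])
    have same: "u (\<lambda>z. \<sigma> z * trig_sum (\<alpha> c) \<zeta> (\<lambda>_. c) z) = ?J (\<lambda>z. \<phi> z * trig_sum (A c) \<zeta> (\<lambda>_. c) z)" for c
    proof -
      have s1: "(\<lambda>i. \<alpha> c i * osc u \<sigma> (\<zeta> i) c) sums u (\<lambda>z. \<sigma> z * trig_sum (\<alpha> c) \<zeta> (\<lambda>_. c) z)"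
        by (rule distribution_trig_sum[OF u compact_cube \<sigma>(1) r\<alpha>])
      have s2: "(\<lambda>i. A c i * osc ?J \<phi> (\<zeta> i) c) sums ?J (\<lambda>z. \<phi> z * trig_sum (A c) \<zeta> (\<lambda>_. c) z)"
        by (rule distribution_trig_sum[OF distribution_integral compact_cube \<phi> rA])
      have eq: "(\<lambda>i. A c i * osc ?J \<phi> (\<zeta> i) c) = (\<lambda>i. \<alpha> c i * osc u \<sigma> (\<zeta> i) c)"
        by (simp add: A_def \<alpha>_def osc_def[of ?J] mult_ac)
      show ?thesis using s2 unfolding eq by (rule sums_unique2[OF s1])
    qed
    have "u \<phi> = u (\<lambda>z. \<sigma> z * trig_sum (\<alpha> 0) \<zeta> (\<lambda>_. 0) z) + u (\<lambda>z. \<sigma> z * trig_sum (\<alpha> (- (pi/2))) \<zeta> (\<lambda>_. - (pi/2)) z)"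
      by (subst \<phi>\<sigma>) (rule dist_add[OF u compact_cube t1 t1])
    also have "\<dots> = ?J (\<lambda>z. \<phi> z * trig_sum (A 0) \<zeta> (\<lambda>_. 0) z + \<phi> z * trig_sum (A (- (pi/2))) \<zeta> (\<lambda>_. - (pi/2)) z)"
      unfolding same by (rule Bochner_Integration.integral_add[OF t2 t2, symmetric])
    also have "\<dots> = (LINT z|lborel. g z * \<phi> z)"
      by (rule Bochner_Integration.integral_cong) (simp_all only: g_def algebra_simps)
    finally show ?thesis .
  qed
  then show ?thesis using sg by blast
qed

section \<open>Gluing local densities\<close>

lemma smooth_fun_local:
  fixes g :: "'n::finite phase \<Rightarrow> real"
  assumes "\<And>z. \<exists>S G. open S \<and> z \<in> S \<and> smooth_fun G \<and> (\<forall>x\<in>S. g x = G x)"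
  shows "smooth_fun g"
  unfolding smooth_fun_def
proof (intro allI conjI)
  fix ks :: "('n + 'n) list"
  have loc: "\<exists>S G. open S \<and> z \<in> S \<and> smooth_fun G \<and> (\<forall>x\<in>S. iterpd ks g x = iterpd ks G x)" for z
  proof -
    obtain S G where S: "open S" "z \<in> S" "smooth_fun G" "\<forall>x\<in>S. g x = G x" using assms[of z] by blast
    have "\<forall>x\<in>S. iterpd ks g x = iterpd ks G x" using S(4) by (intro ballI iterpd_cong_open[OF S(1)]) auto
    with S show ?thesis by (intro exI[of _ S] exI[of _ G]) simp
  qed
  show "continuous_on UNIV (iterpd ks g)"
  proof (intro continuous_at_imp_continuous_on ballI)
    fix z :: "'n phase"
    obtain S G where S: "open S" "z \<in> S" "smooth_fun G" "\<forall>x\<in>S. iterpd ks g x = iterpd ks G x" using loc by blast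
    have "continuous_on S (iterpd ks G)"
      by (rule continuous_on_subset[OF smooth_continuous[OF smooth_iterpd[OF S(3)]]]) simp
    then have "continuous_on S (iterpd ks g)" by (rule continuous_on_eq) (use S(4) in auto)
    then show "isCont (iterpd ks g) z" using S(2) unfolding continuous_on_eq_continuous_at[OF S(1)] by blast
  qed
  fix k and z :: "'n phase"
  obtain S G where S: "open S" "z \<in> S" "smooth_fun G" "\<forall>x\<in>S. iterpd ks g x = iterpd ks G x" using loc by blast
  have "((\<lambda>t. iterpd ks G (z + t *\<^sub>R axis k 1)) has_real_derivative pd k (iterpd ks G) z) (at 0)"
    using smooth_line_derivative[OF smooth_iterpd[OF S(3)], where x = z and k = k and t = 0] by simp
  moreover have "open ((\<lambda>t. z + t *\<^sub>R axis k 1) -` S)"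
    by (intro open_vimage S continuous_intros)
  ultimately have "((\<lambda>t. iterpd ks g (z + t *\<^sub>R axis k 1)) has_real_derivative pd k (iterpd ks G) z) (at 0)"
    by (rule has_field_derivative_transform_within_open) (use S in auto)
  then show "(\<lambda>t. iterpd ks g (z + t *\<^sub>R axis k 1)) field_differentiable at 0"
    by (auto simp: field_differentiable_def)
qed

lemma cube_mono: "r \<le> s \<Longrightarrow> z \<in> cube r \<Longrightarrow> z \<in> cube s"
  by (auto simp: cube_def intro: order_trans)

lemma in_cube_norm: "norm z \<le> r \<Longrightarrow> z \<in> cube r"
  by (auto simp: cube_def intro: order_trans[OF component_le_norm_cart])

text \<open>A partition of unity sums the local densities into a global one, which avoids comparing
  the densities belonging to different cubes.\<close>

lemma smooth_distributionI:
  fixes u :: "('n::finite phase \<Rightarrow> real) \<Rightarrow> real"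
  assumes u: "distribution u"
    and loc: "\<And>R. R > 0 \<Longrightarrow> \<exists>g. smooth_fun g \<and> (\<forall>\<phi>. test_on (cube R) \<phi> \<longrightarrow> u \<phi> = (LINT z|lborel. g z * \<phi> z))"
  shows "smooth_distribution u"
proof -
  have "\<exists>f. test_on (cube (2 * real (N + 1)) :: 'n phase set) f \<and> (\<forall>z\<in>cube (real (N + 1)). f z = 1)" for N
    by (rule cutoff_exists) simp
  from choice[OF allI[OF this]] obtain c :: "nat \<Rightarrow> 'n phase \<Rightarrow> real" where
    "\<forall>N. test_on (cube (2 * real (N + 1))) (c N) \<and> (\<forall>z\<in>cube (real (N + 1)). c N z = 1)" ..
  then have c: "\<And>N. test_on (cube (2 * real (N + 1))) (c N)" "\<And>N z. z \<in> cube (real (N + 1)) \<Longrightarrow> c N z = 1"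
    by blast+
  have "\<exists>g. smooth_fun g \<and> (\<forall>\<phi>. test_on (cube (2 * real (N + 1))) \<phi> \<longrightarrow> u \<phi> = (LINT z|lborel. g z * \<phi> z))" for N
    by (rule loc) simp
  from choice[OF allI[OF this]] obtain g where
    "\<forall>N. smooth_fun (g N) \<and> (\<forall>\<phi>. test_on (cube (2 * real (N + 1))) \<phi> \<longrightarrow> u \<phi> = (LINT z|lborel. g N z * \<phi> z))" ..
  then have g: "\<And>N. smooth_fun (g N)"
    "\<And>N \<phi>. test_on (cube (2 * real (N + 1))) \<phi> \<Longrightarrow> u \<phi> = (LINT z|lborel. g N z * \<phi> z)"
    by blast+
  \<comment> \<open>Differences of successive cutoffs: they telescope to \<open>c m\<close>, and
    from index m + 1 on they vanish on the cube of size m, so the sum that defines f is locally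
    finite.\<close>
  define \<eta> where "\<eta> N z = (case N of 0 \<Rightarrow> c 0 z | Suc M \<Rightarrow> c (Suc M) z - c M z)" for N z
  have \<eta>: "test_on (cube (2 * real (N + 1))) (\<eta> N)" for N
  proof (cases N)
    case 0
    then show ?thesis using c(1)[of 0] by (simp add: \<eta>_def[abs_def])
  next
    case (Suc M)
    have "cube (2 * real (M + 1)) \<subseteq> (cube (2 * real (Suc M + 1)) :: 'n phase set)"
      by (intro subsetI) (rule cube_mono, auto)
    then have "test_on (cube (2 * real (Suc M + 1))) (\<lambda>z. c (Suc M) z - c M z)"
      by (intro test_on_diff c(1) test_on_mono[OF c(1)])
    then show ?thesis using Suc by (simp add: \<eta>_def[abs_def])
  qed
  have \<eta>0: "\<eta> N z = 0" if z: "z \<in> cube (real m)" and mN: "m < N" for N m z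
  proof -
    obtain M where M: "N = Suc M" "m \<le> M" using mN by (cases N) auto
    have "z \<in> cube (real (M + 1))" "z \<in> cube (real (Suc M + 1))"
      by (rule cube_mono[OF _ z], use M(2) in simp)+
    then show ?thesis using c(2) by (simp add: \<eta>_def M)
  qed
  have \<eta>_sum: "(\<Sum>N\<le>m. \<eta> N z) = c m z" for m z
    by (induction m) (auto simp: \<eta>_def)
  define G where "G m z = (\<Sum>N\<le>m. g N z * \<eta> N z)" for m z
  have smG: "smooth_fun (G m)" for m
    unfolding G_def using \<eta> g(1) by (intro smooth_sum smooth_mult) (auto simp: test_on_def)
  have G_eq: "G m' z = G m z" if "z \<in> cube (real m)" "m \<le> m'" for z m m'
    unfolding G_def using that \<eta>0[OF that(1)] by (intro sum.mono_neutral_right) auto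
  define f where "f z = G (nat \<lceil>norm z\<rceil>) z" for z
  have in_cube: "z \<in> cube (real (nat \<lceil>norm z\<rceil>))" for z :: "'n phase"
    by (rule in_cube_norm[OF real_nat_ceiling_ge])
  have f_eq: "f z = G m z" if "z \<in> cube (real m)" for z m
  proof -
    have "G (max m (nat \<lceil>norm z\<rceil>)) z = G m z" by (rule G_eq[OF that]) simp
    moreover have "G (max m (nat \<lceil>norm z\<rceil>)) z = f z" unfolding f_def by (rule G_eq[OF in_cube]) simp
    ultimately show ?thesis by simp
  qed
  have "smooth_fun f"
  proof (rule smooth_fun_local)
    fix z :: "'n phase"
    obtain m :: nat where m: "norm z < real m" using reals_Archimedean2 by blast
    have "x \<in> cube (real m)" if "x \<in> ball 0 (real m)" for x :: "'n phase"
      by (rule in_cube_norm) (use that in simp)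
    then show "\<exists>S Ga. open S \<and> z \<in> S \<and> smooth_fun Ga \<and> (\<forall>x\<in>S. f x = Ga x)"
      using m f_eq smG by (intro exI[of _ "ball 0 (real m)"] exI[of _ "G m"]) auto
  qed
  moreover have "u \<phi> = (LINT z|lborel. f z * \<phi> z)" if \<phi>: "test_fun \<phi>" for \<phi>
  proof -
    have "bounded (closure {z. \<phi> z \<noteq> 0})" using \<phi> by (simp add: test_fun_def compact_imp_bounded)
    then obtain B where B: "\<And>z. z \<in> closure {z. \<phi> z \<noteq> 0} \<Longrightarrow> norm z \<le> B" by (auto simp: bounded_iff)
    obtain m :: nat where m: "B \<le> real m" using real_arch_simple by blast
    have sub: "closure {z. \<phi> z \<noteq> 0} \<subseteq> cube (real m)"
    proof
      fix z assume "z \<in> closure {z. \<phi> z \<noteq> 0}"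
      then have "norm z \<le> real m" using B m by (meson order_trans)
      then show "z \<in> cube (real m)" by (rule in_cube_norm)
    qed
    have t: "test_on (cube (real m)) \<phi>" by (rule test_on_mono[OF test_imp_test_on[OF \<phi>] sub])
    have sm\<phi>: "smooth_fun \<phi>" using t by (simp add: test_on_def)
    have supp: "\<phi> z = (\<Sum>N\<le>m. \<eta> N z * \<phi> z)" for z
    proof (cases "z \<in> cube (real m)")
      case True
      then have "z \<in> cube (real (m + 1))" by (rule cube_mono[rotated]) simp
      then show ?thesis using c(2) by (simp add: sum_distrib_right[symmetric] \<eta>_sum)
    qed (use t in \<open>simp add: test_on_def\<close>)
    have tN: "test_on (cube (2 * real (N + 1))) (\<lambda>z. \<eta> N z * \<phi> z)" for N
      by (rule test_on_mult[OF \<eta> sm\<phi>])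
    have tN': "test_on (cube (real m)) (\<lambda>z. \<eta> N z * \<phi> z)" for N
      by (rule test_on_mult'[OF t]) (use \<eta>[of N] in \<open>simp add: test_on_def\<close>)
    have "u \<phi> = u (\<lambda>z. \<Sum>N\<le>m. \<eta> N z * \<phi> z)" using supp by (intro arg_cong[of _ _ u]) auto
    also have "\<dots> = (\<Sum>N\<le>m. u (\<lambda>z. \<eta> N z * \<phi> z))" by (rule dist_sum[OF u compact_cube tN'])
    also have "\<dots> = (\<Sum>N\<le>m. (LINT z|lborel. g N z * (\<eta> N z * \<phi> z)))" by (intro sum.cong refl g(2) tN)
    also have "\<dots> = (LINT z|lborel. (\<Sum>N\<le>m. g N z * (\<eta> N z * \<phi> z)))"
      by (rule Bochner_Integration.integral_sum[symmetric])
        (rule integrable_test_on[OF compact_cube test_on_mult'[OF tN' g(1)]])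
    also have "\<dots> = (LINT z|lborel. f z * \<phi> z)"
    proof (rule Bochner_Integration.integral_cong[OF refl])
      fix z
      show "(\<Sum>N\<le>m. g N z * (\<eta> N z * \<phi> z)) = f z * \<phi> z"
      proof (cases "z \<in> cube (real m)")
        case True
        then show ?thesis by (simp add: f_eq G_def sum_distrib_right mult.assoc)
      qed (use t in \<open>simp add: test_on_def\<close>)
    qed
    finally show ?thesis .
  qed
  ultimately show ?thesis unfolding smooth_distribution_def by blast
qed

text \<open>The hypothesis is Kalman's observability condition for the drift matrix and the noisy
  momenta; for linear drift and constant diffusion it amounts to Hormander's bracket
  condition.\<close>

theorem hypoelliptic_FP_if_observable:
  fixes M :: "real ^ ('n::finite + 'n) ^ ('n + 'n)"
  assumes g: "\<And>i. \<gamma> i * \<theta> i \<ge> 0"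
    and obs: "\<And>\<xi>. \<xi> \<noteq> 0 \<Longrightarrow> \<exists>j i. \<gamma> i * \<theta> i > 0 \<and> (((*v) M ^^ j) \<xi>) $ Inl i \<noteq> 0"
  shows "hypoelliptic_FP M \<gamma> \<theta>"
  unfolding hypoelliptic_FP_def
proof (intro allI impI)
  fix u :: "('n phase \<Rightarrow> real) \<Rightarrow> real"
  assume u: "distribution u" and "smooth_distribution (FP_dist M \<gamma> \<theta> u)"
  then obtain f where f: "smooth_fun f"
    "\<And>\<phi>. test_fun \<phi> \<Longrightarrow> FP_dist M \<gamma> \<theta> u \<phi> = (LINT z|lborel. f z * \<phi> z)"
    unfolding smooth_distribution_def by blast
  show "smooth_distribution u"
  proof (rule smooth_distributionI[OF u local_representation[OF u]])
    fix R :: real and a :: "'n phase \<Rightarrow> real" and n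
    assume a: "test_on (cube (2 * R)) a"
    show "\<exists>C\<ge>0. \<forall>\<xi> c. \<bar>osc u a \<xi> c\<bar> * (1 + norm \<xi>) ^ n \<le> C"
      by (rule osc_rapid_decay[OF u compact_cube f(1) _ g _ a]) (fact f(2), fact obs)
  qed
qed

subsection \<open>The chain\<close>

lemma pentadiagonal_no_eigenvector:
  fixes x :: "nat \<Rightarrow> real"
  assumes N: "N \<ge> 2" and \<omega>: "-1/4 < \<omega>" "\<omega> < 1/4" and \<mu>: "0 \<le> \<mu>" "\<mu> \<le> 4"
    and row: "\<And>k. k < N \<Longrightarrow>
      (if k + 1 < N then x k - x (k + 1) else 0) + (if 1 \<le> k then x k - x (k - 1) else 0)
      + \<omega> * ((if k + 2 < N then x k - x (k + 2) else 0) + (if 2 \<le> k then x k - x (k - 2) else 0)) = \<mu> * x k"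
    and ends: "x 0 = 0" "x (N - 1) = 0"
  shows "k < N \<Longrightarrow> x k = 0"
proof -
  \<comment> \<open>The degenerate cases are those in which factoring is impossible or pointless:
    for N = 2 every site is an end, for N = 3 row 0 gives the middle value, and for \<omega> = 0 the
    rows already form a three-term recursion.\<close>
  consider "N = 2" | "N = 3" | "N \<ge> 4" "\<omega> = 0" | "N \<ge> 4" "\<omega> \<noteq> 0" using N by linarith
  then show "k < N \<Longrightarrow> x k = 0"
  proof cases
    case 1
    then show "k < N \<Longrightarrow> x k = 0" using ends by (cases "k = 0") (auto simp: less_2_cases_iff)
  next
    case 2
    then have "x 1 = 0" using row[of 0] ends by (simp add: numeral_2_eq_2)
    moreover assume "k < N"
    then have "k = 0 \<or> k = 1 \<or> k = 2" using 2 by linarith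
    ultimately show "x k = 0" using ends 2 by (auto simp: numeral_2_eq_2)
  next
    case 3
    have "Suc k < N \<Longrightarrow> x k = 0 \<and> x (Suc k) = 0" for k
    proof (induction k)
      case 0
      then show ?case using row[of 0] ends 3 by simp
    next
      case (Suc k)
      then show ?case using row[of "Suc k"] 3 by simp
    qed
    moreover assume "k < N"
    ultimately show "x k = 0" using 3(1) ends by (cases "k = N - 1") auto
  next
    case 4
    \<comment> \<open>Extension of \<open>x\<close> that is even about both ends; only two sites beyond each end matter.\<close>
    define e where "e n = (if n < 0 then x (nat (- n)) else if n \<ge> int N then x (nat (2 * (int N - 1) - n)) else x (nat n))"
      for n :: int
    \<comment> \<open>In the interior this is the row itself. At an end it is twice the row. Next to
      an end the reflected second neighbour is the site itself, so the absent bond contributes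
      nothing.\<close>
    have eq: "(2 + 2 * \<omega> - \<mu>) * e n - (e (n - 1) + e (n + 1)) - \<omega> * (e (n - 2) + e (n + 2)) = 0"
      if n: "0 \<le> n" "n < int N" for n
    proof -
      obtain k where k: "n = int k" "k < N" using n nonneg_int_cases by auto
      consider "k = 0" | "k = 1" | "2 \<le> k" "k + 2 < N" | "k = N - 2" "2 \<le> k" | "k = N - 1" "2 \<le> k" using k 4 by linarith
      then show ?thesis
      proof cases
        case 1
        have "e n = 0" "e (n - 1) = x 1" "e (n + 1) = x 1" "e (n - 2) = x 2" "e (n + 2) = x 2"
          using 1 k 4(1) ends by (auto simp: e_def)
        moreover have "- x 1 - \<omega> * x 2 = 0" using row[of 0] 4(1) ends by (simp add: numeral_2_eq_2)
        ultimately show ?thesis by (simp add: algebra_simps)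
      next
        case 2
        have "e n = x 1" "e (n - 1) = 0" "e (n + 1) = x 2" "e (n - 2) = x 1" "e (n + 2) = x 3"
          using 2 k 4(1) ends by (auto simp: e_def numeral_2_eq_2 numeral_3_eq_3)
        moreover have "(x 1 - x 2) + x 1 + \<omega> * (x 1 - x 3) = \<mu> * x 1"
          using row[of 1] 4(1) ends by (simp add: numeral_2_eq_2 numeral_3_eq_3)
        ultimately show ?thesis by (simp add: algebra_simps)
      next
        case 3
        have "e n = x k" "e (n - 1) = x (k - 1)" "e (n + 1) = x (k + 1)" "e (n - 2) = x (k - 2)" "e (n + 2) = x (k + 2)"
          using 3 k by (auto simp: e_def nat_diff_distrib nat_add_distrib)
        then show ?thesis using row[of k] 3 k by (simp add: algebra_simps)
      next
        case 4
        have es: "e n = x k" "e (n - 1) = x (k - 1)" "e (n + 1) = 0" "e (n - 2) = x (k - 2)" "e (n + 2) = x k"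
          using 4 k \<open>N \<ge> 4\<close> ends by (auto simp: e_def nat_diff_distrib nat_add_distrib nat_less_iff intro!: arg_cong[of _ _ x])
        have "x (k + 1) = 0" "k + 1 < N" "\<not> k + 2 < N" using 4 \<open>N \<ge> 4\<close> ends by (auto simp: Suc_diff_Suc numeral_2_eq_2)
        then have "x k + (x k - x (k - 1)) + \<omega> * (x k - x (k - 2)) = \<mu> * x k" using row[OF k(2)] 4(2) by simp
        then show ?thesis unfolding es by (simp add: algebra_simps)
      next
        case 5
        have es: "e n = 0" "e (n - 1) = x (k - 1)" "e (n + 1) = x (k - 1)" "e (n - 2) = x (k - 2)" "e (n + 2) = x (k - 2)"
          using 5 k \<open>N \<ge> 4\<close> ends by (auto simp: e_def nat_diff_distrib nat_add_distrib nat_less_iff intro!: arg_cong[of _ _ x])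
        have r: "- x (k - 1) - \<omega> * x (k - 2) = 0" using row[of k] 5 k ends by simp
        show ?thesis unfolding es distrib_left using r by linarith
      qed
    qed
    define r where "r = 1 / \<omega>"
    have r\<omega>: "\<omega> * r = 1" using 4(2) by (simp add: r_def)
    define p where "p = (2 + 4 * \<omega> - \<mu>) * r"
    define disc where "disc = r\<^sup>2 + 4 * p"
    \<comment> \<open>Two forms for the two signs of \<omega>: for r > 4 the first is nonnegative by
      \<mu> \<le> 4, for r < -4 the second by 0 \<le> \<mu>; the constants cancel because \<omega> r
      = 1. As |r| > 4, the root whose radical has the sign of -r exceeds 2 in absolute
      value.\<close>
    have disc: "disc = (r - 4)\<^sup>2 + (16 - 4 * \<mu>) * r + 16 * (\<omega> * r) - 16"
      "disc = (r + 4)\<^sup>2 - 4 * \<mu> * r + 16 * (\<omega> * r) - 16"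
      by (simp_all add: disc_def p_def power2_eq_square algebra_simps)
    \<comment> \<open>With \<open>S e n = e (n + 1) + e (n - 1)\<close> the recursion reads \<open>(S - s) (S - t) e = 0\<close>.\<close>
    have "\<exists>s t. s + t = - r \<and> s * t = - p \<and> \<bar>t\<bar> > 2"
    proof (cases "\<omega> > 0")
      case True
      have r4: "r > 4" using True \<omega> by (simp add: r_def field_simps)
      then have "disc \<ge> 0" unfolding disc(1) r\<omega> using \<mu> by simp
      then have sq: "sqrt disc * sqrt disc = disc" "sqrt disc \<ge> 0" by simp_all
      have "((- r + sqrt disc) / 2) * ((- r - sqrt disc) / 2) = (r * r - sqrt disc * sqrt disc) / 4"
        by (simp add: algebra_simps)
      then have "((- r + sqrt disc) / 2) * ((- r - sqrt disc) / 2) = - p"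
        unfolding sq by (simp add: disc_def power2_eq_square)
      moreover have "(- r + sqrt disc) / 2 + (- r - sqrt disc) / 2 = - r" by (simp add: field_simps)
      moreover have "\<bar>(- r - sqrt disc) / 2\<bar> > 2"
      proof -
        have "r + sqrt disc > 4" using r4 sq(2) by linarith
        then show ?thesis by (simp add: abs_if field_simps)
      qed
      ultimately show ?thesis by blast
    next
      case False
      then have "\<omega> < 0" using 4 by simp
      then have r4: "r < - 4" using \<omega> by (simp add: r_def field_simps)
      then have "\<mu> * r \<le> 0" using \<mu> by (simp add: mult_nonneg_nonpos)
      then have "disc \<ge> 0" unfolding disc(2) r\<omega> using zero_le_power2[of "r + 4"] by linarith
      then have sq: "sqrt disc * sqrt disc = disc" "sqrt disc \<ge> 0" by simp_all
      have "((- r - sqrt disc) / 2) * ((- r + sqrt disc) / 2) = (r * r - sqrt disc * sqrt disc) / 4"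
        by (simp add: algebra_simps)
      then have "((- r - sqrt disc) / 2) * ((- r + sqrt disc) / 2) = - p"
        unfolding sq by (simp add: disc_def power2_eq_square)
      moreover have "(- r - sqrt disc) / 2 + (- r + sqrt disc) / 2 = - r" by (simp add: field_simps)
      moreover have "\<bar>(- r + sqrt disc) / 2\<bar> > 2"
      proof -
        have "- r + sqrt disc > 4" using r4 sq(2) by linarith
        then show ?thesis by (simp add: abs_if field_simps)
      qed
      ultimately show ?thesis by blast
    qed
    then obtain s t where st: "s + t = - r" "s * t = - p" "\<bar>t\<bar> > 2" by blast
    define y where "y n = e (n + 1) + e (n - 1) - s * e n" for n
    have yeq: "y (n + 1) + y (n - 1) = t * y n" if "0 \<le> n" "n < int N" for n
    proof -
      have "y (n + 1) + y (n - 1) - t * y n =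
          (e (n + 2) + e (n - 2)) - (s + t) * (e (n + 1) + e (n - 1)) + (2 + s * t) * e n"
        unfolding y_def by (simp add: algebra_simps)
      also have "\<dots> = - r * ((2 + 2 * \<omega> - \<mu>) * e n - (e (n - 1) + e (n + 1)) - \<omega> * (e (n - 2) + e (n + 2)))"
      proof -
        have "A + r * B + (2 + - p) * E =
            - r * ((2 + 2 * \<omega> - \<mu>) * E - B - \<omega> * A) + (1 - \<omega> * r) * (A + 2 * E)" for A B E
          by (simp add: p_def algebra_simps)
        from this[of "e (n + 2) + e (n - 2)" "e (n + 1) + e (n - 1)" "e n"]
        show ?thesis unfolding st r\<omega> by (simp add: add.commute)
      qed
      also have "\<dots> = 0" unfolding eq[OF that] by simp
      finally show ?thesis by simp
    qed
    have em: "e (- 1) = e 1" "e (- 2) = e 2" "e (int N) = e (int N - 2)" "e (int N + 1) = e (int N - 3)"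
      using 4(1) by (auto simp: e_def nat_diff_distrib nat_add_distrib intro!: arg_cong[of _ _ x])
    have ym: "y (- 1) = y 1" "y (int N) = y (int N - 2)"
      unfolding y_def using em by (simp_all add: add.commute algebra_simps)
    \<comment> \<open>The maximum principle: the neighbours of a site where |y| is maximal are again
      bounded by \<open>Y\<close>, as reflection sends those beyond an end back into the chain. Thus
      |t| Y \<le> 2 Y, which forces Y = 0.\<close>
    define Y where "Y = Max ((\<lambda>n. \<bar>y n\<bar>) ` {0..<int N})"
    have Yge: "\<bar>y n\<bar> \<le> Y" if "0 \<le> n" "n < int N" for n unfolding Y_def using that by (intro Max_ge) auto
    have "Y \<in> (\<lambda>n. \<bar>y n\<bar>) ` {0..<int N}" unfolding Y_def using N by (intro Max_in) auto
    then obtain m where m: "0 \<le> m" "m < int N" "Y = \<bar>y m\<bar>" by auto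
    have "\<bar>y (m + 1)\<bar> \<le> Y"
    proof (cases "m + 1 < int N")
      case False
      then have "m + 1 = int N" using m by simp
      then show ?thesis using ym(2) Yge[of "int N - 2"] 4(1) by simp
    qed (use Yge m in auto)
    moreover have "\<bar>y (m - 1)\<bar> \<le> Y"
    proof (cases "m = 0")
      case True
      then show ?thesis using ym(1) Yge[of 1] 4(1) by simp
    qed (use Yge m in auto)
    ultimately have "\<bar>t * y m\<bar> \<le> 2 * Y" using yeq[OF m(1,2)] by linarith
    then have "\<bar>t\<bar> * Y \<le> 2 * Y" using m(3) by (simp add: abs_mult)
    then have "Y \<le> 0" using st(3) m(3) by (metis abs_ge_zero mult_le_cancel_right not_less order_le_less)
    then have y0: "y n = 0" if "0 \<le> n" "n < int N" for n using Yge[OF that] by simp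
    have "Suc k < N \<Longrightarrow> x k = 0 \<and> x (Suc k) = 0" for k
    proof (induction k)
      case 0
      \<comment> \<open>Evenness about the left end supplies the second initial value of the
        three-term recursion.\<close>
      have "y 0 = 2 * x 1" using ends 4(1) by (simp add: y_def e_def)
      then show ?case using y0[of 0] ends 4(1) by simp
    next
      case (Suc k)
      have "y (int (Suc k)) = x (Suc (Suc k)) + x k - s * x (Suc k)"
        using Suc.prems by (simp add: y_def e_def nat_add_distrib)
      then show ?case using y0[of "int (Suc k)"] Suc by simp
    qed
    moreover assume "k < N"
    ultimately show "x k = 0" using 4(1) ends by (cases "k = N - 1") auto
  qed
qed

text \<open>Twice the potential, as a bilinear form. It lives on sequences indexed by natural
  numbers, where neighbours are reached by addition, and reads only entries below \<open>N\<close>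
  once \<open>N\<close> is at least 2.\<close>

definition chain_form :: "nat \<Rightarrow> real \<Rightarrow> real \<Rightarrow> (nat \<Rightarrow> real) \<Rightarrow> (nat \<Rightarrow> real) \<Rightarrow> real"
  where "chain_form N \<omega> \<eta> x y =
    (\<Sum>n<N-1. (x n - x (n+1)) * (y n - y (n+1))) + \<omega> * (\<Sum>n<N-2. (x n - x (n+2)) * (y n - y (n+2)))
    + \<eta> * (\<Sum>n<N. x n * y n)"

lemma chain_form_commute: "chain_form N \<omega> \<eta> x y = chain_form N \<omega> \<eta> y x"
  by (simp add: chain_form_def mult.commute)

lemma chain_form_add: "chain_form N \<omega> \<eta> (\<lambda>n. x n + x' n) y = chain_form N \<omega> \<eta> x y + chain_form N \<omega> \<eta> x' y"
proof -
  have "(\<Sum>n\<in>A. (x n + x' n - (x (f n) + x' (f n))) * (y n - y (f n))) =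
      (\<Sum>n\<in>A. (x n - x (f n)) * (y n - y (f n))) + (\<Sum>n\<in>A. (x' n - x' (f n)) * (y n - y (f n)))" for A f
    by (simp add: sum.distrib[symmetric] algebra_simps)
  moreover have "(\<Sum>n<N. (x n + x' n) * y n) = (\<Sum>n<N. x n * y n) + (\<Sum>n<N. x' n * y n)"
    by (simp add: sum.distrib distrib_right)
  ultimately show ?thesis unfolding chain_form_def by (simp add: algebra_simps)
qed

lemma chain_form_cmult: "chain_form N \<omega> \<eta> (\<lambda>n. c * x n) y = c * chain_form N \<omega> \<eta> x y"
proof -
  have "(\<Sum>n\<in>A. (c * x n - c * x (f n)) * (y n - y (f n))) = c * (\<Sum>n\<in>A. (x n - x (f n)) * (y n - y (f n)))" for A f
    by (simp add: sum_distrib_left algebra_simps)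
  moreover have "(\<Sum>n<N. c * x n * y n) = c * (\<Sum>n<N. x n * y n)"
    by (simp add: sum_distrib_left mult.assoc)
  ultimately show ?thesis unfolding chain_form_def by (simp add: algebra_simps)
qed

lemma chain_form_sum:
  "finite J \<Longrightarrow> chain_form N \<omega> \<eta> (\<lambda>n. \<Sum>j\<in>J. c j * x j n) y = (\<Sum>j\<in>J. c j * chain_form N \<omega> \<eta> (x j) y)"
proof (induction J rule: finite_induct)
  case empty
  show ?case by (simp add: chain_form_def)
qed (simp add: chain_form_add chain_form_cmult)

text \<open>Pairing with a unit sequence extracts row k of the matrix, with missing bonds at the
  ends, in the shape that \<open>pentadiagonal_no_eigenvector\<close> expects.\<close>

lemma chain_form_delta:
  assumes "k < N"
  shows "chain_form N \<omega> \<eta> (\<lambda>n. if n = k then 1 else 0) x =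
    (if k + 1 < N then x k - x (k + 1) else 0) + (if 1 \<le> k then x k - x (k - 1) else 0)
    + \<omega> * ((if k + 2 < N then x k - x (k + 2) else 0) + (if 2 \<le> k then x k - x (k - 2) else 0)) + \<eta> * x k"
proof -
  have *: "(\<Sum>n<N-d. ((if n = k then 1 else 0) - (if n + d = k then 1 else 0)) * (x n - x (n + d))) =
      (if k + d < N then x k - x (k + d) else 0) + (if d \<le> k then x k - x (k - d) else 0)" if "d > 0" for d
  proof -
    have "(\<Sum>n<N-d. ((if n = k then 1 else 0) - (if n + d = k then 1 else 0)) * (x n - x (n + d))) =
        (\<Sum>n<N-d. if n = k then x n - x (n + d) else 0) - (\<Sum>n<N-d. if n + d = k then x n - x (n + d) else 0)"
    proof -
      have "((if n = k then 1 else 0) - (if n + d = k then 1 else 0)) * z =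
          (if n = k then z else 0) - (if n + d = k then z else 0)" for n and z :: real by simp
      then show ?thesis by (simp only: sum_subtractf)
    qed
    also have "(\<Sum>n<N-d. if n = k then x n - x (n + d) else 0) = (if k + d < N then x k - x (k + d) else 0)"
      by (subst sum.delta) auto
    also have "(\<Sum>n<N-d. if n + d = k then x n - x (n + d) else 0) = (if d \<le> k then x (k - d) - x k else 0)"
    proof (cases "d \<le> k")
      case True
      then have "(\<Sum>n<N-d. if n + d = k then x n - x (n + d) else 0) = (\<Sum>n<N-d. if n = k - d then x n - x (n + d) else 0)"
        by (intro sum.cong) auto
      also have "\<dots> = x (k - d) - x k" using True assms that by (subst sum.delta) auto
      finally show ?thesis using True by simp
    next
      case False
      then show ?thesis by (intro trans[OF sum.neutral]) auto
    qed
    finally show ?thesis by (auto split: if_splits)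
  qed
  have "(\<Sum>n<N. (if n = k then 1 else 0) * x n) = x k"
    using assms by (simp add: if_distrib[of "\<lambda>z. z * _"] sum.delta cong: if_cong)
  then show ?thesis unfolding chain_form_def using *[of 1] *[of 2] by simp
qed

lemma sum_shift_le:
  fixes f :: "nat \<Rightarrow> real"
  assumes "\<And>n. f n \<ge> 0"
  shows "(\<Sum>n<m. f (n + d)) \<le> (\<Sum>n<m + d. f n)"
proof -
  have "(\<Sum>n<m. f (n + d)) = (\<Sum>n\<in>(\<lambda>n. n + d) ` {..<m}. f n)" by (subst sum.reindex) (auto simp: inj_on_def)
  also have "\<dots> \<le> (\<Sum>n<m + d. f n)" by (rule sum_mono2) (auto simp: assms)
  finally show ?thesis .
qed

text \<open>Both bounds rest on \<open>(a + b)\<^sup>2 \<le> 2 a\<^sup>2 + 2 b\<^sup>2\<close>: next-nearest differences are sums of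
  consecutive nearest differences, and also differences of consecutive sums.\<close>

lemma chain_form_bounds:
  assumes N: "N \<ge> 2" and \<omega>: "-1/4 < \<omega>" "\<omega> < 1/4"
  shows "0 \<le> chain_form N \<omega> 0 x x" "chain_form N \<omega> 0 x x \<le> 4 * (\<Sum>n<N. (x n)\<^sup>2)"
proof -
  define A where "A = (\<Sum>n<N-1. (x n - x (n+1))\<^sup>2)"
  define B where "B = (\<Sum>n<N-2. (x n - x (n+2))\<^sup>2)"
  define C where "C = (\<Sum>n<N-1. (x n + x (n+1))\<^sup>2)"
  have form: "chain_form N \<omega> 0 x x = A + \<omega> * B"
    by (simp add: chain_form_def A_def B_def power2_eq_square)
  have gen: "(\<Sum>n<N-2. (d n + s * d (n+1))\<^sup>2) \<le> 4 * (\<Sum>n<N-1. (d n)\<^sup>2)" if "s\<^sup>2 = 1" for d :: "nat \<Rightarrow> real" and s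
  proof -
    have "(\<Sum>n<N-2. (d n + s * d (n+1))\<^sup>2) \<le> (\<Sum>n<N-2. 2 * (d n)\<^sup>2 + 2 * (d (n+1))\<^sup>2)"
    proof (rule sum_mono)
      fix n
      have "0 \<le> (d n - s * d (n+1))\<^sup>2" by simp
      then show "(d n + s * d (n+1))\<^sup>2 \<le> 2 * (d n)\<^sup>2 + 2 * (d (n+1))\<^sup>2"
        using that by (simp add: power2_sum power2_diff power_mult_distrib)
    qed
    also have "\<dots> = 2 * (\<Sum>n<N-2. (d n)\<^sup>2) + 2 * (\<Sum>n<N-2. (d (n+1))\<^sup>2)"
      by (simp add: sum.distrib sum_distrib_left)
    also have "(\<Sum>n<N-2. (d n)\<^sup>2) \<le> (\<Sum>n<N-1. (d n)\<^sup>2)" by (rule sum_mono2) auto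
    also have "(\<Sum>n<N-2. (d (n+1))\<^sup>2) \<le> (\<Sum>n<N-1. (d n)\<^sup>2)"
    proof -
      have "N - 2 + 1 = N - 1" using N by simp
      then show ?thesis using sum_shift_le[where f = "\<lambda>n. (d n)\<^sup>2" and m = "N-2" and d = 1] by (simp del: One_nat_def)
    qed
    finally show ?thesis by simp
  qed
  have BA: "B \<le> 4 * A" using gen[of 1 "\<lambda>n. x n - x (n+1)"] by (simp add: A_def B_def)
  have BC: "B \<le> 4 * C" using gen[of "-1" "\<lambda>n. x n + x (n+1)"] by (simp add: C_def B_def)
  have nn: "0 \<le> A" "0 \<le> B" "0 \<le> C" by (auto simp: A_def B_def C_def intro: sum_nonneg)
  have AC: "A + C \<le> 4 * (\<Sum>n<N. (x n)\<^sup>2)"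
  proof -
    have "A + C = (\<Sum>n<N-1. 2 * (x n)\<^sup>2 + 2 * (x (n+1))\<^sup>2)"
      unfolding A_def C_def sum.distrib[symmetric] by (intro sum.cong) (auto simp: power2_sum power2_diff)
    also have "\<dots> = 2 * (\<Sum>n<N-1. (x n)\<^sup>2) + 2 * (\<Sum>n<N-1. (x (n+1))\<^sup>2)"
      by (simp add: sum.distrib sum_distrib_left)
    also have "(\<Sum>n<N-1. (x n)\<^sup>2) \<le> (\<Sum>n<N. (x n)\<^sup>2)" by (rule sum_mono2) auto
    also have "(\<Sum>n<N-1. (x (n+1))\<^sup>2) \<le> (\<Sum>n<N. (x n)\<^sup>2)"
      using sum_shift_le[where f = "\<lambda>n. (x n)\<^sup>2" and m = "N-1" and d = 1] N by simp
    finally show ?thesis by simp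
  qed
  show "0 \<le> chain_form N \<omega> 0 x x"
  proof (cases "\<omega> \<ge> 0")
    case False
    have "(- \<omega>) * B \<le> (1/4) * (4 * A)" using \<omega> False nn BA by (intro mult_mono) auto
    then show ?thesis by (simp add: form)
  qed (use nn in \<open>simp add: form\<close>)
  \<comment> \<open>The detour through sums of neighbours gives the constant 4: combined with A + C
    it is the parallelogram identity, whereas B \<le> 4 A alone would give only 8.\<close>
  have "\<omega> * B \<le> C"
  proof (cases "\<omega> \<ge> 0")
    case True
    have "\<omega> * B \<le> (1/4) * (4 * C)" using \<omega> True nn BC by (intro mult_mono) auto
    then show ?thesis by simp
  next
    case False
    then have "\<omega> * B \<le> 0" using nn by (intro mult_nonpos_nonneg) auto
    then show ?thesis using nn by linarith
  qed
  then show "chain_form N \<omega> 0 x x \<le> 4 * (\<Sum>n<N. (x n)\<^sup>2)" using AC by (simp add: form)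
qed

definition site_seq :: "('n::finite \<Rightarrow> nat) \<Rightarrow> real ^ 'n \<Rightarrow> nat \<Rightarrow> real"
  where "site_seq idx v n = v $ inv idx n"

text \<open>A maximiser of the quadratic form on the unit sphere of the invariant subspace is an
  eigenvector: its defect w lies in the subspace, and moving along w would violate maximality unless
  w = 0.\<close>

lemma self_adjoint_eigenvector:
  fixes f :: "'a::euclidean_space \<Rightarrow> 'a"
  assumes f: "linear f" and sym: "\<And>x y. x \<bullet> f y = f x \<bullet> y"
    and W: "subspace W" "\<And>x. x \<in> W \<Longrightarrow> f x \<in> W" and w0: "w0 \<in> W" "w0 \<noteq> 0"
  obtains v \<mu> where "v \<in> W" "v \<noteq> 0" "f v = \<mu> *\<^sub>R v"
proof -
  let ?S = "sphere 0 1 \<inter> W"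
  have c: "compact ?S" by (intro compact_Int_closed compact_sphere closed_subspace W)
  have "(1 / norm w0) *\<^sub>R w0 \<in> ?S" using w0 W by (auto simp: subspace_scale)
  then have ne: "?S \<noteq> {}" by blast
  have "bounded_linear f" using f by (simp add: linear_conv_bounded_linear)
  then have "continuous_on ?S (\<lambda>x. x \<bullet> f x)" by (intro continuous_intros linear_continuous_on)
  from continuous_attains_sup[OF c ne this]
  obtain v where v': "v \<in> ?S" "\<forall>x\<in>?S. x \<bullet> f x \<le> v \<bullet> f v" by (elim bexE)
  then have v: "v \<in> ?S" "\<And>x. x \<in> ?S \<Longrightarrow> x \<bullet> f x \<le> v \<bullet> f v" by simp_all
  define \<mu> where "\<mu> = v \<bullet> f v"
  have vv: "v \<bullet> v = 1" using v(1) by (simp add: dot_square_norm)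
  have le: "x \<bullet> f x \<le> \<mu> * (x \<bullet> x)" if "x \<in> W" for x
  proof (cases "x = 0")
    case False
    then have "(1 / norm x) *\<^sub>R x \<in> ?S" using that W by (auto simp: subspace_scale)
    from v(2)[OF this] have "(1 / norm x) * ((1 / norm x) * (x \<bullet> f x)) \<le> \<mu>"
      by (simp add: \<mu>_def linear_scale[OF f])
    then show ?thesis using False by (simp add: dot_square_norm power2_eq_square field_simps)
  qed (simp add: linear_0[OF f])
  define w where "w = \<mu> *\<^sub>R v - f v"
  have w: "w \<in> W" unfolding w_def using v(1) W by (auto intro: subspace_diff subspace_scale)
  have "w \<bullet> w = 0"
  proof (rule ccontr)
    assume "w \<bullet> w \<noteq> 0"
    then have pos: "w \<bullet> w > 0" by simp
    define b where "b = \<mu> * (w \<bullet> w) - w \<bullet> f w"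
    have b: "b \<ge> 0" using le[OF w] by (simp add: b_def)
    have q: "0 \<le> 2 * t * (w \<bullet> w) + t\<^sup>2 * b" for t
    proof -
      have "v + t *\<^sub>R w \<in> W" using v(1) w W by (auto intro: subspace_add subspace_scale)
      from le[OF this] have "0 \<le> \<mu> * ((v + t *\<^sub>R w) \<bullet> (v + t *\<^sub>R w)) - (v + t *\<^sub>R w) \<bullet> f (v + t *\<^sub>R w)" by simp
      also have "\<dots> = (\<mu> * (v \<bullet> v) - v \<bullet> f v) + 2 * t * (\<mu> * (v \<bullet> w) - f v \<bullet> w) + t\<^sup>2 * b"
      proof -
        have "(v + t *\<^sub>R w) \<bullet> (v + t *\<^sub>R w) = v \<bullet> v + 2 * t * (v \<bullet> w) + t\<^sup>2 * (w \<bullet> w)"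
          by (simp add: inner_add_left inner_add_right inner_commute[of w v] power2_eq_square algebra_simps)
        moreover have "(v + t *\<^sub>R w) \<bullet> f (v + t *\<^sub>R w) = v \<bullet> f v + 2 * t * (f v \<bullet> w) + t\<^sup>2 * (w \<bullet> f w)"
          by (simp add: linear_add[OF f] linear_scale[OF f] inner_add_left inner_add_right sym[of v w]
              inner_commute[of w "f v"] power2_eq_square algebra_simps)
        ultimately show ?thesis by (simp add: b_def algebra_simps)
      qed
      also have "\<mu> * (v \<bullet> v) - v \<bullet> f v = 0" by (simp add: vv \<mu>_def)
      also have "\<mu> * (v \<bullet> w) - f v \<bullet> w = w \<bullet> w" by (simp add: w_def inner_diff_left)
      finally show ?thesis by simp
    qed
    \<comment> \<open>A small negative step, for which the linear term wins since |t| b is at most w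
      \<bullet> w; the 1 in the denominator covers b = 0.\<close>
    define t where "t = - (w \<bullet> w) / (b + 1)"
    have "2 * t * (w \<bullet> w) + t\<^sup>2 * b = t * (2 * (w \<bullet> w) + t * b)" by (simp add: power2_eq_square algebra_simps)
    moreover have "2 * (w \<bullet> w) + t * b > 0"
    proof -
      have "b / (b + 1) \<le> 1" using b by simp
      then have "(w \<bullet> w) * (b / (b + 1)) \<le> (w \<bullet> w) * 1" using pos by (intro mult_left_mono) auto
      moreover have "t * b = - ((w \<bullet> w) * (b / (b + 1)))" by (simp add: t_def)
      ultimately show ?thesis using pos by linarith
    qed
    moreover have "t < 0" using pos b by (simp add: t_def)
    ultimately have "2 * t * (w \<bullet> w) + t\<^sup>2 * b < 0" by (simp add: mult_neg_pos)
    then show False using q[of t] by simp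
  qed
  then have "f v = \<mu> *\<^sub>R v" by (simp add: w_def)
  moreover have "v \<noteq> 0" using v(1) by auto
  ultimately show ?thesis using that v(1) by blast
qed

section \<open>The matrix of the potential in site coordinates\<close>

locale chain =
  fixes idx :: "'n::finite \<Rightarrow> nat" and \<omega> \<eta> :: real
  assumes idx: "bij_betw idx UNIV {..<CARD('n)}"
    and card2: "CARD('n) \<ge> 2"
    and omega: "-1/4 < \<omega>" "\<omega> < 1/4"
begin

lemma idx_less: "idx i < CARD('n)"
  using idx by (auto simp: bij_betw_def)

lemma inj_idx: "inj idx"
  using idx by (simp add: bij_betw_def)

lemma idx_inv: "n < CARD('n) \<Longrightarrow> idx (inv idx n) = n"
  using idx by (intro f_inv_into_f) (simp add: bij_betw_def)

lemma sum_sites: "(\<Sum>i\<in>UNIV. F (idx i)) = (\<Sum>n<CARD('n). F n)"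
  by (rule sum.reindex_bij_betw[OF idx])

text \<open>Injectivity of \<open>idx\<close> leaves at most one partner at distance d, and none
  within d of the right end.\<close>

lemma sum_sites_shift:
  assumes "d > 0"
  shows "(\<Sum>i\<in>UNIV. \<Sum>j\<in>{j. idx j = idx i + d}. (q $ i - q $ j)\<^sup>2) =
    (\<Sum>n<CARD('n) - d. (site_seq idx q n - site_seq idx q (n + d))\<^sup>2)"
proof -
  have q: "q $ i = site_seq idx q (idx i)" for i by (simp add: site_seq_def inj_idx)
  have "(\<Sum>j\<in>{j. idx j = idx i + d}. (q $ i - q $ j)\<^sup>2) =
      (if idx i + d < CARD('n) then (site_seq idx q (idx i) - site_seq idx q (idx i + d))\<^sup>2 else 0)" for i
  proof (cases "idx i + d < CARD('n)")
    case True
    have "idx j = idx i + d \<longleftrightarrow> j = inv idx (idx i + d)" for j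
      using idx_inv[OF True] injD[OF inj_idx, of j "inv idx (idx i + d)"] by auto
    then have "{j. idx j = idx i + d} = {inv idx (idx i + d)}" by auto
    then show ?thesis using True by (simp add: site_seq_def inj_idx)
  next
    case False
    then have "idx j \<noteq> idx i + d" for j using idx_less[of j] by auto
    then have "{j. idx j = idx i + d} = {}" by auto
    then show ?thesis using False by simp
  qed
  then have "(\<Sum>i\<in>UNIV. \<Sum>j\<in>{j. idx j = idx i + d}. (q $ i - q $ j)\<^sup>2) =
      (\<Sum>n<CARD('n). if n + d < CARD('n) then (site_seq idx q n - site_seq idx q (n + d))\<^sup>2 else 0)"
    using sum_sites[of "\<lambda>n. if n + d < CARD('n) then (site_seq idx q n - site_seq idx q (n + d))\<^sup>2 else 0"] by simp
  also have "\<dots> = (\<Sum>n<CARD('n) - d. (site_seq idx q n - site_seq idx q (n + d))\<^sup>2)"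
    by (rule sum.mono_neutral_cong_right) (use assms in auto)
  finally show ?thesis .
qed

lemma potential_eq: "potential idx \<omega> \<eta> q = chain_form CARD('n) \<omega> \<eta> (site_seq idx q) (site_seq idx q) / 2"
proof -
  have "(\<Sum>i\<in>UNIV. (q $ i)\<^sup>2) = (\<Sum>n<CARD('n). (site_seq idx q n)\<^sup>2)"
    using sum_sites[of "\<lambda>n. (site_seq idx q n)\<^sup>2"] by (simp add: site_seq_def inj_idx)
  then show ?thesis
    unfolding potential_def chain_form_def sum_sites_shift[OF zero_less_one] sum_sites_shift[OF zero_less_numeral]
    by (simp add: power2_eq_square algebra_simps)
qed

lemma site_seq_add: "site_seq idx (v + w) = (\<lambda>n. site_seq idx v n + site_seq idx w n)"
  by (simp add: site_seq_def fun_eq_iff)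

text \<open>Polarisation: the potential is half of the form, so the mixed term, which occurs twice,
  appears exactly once.\<close>

lemma Bmat_entry:
  "Bmat idx \<omega> \<eta> $ i $ j = chain_form CARD('n) \<omega> \<eta> (site_seq idx (axis i 1)) (site_seq idx (axis j 1))"
proof -
  let ?f = "chain_form CARD('n) \<omega> \<eta>" and ?a = "site_seq idx (axis i 1)" and ?b = "site_seq idx (axis j 1)"
  have "?f (\<lambda>n. ?a n + ?b n) (\<lambda>n. ?a n + ?b n) = ?f ?a ?a + 2 * ?f ?a ?b + ?f ?b ?b"
    unfolding chain_form_add chain_form_commute[of _ _ _ _ "\<lambda>n. ?a n + ?b n"]
    by (simp add: chain_form_commute[of _ _ _ ?b ?a])
  then show ?thesis by (simp add: Bmat_def potential_eq site_seq_add add_divide_distrib)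
qed

lemma site_seq_expansion: "site_seq idx v = (\<lambda>n. \<Sum>j\<in>UNIV. v $ j * site_seq idx (axis j 1) n)"
  by (simp add: site_seq_def fun_eq_iff axis_def if_distrib cong: if_cong)

lemma chain_form_expand:
  "chain_form N \<omega> \<eta> (site_seq idx v) y = (\<Sum>j\<in>UNIV. v $ j * chain_form N \<omega> \<eta> (site_seq idx (axis j 1)) y)"
  by (subst site_seq_expansion[of v]) (rule chain_form_sum[OF finite])

lemma Bmat_mult: "(Bmat idx \<omega> \<eta> *v v) $ i = chain_form CARD('n) \<omega> \<eta> (site_seq idx (axis i 1)) (site_seq idx v)"
proof -
  have "(Bmat idx \<omega> \<eta> *v v) $ i = (\<Sum>j\<in>UNIV. Bmat idx \<omega> \<eta> $ i $ j * v $ j)"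
    by (simp add: matrix_vector_mult_def)
  also have "\<dots> = (\<Sum>j\<in>UNIV. v $ j * chain_form CARD('n) \<omega> \<eta> (site_seq idx (axis j 1)) (site_seq idx (axis i 1)))"
    unfolding Bmat_entry by (intro sum.cong refl) (subst chain_form_commute, rule mult.commute)
  also have "\<dots> = chain_form CARD('n) \<omega> \<eta> (site_seq idx v) (site_seq idx (axis i 1))"
    by (rule chain_form_expand[symmetric])
  finally show ?thesis unfolding chain_form_commute[of _ _ _ "site_seq idx v"] .
qed

lemma Bmat_inner: "v \<bullet> (Bmat idx \<omega> \<eta> *v w) = chain_form CARD('n) \<omega> \<eta> (site_seq idx v) (site_seq idx w)"
  unfolding inner_vec_def chain_form_expand[of _ v] Bmat_mult by simp

lemma Bmat_self_adjoint: "v \<bullet> (Bmat idx \<omega> \<eta> *v w) = (Bmat idx \<omega> \<eta> *v v) \<bullet> w"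
  unfolding inner_commute[of "Bmat idx \<omega> \<eta> *v v"] Bmat_inner by (rule chain_form_commute)

lemma chain_form_split: "chain_form N \<omega> \<eta> x y = chain_form N \<omega> 0 x y + \<eta> * (\<Sum>n<N. x n * y n)"
  by (simp add: chain_form_def)

lemma inner_sites: "v \<bullet> v = (\<Sum>n<CARD('n). site_seq idx v n * site_seq idx v n)"
  unfolding inner_vec_def using sum_sites[of "\<lambda>n. site_seq idx v n * site_seq idx v n"]
  by (simp add: site_seq_def inj_idx)

lemma Bmat_ge: "v \<bullet> (Bmat idx \<omega> \<eta> *v v) \<ge> \<eta> * (v \<bullet> v)"
  unfolding Bmat_inner chain_form_split inner_sites using chain_form_bounds(1)[OF card2 omega] by simp

text \<open>The shifted eigenvalue \<nu> - \<eta> is a Rayleigh quotient of the form without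
  pinning, so \<open>chain_form_bounds\<close> places it in [0, 4]. The eigenvalue equation, read
  row by row, is then excluded by \<open>pentadiagonal_no_eigenvector\<close>.\<close>

lemma eigenvector_vanishing_at_ends:
  assumes eig: "Bmat idx \<omega> \<eta> *v v = \<nu> *\<^sub>R v"
    and ends: "\<And>i. idx i = 0 \<or> idx i = CARD('n) - 1 \<Longrightarrow> v $ i = 0"
  shows "v = 0"
proof (rule ccontr)
  assume "v \<noteq> 0"
  let ?N = "CARD('n)" and ?x = "site_seq idx v"
  have vv: "v \<bullet> v = (\<Sum>n<?N. (?x n)\<^sup>2)"
    unfolding power2_eq_square by (rule inner_sites)
  have pos: "v \<bullet> v > 0" using \<open>v \<noteq> 0\<close> by simp
  have "v \<bullet> (Bmat idx \<omega> \<eta> *v v) = \<nu> * (v \<bullet> v)" unfolding eig by simp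
  moreover have "v \<bullet> (Bmat idx \<omega> \<eta> *v v) = chain_form ?N \<omega> 0 ?x ?x + \<eta> * (v \<bullet> v)"
    unfolding inner_sites Bmat_inner by (rule chain_form_split)
  ultimately have "\<nu> * (v \<bullet> v) = chain_form ?N \<omega> 0 ?x ?x + \<eta> * (v \<bullet> v)" by simp
  then have "(\<nu> - \<eta>) * (v \<bullet> v) = chain_form ?N \<omega> 0 ?x ?x" by (simp add: left_diff_distrib)
  then have "0 * (v \<bullet> v) \<le> (\<nu> - \<eta>) * (v \<bullet> v)" "(\<nu> - \<eta>) * (v \<bullet> v) \<le> 4 * (v \<bullet> v)"
    using chain_form_bounds[OF card2 omega, of ?x] by (simp_all add: vv)
  then have \<mu>: "0 \<le> \<nu> - \<eta>" "\<nu> - \<eta> \<le> 4" using pos mult_le_cancel_right_pos by blast+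
  have x0: "?x 0 = 0" "?x (?N - 1) = 0" using ends idx_inv card2 by (auto simp: site_seq_def)
  have "?x k = 0" if "k < ?N" for k
  proof (rule pentadiagonal_no_eigenvector[OF card2 omega \<mu> _ x0 that])
    fix k assume k: "k < ?N"
    let ?i = "inv idx k"
    \<comment> \<open>The two sequences are known to agree only below the number of sites, where
      \<open>inv idx\<close> inverts \<open>idx\<close>; the form reads nothing beyond.\<close>
    have "chain_form ?N \<omega> \<eta> (\<lambda>n. if n = k then 1 else 0) ?x = chain_form ?N \<omega> \<eta> (site_seq idx (axis ?i 1)) ?x"
    proof -
      have "(if n = k then 1 else 0) = site_seq idx (axis ?i 1) n" if "n < ?N" for n
        using idx_inv[OF k] idx_inv[OF that] by (auto simp: site_seq_def axis_def)
      then show ?thesis unfolding chain_form_def using card2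
        by (intro arg_cong2[of _ _ _ _ "(+)"] arg_cong2[of _ _ _ _ "(*)"] sum.cong refl) auto
    qed
    also have "\<dots> = \<nu> * ?x k"
      using arg_cong[OF eig, of "\<lambda>w. w $ ?i"] unfolding Bmat_mult by (simp add: site_seq_def)
    finally show "(if k + 1 < ?N then ?x k - ?x (k + 1) else 0) + (if 1 \<le> k then ?x k - ?x (k - 1) else 0)
      + \<omega> * ((if k + 2 < ?N then ?x k - ?x (k + 2) else 0) + (if 2 \<le> k then ?x k - ?x (k - 2) else 0))
      = (\<nu> - \<eta>) * ?x k"
      unfolding chain_form_delta[OF k] by (simp add: algebra_simps)
  qed
  from this[OF idx_less] have "v $ i = 0" for i by (simp add: site_seq_def inj_idx)
  then show False using \<open>v \<noteq> 0\<close> by (simp add: vec_eq_iff)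
qed

end

lemma sum_UNIV_Plus: "(\<Sum>b\<in>UNIV. F b) = (\<Sum>i\<in>(UNIV :: 'a::finite set). F (Inl i)) + (\<Sum>i\<in>(UNIV :: 'b::finite set). F (Inr i))"
  using sum.Plus[of "UNIV :: 'a set" "UNIV :: 'b set" F] by (simp add: o_def)

subsection \<open>Observability and spectrum of the chain\<close>

definition momentum :: "'n::finite phase \<Rightarrow> real ^ 'n"
  where "momentum \<xi> = (\<chi> i. \<xi> $ Inl i)"

definition position :: "'n::finite phase \<Rightarrow> real ^ 'n"
  where "position \<xi> = (\<chi> i. \<xi> $ Inr i)"

lemma linear_momentum: "linear momentum"
  by (rule linearI) (simp_all add: momentum_def vec_eq_iff)

lemma phase_eq_0: "momentum \<xi> = 0 \<Longrightarrow> position \<xi> = 0 \<Longrightarrow> \<xi> = 0"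
  unfolding momentum_def position_def vec_eq_iff by (auto simp: split_sum_all)

lemma momentum_Mmat: "momentum (Mmat \<gamma> B *v \<xi>) = (\<chi> i. \<gamma> i * momentum \<xi> $ i) - position \<xi>"
proof -
  have "(Mmat \<gamma> B *v \<xi>) $ Inl i = \<gamma> i * \<xi> $ Inl i - \<xi> $ Inr i" for i
    by (simp add: matrix_vector_mult_def sum_UNIV_Plus Mmat_def if_distrib[of "\<lambda>z. z * _"] cong: if_cong)
  then show ?thesis by (simp add: vec_eq_iff momentum_def position_def)
qed

lemma position_Mmat: "position (Mmat \<gamma> B *v \<xi>) = B *v momentum \<xi>"
  by (simp add: vec_eq_iff matrix_vector_mult_def sum_UNIV_Plus Mmat_def momentum_def position_def)

lemma eigenvector_of_mat_spectrum:
  assumes "c \<in> mat_spectrum A"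
  shows "\<exists>x. x \<noteq> 0 \<and> cmat A *v x = c *s x"
proof -
  have "\<not> invertible (mat c - cmat A)" using assms by (simp add: mat_spectrum_def invertible_det_nz)
  then obtain x where x: "x \<noteq> 0" "(mat c - cmat A) *v x = 0"
    unfolding invertible_left_inverse matrix_left_invertible_ker by blast
  have "mat c *v x = c *s x"
    by (simp add: vec_eq_iff matrix_vector_mult_def mat_def if_distrib[of "\<lambda>z. z * _"] cong: if_cong)
  with x show ?thesis by (auto simp: matrix_vector_mult_diff_rdistrib)
qed

text \<open>Finiteness and nonemptiness turn the infimum in \<open>spectral_gap\<close> into a
  minimum. The characteristic polynomial p is not constant: its reversal r(s) = s^d p(1/s) has r(0)
  = 1, whereas a constant p would make it s^d p(0) and hence tend to 0.\<close>

lemma mat_spectrum_finite_nonempty: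
  fixes A :: "real ^ 'k::finite ^ 'k"
  shows "finite (mat_spectrum A)" "mat_spectrum A \<noteq> {}"
proof -
  define p :: "complex poly" where "p = det (\<chi> i j. [: - cmat A $ i $ j, mat 1 $ i $ j :])"
  have p: "poly p c = det (mat c - cmat A)" for c
    by (simp add: p_def det_def poly_sum poly_prod mat_def if_distrib[of "\<lambda>z. c * z"] cong: if_cong)
  define r :: "complex poly" where "r = det (\<chi> i j. [: mat 1 $ i $ j, - cmat A $ i $ j :])"
  have r: "poly r s = det (\<chi> i j. mat 1 $ i $ j - s * cmat A $ i $ j)" for s
    by (simp add: r_def det_def poly_sum poly_prod)
  have scale: "poly r s = s ^ CARD('k) * poly p (1 / s)" if "s \<noteq> 0" for s
  proof -
    have "(\<chi> i j. mat 1 $ i $ j - s * cmat A $ i $ j) = (\<chi> i. s *s (mat (1 / s) - cmat A) $ i)"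
      using that by (simp add: vec_eq_iff mat_def right_diff_distrib)
    then show ?thesis
      using det_rows_mul[of "\<lambda>_. s" "\<lambda>i. (mat (1 / s) - cmat A) $ i"]
      unfolding r p by (simp only: vec_lambda_eta prod_constant)
  qed
  have nc: "\<not> constant (poly p)"
  proof
    assume "constant (poly p)"
    then have "poly p c = poly p 0" for c unfolding constant_def by (rule spec2[of _ c 0])
    then have eq: "poly r s = s ^ CARD('k) * poly p 0" if "s \<noteq> 0" for s using scale[OF that] by simp
    have "0 ^ CARD('k) * poly p 0 = 0" by (simp add: zero_power)
    moreover have "(\<lambda>s. s ^ CARD('k) * poly p 0) \<midarrow>0\<rightarrow> 0 ^ CARD('k) * poly p 0"
      by (intro tendsto_intros)
    ultimately have "(\<lambda>s. s ^ CARD('k) * poly p 0) \<midarrow>0\<rightarrow> 0" by (rule subst)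
    moreover have "poly r \<midarrow>0\<rightarrow> poly r 0" using isCont_def poly_isCont by blast
    then have "(\<lambda>s. s ^ CARD('k) * poly p 0) \<midarrow>0\<rightarrow> poly r 0"
      by (rule Lim_transform_eventually) (simp add: eventually_at_filter eq)
    ultimately have "poly r 0 = 0" by (rule LIM_unique[symmetric])
    moreover have "(\<chi> i j. mat 1 $ i $ j - 0 * cmat A $ i $ j) = mat 1" by (simp add: vec_eq_iff)
    ultimately show False unfolding r by simp
  qed
  have spec: "mat_spectrum A = {c. poly p c = 0}" by (simp add: mat_spectrum_def p)
  have "p \<noteq> 0" using nc by (auto simp: constant_def)
  then show "finite (mat_spectrum A)" unfolding spec by (rule poly_roots_finite)
  show "mat_spectrum A \<noteq> {}" unfolding spec using fundamental_theorem_of_algebra[OF nc] by blast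
qed

context chain
begin

text \<open>On the unobservable subspace the end momenta vanish, so friction does not act and two
  applications of M amount to -B on the momentum part. The momentum parts thus form a B-invariant
  space of vectors vanishing at both ends, where self-adjointness would provide an
  eigenvector.\<close>

lemma observable:
  assumes \<gamma>0: "\<And>i. idx i \<noteq> 0 \<Longrightarrow> idx i \<noteq> CARD('n) - 1 \<Longrightarrow> \<gamma> i = 0" and "\<xi> \<noteq> 0"
  shows "\<exists>j i. (idx i = 0 \<or> idx i = CARD('n) - 1) \<and> (((*v) (Mmat \<gamma> (Bmat idx \<omega> \<eta>)) ^^ j) \<xi>) $ Inl i \<noteq> 0"
proof (rule ccontr)
  define B where "B = Bmat idx \<omega> \<eta>"
  define M where "M = Mmat \<gamma> B"
  define U where "U = {\<xi>. \<forall>j i. (idx i = 0 \<or> idx i = CARD('n) - 1) \<longrightarrow> (((*v) M ^^ j) \<xi>) $ Inl i = 0}"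
  assume "\<not> ?thesis"
  then have "\<xi> \<in> U" unfolding U_def M_def B_def by blast
  have U: "subspace U"
    unfolding U_def subspace_def
    by (simp add: linear_0[OF linear_matrix_power] linear_add[OF linear_matrix_power] linear_scale[OF linear_matrix_power])
  have inv: "M *v x \<in> U" if "x \<in> U" for x
  proof -
    have "(((*v) M ^^ j) (M *v x)) $ Inl i = 0" if "idx i = 0 \<or> idx i = CARD('n) - 1" for j i
    proof -
      have "(((*v) M ^^ j) (M *v x)) = ((*v) M ^^ Suc j) x" by (simp add: funpow_swap1)
      then show ?thesis
        by (simp only:) (rule CollectD[OF \<open>x \<in> U\<close>[unfolded U_def], rule_format], rule that)
    qed
    then show ?thesis unfolding U_def by blast
  qed
  have ends: "momentum x $ i = 0" if "x \<in> U" "idx i = 0 \<or> idx i = CARD('n) - 1" for x i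
  proof -
    have "(((*v) M ^^ 0) x) $ Inl i = 0" using that unfolding U_def by blast
    then show ?thesis by (simp add: momentum_def)
  qed
  have mom: "momentum (M *v x) = - position x" if "x \<in> U" for x
  proof -
    have "\<gamma> i * momentum x $ i = 0" for i using ends[OF that, of i] \<gamma>0[of i] by (cases "idx i = 0 \<or> idx i = CARD('n) - 1") auto
    then show ?thesis unfolding M_def momentum_Mmat by (simp add: vec_eq_iff)
  qed
  let ?W = "momentum ` U"
  have W: "subspace ?W" by (rule linear_subspace_image[OF linear_momentum U])
  have Winv: "B *v w \<in> ?W" if "w \<in> ?W" for w
  proof -
    from that obtain x where x: "x \<in> U" "w = momentum x" by blast
    have "B *v w = momentum (- (M *v (M *v x)))"
      using mom[OF inv[OF x(1)]] unfolding linear_neg[OF linear_momentum] M_def position_Mmat x(2) by simp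
    moreover have "- (M *v (M *v x)) \<in> U" by (rule subspace_neg[OF U inv[OF inv[OF x(1)]]])
    ultimately show ?thesis by blast
  qed
  have W0: "w = 0" if "w \<in> ?W" for w
  proof (rule ccontr)
    assume "w \<noteq> 0"
    have sym: "x \<bullet> (B *v y) = (B *v x) \<bullet> y" for x y unfolding B_def by (rule Bmat_self_adjoint)
    obtain v \<mu> where v: "v \<in> ?W" "v \<noteq> 0" "B *v v = \<mu> *\<^sub>R v"
      by (rule self_adjoint_eigenvector[of "(*v) B", OF matrix_vector_mul_linear sym W Winv \<open>w \<in> ?W\<close> \<open>w \<noteq> 0\<close>])
    have "v = 0"
      by (rule eigenvector_vanishing_at_ends[OF v(3)[unfolded B_def]]) (use v(1) ends in auto)
    then show False using v(2) by simp
  qed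
  \<comment> \<open>Once all momentum parts are 0, the position part is 0 as well, because it is
    minus the momentum part of M \<xi>.\<close>
  have "momentum \<xi> = 0" using W0 \<open>\<xi> \<in> U\<close> by blast
  moreover have "position \<xi> = 0" using mom[OF \<open>\<xi> \<in> U\<close>] W0[OF imageI[OF inv[OF \<open>\<xi> \<in> U\<close>]]] by simp
  ultimately show False using \<open>\<xi> \<noteq> 0\<close> phase_eq_0 by blast
qed

lemma spectrum_right_half_plane:
  assumes \<eta>: "\<eta> > 0"
    and \<gamma>: "\<And>i. idx i = 0 \<or> idx i = CARD('n) - 1 \<Longrightarrow> \<gamma> i > 0"
    and \<gamma>0: "\<And>i. idx i \<noteq> 0 \<Longrightarrow> idx i \<noteq> CARD('n) - 1 \<Longrightarrow> \<gamma> i = 0"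
    and c: "c \<in> mat_spectrum (Mmat \<gamma> (Bmat idx \<omega> \<eta>))"
  shows "Re c > 0"
proof (rule ccontr)
  define B where "B = Bmat idx \<omega> \<eta>"
  define M where "M = Mmat \<gamma> B"
  define r s where "r = Re c" and "s = Im c"
  assume "\<not> ?thesis"
  then have r0: "r \<le> 0" by (simp add: r_def)
  obtain x where x: "x \<noteq> 0" "cmat M *v x = c *s x"
    using eigenvector_of_mat_spectrum[OF c] unfolding M_def B_def by blast
  define xr where "xr = (\<chi> b. Re (x $ b))"
  define xi where "xi = (\<chi> b. Im (x $ b))"
  have comp: "(\<Sum>b\<in>UNIV. complex_of_real (M $ a $ b) * x $ b) = c * x $ a" for a
    using arg_cong[OF x(2), of "\<lambda>v. v $ a"] by (simp add: matrix_vector_mult_def cmat_def)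
  have Mr: "M *v xr = r *\<^sub>R xr - s *\<^sub>R xi"
    unfolding vec_eq_iff
  proof
    fix a
    show "(M *v xr) $ a = (r *\<^sub>R xr - s *\<^sub>R xi) $ a"
      using arg_cong[OF comp[of a], of Re] by (simp add: matrix_vector_mult_def xr_def xi_def r_def s_def Re_sum)
  qed
  have Mi: "M *v xi = s *\<^sub>R xr + r *\<^sub>R xi"
    unfolding vec_eq_iff
  proof
    fix a
    show "(M *v xi) $ a = (s *\<^sub>R xr + r *\<^sub>R xi) $ a"
      using arg_cong[OF comp[of a], of Im] by (simp add: matrix_vector_mult_def xr_def xi_def r_def s_def Im_sum)
  qed
  define a d where "a = momentum xr" and "d = momentum xi"
  define G where "G v = (\<chi> i. \<gamma> i * v $ i)" for v :: "real ^ 'n"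
  have pos_lin: "position (t *\<^sub>R v + u *\<^sub>R w) = t *\<^sub>R position v + u *\<^sub>R position w"
    "position (t *\<^sub>R v - u *\<^sub>R w) = t *\<^sub>R position v - u *\<^sub>R position w" for t u and v w :: "'n phase"
    by (simp_all add: position_def vec_eq_iff)
  have mom_lin: "momentum (t *\<^sub>R v + u *\<^sub>R w) = t *\<^sub>R momentum v + u *\<^sub>R momentum w"
    "momentum (t *\<^sub>R v - u *\<^sub>R w) = t *\<^sub>R momentum v - u *\<^sub>R momentum w" for t u and v w :: "'n phase"
    by (simp_all add: momentum_def vec_eq_iff)
  have qr: "position xr = G a - r *\<^sub>R a + s *\<^sub>R d"
    using arg_cong[OF Mr, of momentum] unfolding M_def momentum_Mmat mom_lin by (simp add: a_def d_def G_def algebra_simps)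
  have qi: "position xi = G d - s *\<^sub>R a - r *\<^sub>R d"
    using arg_cong[OF Mi, of momentum] unfolding M_def momentum_Mmat mom_lin by (simp add: a_def d_def G_def algebra_simps)
  have Ba: "B *v a = r *\<^sub>R position xr - s *\<^sub>R position xi"
    using arg_cong[OF Mr, of position] unfolding M_def position_Mmat pos_lin by (simp add: a_def)
  have Bd: "B *v d = s *\<^sub>R position xr + r *\<^sub>R position xi"
    using arg_cong[OF Mi, of position] unfolding M_def position_Mmat pos_lin by (simp add: d_def)
  have nz: "a \<noteq> 0 \<or> d \<noteq> 0"
  proof (rule ccontr)
    assume "\<not> ?thesis"
    then have ad: "a = 0" "d = 0" by auto
    then have "position xr = 0" "position xi = 0" unfolding qr qi by (simp_all add: G_def vec_eq_iff)
    then have "xr = 0" "xi = 0" using ad phase_eq_0 unfolding a_def d_def by blast+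
    then have "x = 0" by (simp add: vec_eq_iff xr_def xi_def complex_eq_iff)
    then show False using x(1) by simp
  qed
  define m where "m = a \<bullet> a + d \<bullet> d"
  have m: "m > 0" unfolding m_def using nz by (metis add_nonneg_pos add_pos_nonneg inner_ge_zero inner_gt_zero_iff)
  define g where "g = a \<bullet> G a + d \<bullet> G d"
  have \<gamma>nn: "\<gamma> i \<ge> 0" for i using \<gamma>[of i] \<gamma>0[of i] by (cases "idx i = 0 \<or> idx i = CARD('n) - 1") auto
  have GG: "v \<bullet> G v = (\<Sum>i\<in>UNIV. \<gamma> i * (v $ i)\<^sup>2)" for v
    by (simp add: G_def inner_vec_def power2_eq_square mult_ac)
  have G0: "v \<bullet> G v \<ge> 0" for v unfolding GG using \<gamma>nn by (intro sum_nonneg mult_nonneg_nonneg) auto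
  have Gsym: "a \<bullet> G d = d \<bullet> G a" by (simp add: G_def inner_vec_def mult_ac)
  have aa: "a \<bullet> (B *v a) = r * (a \<bullet> G a - r * (a \<bullet> a) + s * (a \<bullet> d)) - s * (a \<bullet> G d - s * (a \<bullet> a) - r * (a \<bullet> d))"
    unfolding Ba qr qi by (simp only: inner_add_right inner_diff_right inner_scaleR_right)
  have dd: "d \<bullet> (B *v d) = s * (a \<bullet> G d - r * (a \<bullet> d) + s * (d \<bullet> d)) + r * (d \<bullet> G d - s * (a \<bullet> d) - r * (d \<bullet> d))"
    unfolding Bd qr qi Gsym inner_commute[of a d] by (simp only: inner_add_right inner_diff_right inner_scaleR_right)
  have ad: "a \<bullet> (B *v d) = s * (a \<bullet> G a - r * (a \<bullet> a) + s * (a \<bullet> d)) + r * (a \<bullet> G d - s * (a \<bullet> a) - r * (a \<bullet> d))"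
    unfolding Bd qr qi by (simp only: inner_add_right inner_diff_right inner_scaleR_right)
  have da: "d \<bullet> (B *v a) = r * (a \<bullet> G d - r * (a \<bullet> d) + s * (d \<bullet> d)) - s * (d \<bullet> G d - s * (a \<bullet> d) - r * (d \<bullet> d))"
    unfolding Ba qr qi Gsym inner_commute[of a d] by (simp only: inner_add_right inner_diff_right inner_scaleR_right)
  \<comment> \<open>With v = a + i d, \<open>K1\<close> and \<open>K2\<close> are the real and
    imaginary parts of the quadratic identity for c = r + i s; m stands for |v|^2 and g for the
    friction term.\<close>
  have K1: "a \<bullet> (B *v a) + d \<bullet> (B *v d) = r * g + (s\<^sup>2 - r\<^sup>2) * m"
    unfolding aa dd g_def m_def power2_eq_square by algebra
  have "a \<bullet> (B *v d) = d \<bullet> (B *v a)" unfolding B_def Bmat_self_adjoint[of a] by (rule inner_commute)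
  then have K2: "s * (g - 2 * r * m) = 0"
    unfolding ad da g_def m_def by algebra
  have "\<eta> * m \<le> a \<bullet> (B *v a) + d \<bullet> (B *v d)"
    unfolding m_def distrib_left B_def by (intro add_mono Bmat_ge)
  then have K3: "r * g + (s\<^sup>2 - r\<^sup>2) * m > 0" using K1 \<eta> m by (metis less_le_trans mult_pos_pos)
  have g0: "g \<ge> 0" unfolding g_def using G0 by simp
  \<comment> \<open>A real eigenvalue r \<le> 0 would make the potential energy nonpositive. For s
    nonzero the imaginary part gives g = 2 r m, and g \<ge> 0 \<ge> r leaves only r = 0 and g =
    0.\<close>
  show False
  proof (cases "s = 0")
    case True
    have "r * g \<le> 0" using r0 g0 by (simp add: mult_nonpos_nonneg)
    then show False using K3 True mult_nonneg_nonneg[OF zero_le_power2[of r] less_imp_le[OF m]]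
      by (simp add: left_diff_distrib)
  next
    case False
    then have "g = 2 * r * m" using K2 by simp
    moreover have "r * m \<le> 0" using r0 m by (simp add: mult_nonpos_nonneg)
    ultimately have "g = 0" "r * m = 0" using g0 by linarith+
    then have r: "r = 0" using m by simp
    have "a \<bullet> G a = 0" "d \<bullet> G d = 0" using \<open>g = 0\<close> G0[of a] G0[of d] unfolding g_def by linarith+
    then have "\<gamma> i * (v $ i)\<^sup>2 = 0" if "v = a \<or> v = d" for v i
      using that \<gamma>nn unfolding GG by (subst (asm) (1 2) sum_nonneg_eq_0_iff) auto
    then have z: "\<gamma> i * v $ i = 0" if "v = a \<or> v = d" for v i using that by (metis mult_eq_0_iff power2_eq_square)
    then have "G a = 0" "G d = 0" by (simp_all add: G_def vec_eq_iff)
    then have "B *v a = s\<^sup>2 *\<^sub>R a" "B *v d = s\<^sup>2 *\<^sub>R d"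
      unfolding Ba Bd qr qi r by (simp_all add: power2_eq_square)
    moreover have "v $ i = 0" if "v = a \<or> v = d" "idx i = 0 \<or> idx i = CARD('n) - 1" for v i
      using z[OF that(1), of i] \<gamma>[OF that(2)] by simp
    ultimately have "a = 0" "d = 0"
      unfolding B_def using eigenvector_vanishing_at_ends by blast+
    then show False using nz by blast
  qed
qed

end

text \<open>The gap is asserted for \<eta> > 0: without pinning, B annihilates the constant vector,
  and M annihilates the phase vector with all momenta 1 and positions \<open>\<gamma>\<close>. Then
  0 belongs to the spectrum and the infimum cannot be positive.\<close>

theorem theorem3p3:
  fixes idx :: "'n::finite \<Rightarrow> nat" and \<omega> \<eta> :: real and \<gamma> \<theta> :: "'n \<Rightarrow> real"
  assumes "bij_betw idx UNIV {..<CARD('n)}"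
    and "CARD('n) \<ge> 2"
    and "-1/4 < \<omega>" and "\<omega> < 1/4"
    and "\<eta> \<ge> 0"
    and "\<And>i. idx i = 0 \<or> idx i = CARD('n) - 1 \<Longrightarrow> \<gamma> i > 0"
    and "\<And>i. idx i \<noteq> 0 \<Longrightarrow> idx i \<noteq> CARD('n) - 1 \<Longrightarrow> \<gamma> i = 0"
    and "\<And>i. \<theta> i > 0"
  shows "hypoelliptic_FP (Mmat \<gamma> (Bmat idx \<omega> \<eta>)) \<gamma> \<theta>
         \<and> (\<eta> > 0 \<longrightarrow> spectral_gap (Mmat \<gamma> (Bmat idx \<omega> \<eta>)) > 0)"
proof (intro conjI impI)
  interpret chain idx \<omega> \<eta> by unfold_locales (rule assms)+
  let ?M = "Mmat \<gamma> (Bmat idx \<omega> \<eta>)"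
  show "hypoelliptic_FP ?M \<gamma> \<theta>"
  proof (rule hypoelliptic_FP_if_observable)
    fix i
    have "\<gamma> i \<ge> 0"
      using assms(6)[of i] assms(7)[of i] by (cases "idx i = 0 \<or> idx i = CARD('n) - 1") auto
    then show "\<gamma> i * \<theta> i \<ge> 0" using assms(8)[of i] by simp
  next
    fix \<xi> :: "'n phase" assume "\<xi> \<noteq> 0"
    obtain j i where "idx i = 0 \<or> idx i = CARD('n) - 1" "(((*v) ?M ^^ j) \<xi>) $ Inl i \<noteq> 0"
      using observable[where \<gamma> = \<gamma>, OF assms(7) \<open>\<xi> \<noteq> 0\<close>] by blast
    then show "\<exists>j i. \<gamma> i * \<theta> i > 0 \<and> (((*v) ?M ^^ j) \<xi>) $ Inl i \<noteq> 0"
      using mult_pos_pos[OF assms(6,8)] by blast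
  qed
  assume "\<eta> > 0"
  have "finite (Re ` mat_spectrum ?M)" "Re ` mat_spectrum ?M \<noteq> {}"
    using mat_spectrum_finite_nonempty by blast+
  then have "spectral_gap ?M \<in> Re ` mat_spectrum ?M"
    unfolding spectral_gap_def by (metis cInf_eq_Min Min_in)
  then obtain c where c: "c \<in> mat_spectrum ?M" "spectral_gap ?M = Re c" by (elim imageE) simp
  show "spectral_gap ?M > 0"
    unfolding c(2) by (rule spectrum_right_half_plane[OF \<open>\<eta> > 0\<close> assms(6,7) c(1)])
qed

end
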